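(* Let $\Omega$ be a bounded domain of the Heisenberg group $\mathbb{H}^1$ with smooth boundary such that both $\Omega$ and $\mathbb{H}^1\setminus\overline{\Omega}$ satisfy the uniform exterior ball property, and let $\xi$ be any point of $\Omega$. Then $$\lambda_1(\Omega)\le C_\Omega(\xi)\,\frac{l_{11}^2}{r_\Omega^2(\xi)},$$ where $l_{11}$ is the first strictly positive zero of the Bessel function $J_1$ of the first kind and order $1$, $r_\Omega(\xi)$ is the harmonic radius of $\Omega$ at $\xi$, and $$C_\Omega(\xi)=16\sqrt2\,\alpha_\Omega^6(\xi)\,C^2,\qquad C=\left(\frac{3}{2\pi}\right)^{1/4},\qquad \alpha_\Omega(\xi)=\frac{\sup_{\eta\in\partial\Omega}d_{\mathbb{H}^1}(\xi,\eta)}{\inf_{\eta\in\partial\Omega}d_{\mathbb{H}^1}(\xi,\eta)}.$$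
   Context: $\mathbb{H}^1$ is $\mathbb{R}^3$ with coordinates $(x,y,t)$ and group law $(x,y,t)\circ(x_0,y_0,t_0)=(x+x_0,\,y+y_0,\,t+t_0+2(x_0y-xy_0))$. Let $\rho(x,y,t)=((x^2+y^2)^2+t^2)^{1/4}$, $d_{\mathbb{H}^1}(\xi,\eta)=\rho(\xi^{-1}\circ\eta)$, and let $B(\xi,r)=\{\eta: d_{\mathbb{H}^1}(\xi,\eta)<r\}$ (Koranyi ball). Put $X=\partial_x+2y\partial_t$, $Y=\partial_y-2x\partial_t$, $\nabla_{\mathbb{H}^1}u=(Xu)X+(Yu)Y$, $|\nabla_{\mathbb{H}^1}u|^2=(Xu)^2+(Yu)^2$, and $\Delta_{\mathbb{H}^1}=X^2+Y^2$. The volume $dv$ is Lebesgue measure on $\mathbb{R}^3$. Uniform exterior ball property of an open set $D\subset\mathbb{H}^1$: there is $r_0>0$ such that for all $\xi\in\partial D$ and all $r\in\,]0,r_0]$ there is $\eta\in\mathbb{H}^1$ with $B(\eta,r)\cap D=\emptyset$ and $\xi\in\partial B(\eta,r)$. If a bounded domain with smooth boundary and the complement of its closure satisfy this property, then the domain is regular: for every $\varphi\in C(\partial\Omega)$ the problem $\Delta_{\mathbb{H}^1}u=0$ in $\Omega$, $u=\varphi$ on $\partial\Omega$ has a solution $u\in C^2(\Omega)\cap C(\overline\Omega)$. Harmonic radius: let $\Gamma_\xi(\eta)=\frac{1}{8\pi\rho^2(\xi^{-1}\circ\eta)}$ and let $H_\xi\in C^2(\Omega)\cap C(\overline\Omega)$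 be the solution of $\Delta_{\mathbb{H}^1}H_\xi=0$ in $\Omega$, $H_\xi=\Gamma_\xi$ on $\partial\Omega$. Then $r_\Omega(\xi)=\frac{1}{\sqrt{8\pi H_\xi(\xi)}}$. First eigenvalue: $\lambda_1(\Omega)$ is the smallest eigenvalue of the Dirichlet problem $-\Delta_{\mathbb{H}^1}u=\lambda u$ in $\Omega$, $u=0$ on $\partial\Omega$; equivalently $\lambda_1(\Omega)=\inf\left\{\int_\Omega|\nabla_{\mathbb{H}^1}v|^2\,dv\Big/\int_\Omega v^2\,dv\;:\;0\ne v\in S_0^{1,2}(\Omega)\right\}$, where $S_0^{1,2}(\Omega)$ is the completion (closure) of $C_0^\infty(\Omega)$ with respect to the norm $\left(\int_\Omega|\nabla_{\mathbb{H}^1}\varphi|^2\,dv\right)^{1/2}$. *)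

theory Defs
  imports "HOL-Analysis.Analysis"
begin

section \<open>The Heisenberg group\<close>

text \<open>Points are triples \<open>(x, y, t)\<close>; the topology and Lebesgue measure are those of three-dimensional
  Euclidean space, which the product type already carries.\<close>

type_synonym heis = "real \<times> real \<times> real"

fun heis_mult :: "heis \<Rightarrow> heis \<Rightarrow> heis" where
  "heis_mult (x, y, t) (x0, y0, t0) = (x + x0, y + y0, t + t0 + 2 * (x0 * y - x * y0))"

fun heis_inv :: "heis \<Rightarrow> heis" where
  "heis_inv (x, y, t) = (- x, - y, - t)"

lemma heis_mult_inv: "heis_mult (heis_inv p) p = 0" "heis_mult p (heis_inv p) = 0"
  by (cases p; simp add: zero_prod_def)+

fun rho :: "heis \<Rightarrow> real" where
  "rho (x, y, t) = root 4 ((x\<^sup>2 + y\<^sup>2)\<^sup>2 + t\<^sup>2)"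

definition heis_dist :: "heis \<Rightarrow> heis \<Rightarrow> real" where
  "heis_dist \<xi> \<eta> = rho (heis_mult (heis_inv \<xi>) \<eta>)"

definition koranyi_ball :: "heis \<Rightarrow> real \<Rightarrow> heis set" where
  "koranyi_ball \<xi> r = {\<eta>. heis_dist \<xi> \<eta> < r}"


section \<open>Differential operators and smoothness\<close>

definition partial_x :: "(heis \<Rightarrow> real) \<Rightarrow> heis \<Rightarrow> real" where
  "partial_x u p = frechet_derivative u (at p) (1, 0, 0)"

definition partial_y :: "(heis \<Rightarrow> real) \<Rightarrow> heis \<Rightarrow> real" where
  "partial_y u p = frechet_derivative u (at p) (0, 1, 0)"

definition partial_t :: "(heis \<Rightarrow> real) \<Rightarrow> heis \<Rightarrow> real" where
  "partial_t u p = frechet_derivative u (at p) (0, 0, 1)"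

definition hX :: "(heis \<Rightarrow> real) \<Rightarrow> heis \<Rightarrow> real" where
  "hX u = (\<lambda>(x, y, t). partial_x u (x, y, t) + 2 * y * partial_t u (x, y, t))"

definition hY :: "(heis \<Rightarrow> real) \<Rightarrow> heis \<Rightarrow> real" where
  "hY u = (\<lambda>(x, y, t). partial_y u (x, y, t) - 2 * x * partial_t u (x, y, t))"

definition heis_laplacian :: "(heis \<Rightarrow> real) \<Rightarrow> heis \<Rightarrow> real" where
  "heis_laplacian u p = hX (hX u) p + hY (hY u) p"

text \<open>The class \<open>C\<^sup>k\<close> on an open set \<open>U\<close>: all partial derivatives up to order \<open>k\<close> exist and
  are continuous on \<open>U\<close>.\<close>

primrec Ck_on :: "nat \<Rightarrow> 'a::euclidean_space set \<Rightarrow> ('a \<Rightarrow> real) \<Rightarrow> bool" where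
  "Ck_on 0 U f \<longleftrightarrow> continuous_on U f"
| "Ck_on (Suc k) U f \<longleftrightarrow>
     f differentiable_on U \<and> (\<forall>b\<in>Basis. Ck_on k U (\<lambda>p. frechet_derivative f (at p) b))"

definition smooth_on :: "'a::euclidean_space set \<Rightarrow> ('a \<Rightarrow> real) \<Rightarrow> bool" where
  "smooth_on U f \<longleftrightarrow> (\<forall>k. Ck_on k U f)"


section \<open>Domains\<close>

definition bounded_domain :: "heis set \<Rightarrow> bool" where
  "bounded_domain \<Omega> \<longleftrightarrow> open \<Omega> \<and> connected \<Omega> \<and> \<Omega> \<noteq> {} \<and> bounded \<Omega>"

text \<open>Near each boundary point the set is the sublevel set of a smooth function without critical
  points; the boundary is then locally the zero level set of that function.\<close>

definition smooth_boundary :: "heis set \<Rightarrow> bool" where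
  "smooth_boundary \<Omega> \<longleftrightarrow>
     (\<forall>p\<in>frontier \<Omega>. \<exists>U \<phi>. open U \<and> p \<in> U \<and> smooth_on U \<phi> \<and>
        (\<forall>q\<in>U. frechet_derivative \<phi> (at q) \<noteq> (\<lambda>v. 0)) \<and>
        \<Omega> \<inter> U = {q \<in> U. \<phi> q < 0})"

definition uniform_exterior_ball :: "heis set \<Rightarrow> bool" where
  "uniform_exterior_ball D \<longleftrightarrow>
     (\<exists>r0>0. \<forall>\<xi>\<in>frontier D. \<forall>r. 0 < r \<and> r \<le> r0 \<longrightarrow>
        (\<exists>\<eta>. koranyi_ball \<eta> r \<inter> D = {} \<and> \<xi> \<in> frontier (koranyi_ball \<eta> r)))"


section \<open>Harmonic radius\<close>

definition dirichlet_solution :: "heis set \<Rightarrow> (heis \<Rightarrow> real) \<Rightarrow> (heis \<Rightarrow> real) \<Rightarrow> bool" where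
  "dirichlet_solution \<Omega> \<phi> u \<longleftrightarrow>
     Ck_on 2 \<Omega> u \<and> continuous_on (closure \<Omega>) u \<and>
     (\<forall>p\<in>\<Omega>. heis_laplacian u p = 0) \<and> (\<forall>p\<in>frontier \<Omega>. u p = \<phi> p)"

definition Gamma_fund :: "heis \<Rightarrow> heis \<Rightarrow> real" where
  "Gamma_fund \<xi> \<eta> = 1 / (8 * pi * (rho (heis_mult (heis_inv \<xi>) \<eta>))\<^sup>2)"

text \<open>On a regular bounded domain the solution exists and is unique on \<open>closure \<Omega>\<close>; its values
  elsewhere are irrelevant, which is why \<open>SOME\<close> rather than \<open>THE\<close> is used.\<close>

definition H_part :: "heis set \<Rightarrow> heis \<Rightarrow> heis \<Rightarrow> real" where
  "H_part \<Omega> \<xi> = (SOME H. dirichlet_solution \<Omega> (Gamma_fund \<xi>) H)"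

definition harmonic_radius :: "heis set \<Rightarrow> heis \<Rightarrow> real" where
  "harmonic_radius \<Omega> \<xi> = 1 / sqrt (8 * pi * H_part \<Omega> \<xi> \<xi>)"


section \<open>First Dirichlet eigenvalue\<close>

definition test_function :: "heis set \<Rightarrow> (heis \<Rightarrow> real) \<Rightarrow> bool" where
  "test_function \<Omega> \<phi> \<longleftrightarrow>
     smooth_on UNIV \<phi> \<and> compact (closure {p. \<phi> p \<noteq> 0}) \<and> closure {p. \<phi> p \<noteq> 0} \<subseteq> \<Omega>"

definition L2_on :: "heis set \<Rightarrow> (heis \<Rightarrow> real) \<Rightarrow> bool" where
  "L2_on \<Omega> v \<longleftrightarrow> v \<in> borel_measurable (lebesgue_on \<Omega>) \<and> integrable (lebesgue_on \<Omega>) (\<lambda>p. (v p)\<^sup>2)"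

definition L2_tendsto :: "heis set \<Rightarrow> (nat \<Rightarrow> heis \<Rightarrow> real) \<Rightarrow> (heis \<Rightarrow> real) \<Rightarrow> bool" where
  "L2_tendsto \<Omega> f v \<longleftrightarrow> (\<lambda>n. LINT p|lebesgue_on \<Omega>. (f n p - v p)\<^sup>2) \<longlonglongrightarrow> 0"

text \<open>\<open>S0_12 \<Omega> v a b\<close>: the function \<open>v\<close> belongs to \<open>S\<^sub>0\<^sup>1\<^sup>,\<^sup>2(\<Omega>)\<close> and \<open>(a, b)\<close> is its horizontal gradient
  \<open>(X v, Y v)\<close>.  Elements of the completion of the test functions are represented concretely: on a
  bounded open set the Poincare inequality makes a sequence that is Cauchy in the norm
  \<open>\<phi> \<mapsto> (\<integral> (X \<phi>)\<^sup>2 + (Y \<phi>)\<^sup>2)\<^sup>1\<^sup>/\<^sup>2\<close> Cauchy in \<open>L\<^sup>2\<close> too, and the limits of \<open>X \<phi>\<^sub>n\<close>, \<open>Y \<phi>\<^sub>n\<close> are the weak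
  derivatives of the limit of \<open>\<phi>\<^sub>n\<close>, hence determined by it almost everywhere.\<close>

definition S0_12 ::
  "heis set \<Rightarrow> (heis \<Rightarrow> real) \<Rightarrow> (heis \<Rightarrow> real) \<Rightarrow> (heis \<Rightarrow> real) \<Rightarrow> bool" where
  "S0_12 \<Omega> v a b \<longleftrightarrow> L2_on \<Omega> v \<and> L2_on \<Omega> a \<and> L2_on \<Omega> b \<and>
     (\<exists>\<phi>. (\<forall>n. test_function \<Omega> (\<phi> n)) \<and> L2_tendsto \<Omega> \<phi> v \<and>
          L2_tendsto \<Omega> (\<lambda>n. hX (\<phi> n)) a \<and> L2_tendsto \<Omega> (\<lambda>n. hY (\<phi> n)) b)"

definition lambda1 :: "heis set \<Rightarrow> real" where
  "lambda1 \<Omega> = Inf {(LINT p|lebesgue_on \<Omega>. (a p)\<^sup>2 + (b p)\<^sup>2) / (LINT p|lebesgue_on \<Omega>. (v p)\<^sup>2) |v a b.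
      S0_12 \<Omega> v a b \<and> \<not> (AE p in lebesgue_on \<Omega>. v p = 0)}"


section \<open>The constants in the estimate\<close>

definition bessel_J :: "nat \<Rightarrow> real \<Rightarrow> real" where
  "bessel_J m x = (\<Sum>k. (- 1) ^ k / (fact k * fact (k + m)) * (x / 2) ^ (2 * k + m))"

definition l11 :: real where
  "l11 = (LEAST x. 0 < x \<and> bessel_J 1 x = 0)"

definition alpha_ratio :: "heis set \<Rightarrow> heis \<Rightarrow> real" where
  "alpha_ratio \<Omega> \<xi> = (SUP \<eta>\<in>frontier \<Omega>. heis_dist \<xi> \<eta>) / (INF \<eta>\<in>frontier \<Omega>. heis_dist \<xi> \<eta>)"

definition C_heis :: real where
  "C_heis = root 4 (3 / (2 * pi))"

definition C_const :: "heis set \<Rightarrow> heis \<Rightarrow> real" where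
  "C_const \<Omega> \<xi> = 16 * sqrt 2 * alpha_ratio \<Omega> \<xi> ^ 6 * C_heis\<^sup>2"

end

theory Submission
  imports Defs "HOL-Complex_Analysis.Great_Picard"
begin

text \<open>
  Let \<open>d\<close> and \<open>D\<close> be the smallest and the largest distance from \<open>\<xi>\<close> to the boundary, so that
  \<open>\<alpha> = D / d\<close>.  Two comparisons prove the estimate.  The boundary values of the harmonic part
  \<open>H\<close> are at least \<open>1 / (8 \<pi> D\<^sup>2)\<close>, so the minimum principle
  (\<open>dirichlet_minimum_principle\<close>) gives the same bound for \<open>H \<xi>\<close>, that is, the reciprocal of the
  squared harmonic radius is at least \<open>1 / D\<^sup>2\<close>.  On the other side \<open>\<Omega>\<close> contains the Koranyi ball of
  radius \<open>d\<close> about \<open>\<xi>\<close>, and a bump function supported in a slightly smaller ball shows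
  that the first eigenvalue is at most \<open>180 / d\<^sup>2\<close> (\<open>lambda1_le\<close>).
  As \<open>\<alpha>\<^sup>6 / D\<^sup>2 \<ge> 1 / d\<^sup>2\<close>, it remains to compare numbers: \<open>16 \<surd>2 C\<^sup>2 \<ge> 15.52\<close>, and an
  alternating series estimate gives \<open>l\<^sub>1\<^sub>1\<^sup>2 \<ge> 12\<close> (\<open>l11_square_ge\<close>); their product exceeds \<open>180\<close>.

  The harmonic part is chosen among the solutions of a Dirichlet problem, so all this has content only
  once a solution is known to exist; \<open>dirichlet_solution_exists\<close> provides it and is the main work.
  The solution is a limit of value functions of random walks: for a step size \<open>s\<close> let \<open>u\<^sub>s\<close>
  agree with the boundary data off \<open>\<Omega>\<close> and satisfy on \<open>\<Omega>\<close>
  that \<open>u\<^sub>s p\<close> is the mean of \<open>u\<^sub>s\<close> at the four points \<open>p \<cdot> (\<plusminus>s, 0, 0)\<close>, \<open>p \<cdot> (0, \<plusminus>s, 0)\<close>.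
  \<^item> An exterior Koranyi ball is strictly convex in the Euclidean sense, and the sub-Laplacians of the gauge
    \<open>N = |z|\<^sup>4 + t\<^sup>2\<close>, of its reciprocal and of affine functions are explicit; combining these three
    gives a barrier at each boundary point, characteristic or not (\<open>barrier_exists\<close>).  Hence \<open>u\<^sub>s\<close>
    is close to the data near the boundary, uniformly in small \<open>s\<close> (\<open>boundary_uniform\<close>).
  \<^item> The averaging commutes with left translations, so the difference of \<open>u\<^sub>s\<close> and a left
    translate obeys the maximum principle, and closeness at the boundary propagates inside:
    the \<open>u\<^sub>s\<close> are asymptotically equicontinuous (\<open>dpp_equicontinuous\<close>) and converge along a
    subsequence to a continuous function (\<open>dpp_limit\<close>).
  \<^item> The averaging is symmetric for Lebesgue measure, which is bi-invariant, so the limit is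
    weakly harmonic (\<open>weakly_harmonic_limit\<close>).
  \<^item> Replacing the fundamental solution \<open>N\<^sup>-\<^sup>1\<^sup>/\<^sup>2\<close> near its pole by a polynomial in \<open>N\<close> gives test
    functions that turn weak harmonicity into a mean value formula with an explicit \<open>C\<^sup>2\<close> kernel
    (\<open>mean_value\<close>), and differentiation under the integral shows that the limit is a classical solution
    (\<open>weakly_harmonic_smooth\<close>).
\<close>

section \<open>Calculus of \<open>C\<^sup>k\<close> functions\<close>

lemma Ck_on_has_derivative:
  assumes "open U" "Ck_on (Suc k) U f" "p \<in> U"
  shows "(f has_derivative frechet_derivative f (at p)) (at p)"
  using assms by (auto simp: differentiable_on_eq_differentiable_at frechet_derivative_works[symmetric])

lemma Ck_on_cong:
  assumes "open U" "Ck_on k U f" "\<And>p. p \<in> U \<Longrightarrow> f p = g p"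
  shows "Ck_on k U g"
  using assms(2,3)
proof (induction k arbitrary: f g)
  case 0
  then show ?case using continuous_on_cong[of U U f g] by simp
next
  case (Suc k)
  have der: "(g has_derivative frechet_derivative f (at p)) (at p)" if "p \<in> U" for p
    using has_derivative_transform_within_open[OF
        Ck_on_has_derivative[OF assms(1) Suc.prems(1) that] assms(1) that] Suc.prems(2) by auto
  then have d: "g differentiable_on U"
    by (meson differentiable_at_withinI differentiable_def differentiable_on_def)
  have e: "frechet_derivative f (at p) = frechet_derivative g (at p)" if "p \<in> U" for p
    using frechet_derivative_at[OF der[OF that]] .
  have "Ck_on k U (\<lambda>p. frechet_derivative g (at p) b)" if "b \<in> Basis" for b
    by (rule Suc.IH[of "\<lambda>p. frechet_derivative f (at p) b"]) (use Suc.prems that e in auto)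
  with d show ?case by simp
qed

text \<open>Any family of derivatives may be supplied; uniqueness identifies it with the Frechet derivative
  that the definition of \<open>C\<^sup>k\<close> mentions.\<close>

lemma Ck_on_Suc_intro:
  assumes "open U"
    and der: "\<And>p. p \<in> U \<Longrightarrow> (f has_derivative f' p) (at p)"
    and "\<And>b. b \<in> Basis \<Longrightarrow> Ck_on k U (\<lambda>p. f' p b)"
  shows "Ck_on (Suc k) U f"
proof -
  have d: "f differentiable_on U"
    using der by (meson differentiable_at_withinI differentiable_def differentiable_on_def)
  have "Ck_on k U (\<lambda>p. frechet_derivative f (at p) b)" if "b \<in> Basis" for b
    by (rule Ck_on_cong[OF assms(1) assms(3)[OF that]]) (simp add: frechet_derivative_at[OF der, symmetric])
  with d show ?thesis by simp
qed

lemma Ck_on_continuous: "Ck_on k U f \<Longrightarrow> continuous_on U f"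
  by (cases k) (auto intro: differentiable_imp_continuous_on)

lemma Ck_on_Suc_imp: "Ck_on (Suc k) U f \<Longrightarrow> Ck_on k U f"
proof (induction k arbitrary: f)
  case 0
  then show ?case using Ck_on_continuous[of "Suc 0" U f] by simp
next
  case (Suc k)
  then show ?case using Suc.IH by simp
qed

lemma Ck_on_Suc_frechet:
  "Ck_on (Suc k) U f \<Longrightarrow> b \<in> Basis \<Longrightarrow> Ck_on k U (\<lambda>p. frechet_derivative f (at p) b)"
  by simp

lemma Ck_on_const: "open U \<Longrightarrow> Ck_on k U (\<lambda>p. c)"
proof (induction k arbitrary: c)
  case (Suc k)
  show ?case
    by (rule Ck_on_Suc_intro[where f' = "\<lambda>_ _. 0"]) (use Suc in auto)
qed auto

lemma Ck_on_bounded_linear: "open U \<Longrightarrow> bounded_linear l \<Longrightarrow> Ck_on k U l"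
proof (cases k)
  case 0
  assume "bounded_linear l"
  then show ?thesis using 0 by (simp add: linear_continuous_on)
next
  case (Suc n)
  assume "open U" "bounded_linear l"
  then show ?thesis unfolding Suc
    by (intro Ck_on_Suc_intro[where f' = "\<lambda>_. l"] Ck_on_const)
       (auto intro: bounded_linear_imp_has_derivative)
qed

lemma Ck_on_add:
  assumes "open U" "Ck_on k U f" "Ck_on k U g"
  shows "Ck_on k U (\<lambda>p. f p + g p)"
  using assms(2,3)
proof (induction k arbitrary: f g)
  case 0
  then show ?case by (auto intro: continuous_intros)
next
  case (Suc k)
  show ?case
  proof (rule Ck_on_Suc_intro[where f' = "\<lambda>p v. frechet_derivative f (at p) v + frechet_derivative g (at p) v", OF assms(1)])
    show "((\<lambda>p. f p + g p) has_derivative (\<lambda>v. frechet_derivative f (at p) v + frechet_derivative g (at p) v)) (at p)"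
      if "p \<in> U" for p
      by (intro has_derivative_add Ck_on_has_derivative[OF assms(1) Suc.prems(1) that]
            Ck_on_has_derivative[OF assms(1) Suc.prems(2) that])
    show "Ck_on k U (\<lambda>p. frechet_derivative f (at p) b + frechet_derivative g (at p) b)"
      if "b \<in> Basis" for b
      by (intro Suc.IH Ck_on_Suc_frechet Suc.prems that)
  qed
qed

lemma Ck_on_mult:
  assumes "open U" "Ck_on k U f" "Ck_on k U g"
  shows "Ck_on k U (\<lambda>p. f p * g p)"
  using assms(2,3)
proof (induction k arbitrary: f g)
  case 0
  then show ?case by (auto intro: continuous_intros)
next
  case (Suc k)
  show ?case
  proof (rule Ck_on_Suc_intro[where f' = "\<lambda>p v. f p * frechet_derivative g (at p) v + frechet_derivative f (at p) v * g p", OF assms(1)])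
    show "((\<lambda>p. f p * g p) has_derivative (\<lambda>v. f p * frechet_derivative g (at p) v + frechet_derivative f (at p) v * g p)) (at p)"
      if "p \<in> U" for p
      by (intro has_derivative_mult Ck_on_has_derivative[OF assms(1) Suc.prems(1) that]
            Ck_on_has_derivative[OF assms(1) Suc.prems(2) that])
    show "Ck_on k U (\<lambda>p. f p * frechet_derivative g (at p) b + frechet_derivative f (at p) b * g p)"
      if "b \<in> Basis" for b
      by (intro Ck_on_add[OF assms(1)] Suc.IH Ck_on_Suc_frechet Suc.prems that
            Suc.prems[THEN Ck_on_Suc_imp])
  qed
qed

lemma Ck_on_power: "open U \<Longrightarrow> Ck_on k U f \<Longrightarrow> Ck_on k U (\<lambda>p. f p ^ n)"
proof (induction n)
  case 0
  then show ?case by (simp add: Ck_on_const)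
next
  case (Suc n)
  then show ?case using Ck_on_mult[of U k f "\<lambda>p. f p ^ n"] by simp
qed

lemma Ck_on_minus: "open U \<Longrightarrow> Ck_on k U f \<Longrightarrow> Ck_on k U (\<lambda>p. - f p)"
  using Ck_on_mult[OF _ Ck_on_const[of U k "-1"], of f] by simp

lemma Ck_on_diff: "open U \<Longrightarrow> Ck_on k U f \<Longrightarrow> Ck_on k U g \<Longrightarrow> Ck_on k U (\<lambda>p. f p - g p)"
  using Ck_on_add[OF _ _ Ck_on_minus, of U k f g] by simp

lemmas Ck_on_intros = Ck_on_const Ck_on_add Ck_on_diff Ck_on_minus Ck_on_mult Ck_on_power

lemma Ck_on_mono: "Ck_on k U f \<Longrightarrow> V \<subseteq> U \<Longrightarrow> Ck_on k V f"
proof (induction k arbitrary: f)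
  case 0
  then show ?case using continuous_on_subset[of U f V] by simp
next
  case (Suc k)
  then show ?case using differentiable_on_subset[of f U V] by simp
qed

text \<open>Being \<open>C\<^sup>k\<close> is a local property, which lets the regularity of the solution be proved near one point
  at a time.\<close>

lemma Ck_on_Union:
  assumes "\<And>p. p \<in> U \<Longrightarrow> \<exists>V. open V \<and> p \<in> V \<and> Ck_on k V f"
  shows "Ck_on k U f"
  using assms
proof (induction k arbitrary: f)
  case 0
  show ?case unfolding Ck_on.simps
  proof (rule continuous_at_imp_continuous_on, rule ballI)
    fix p assume "p \<in> U"
    then obtain V where V: "open V" "p \<in> V" "Ck_on 0 V f" using 0 by blast
    then show "continuous (at p) f" by (simp add: continuous_on_eq_continuous_at)
  qed
next
  case (Suc k)
  have "f differentiable_on U"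
    unfolding differentiable_on_def
  proof
    fix p assume "p \<in> U"
    then obtain V where "open V" "p \<in> V" "Ck_on (Suc k) V f" using Suc.prems by blast
    then have "f differentiable (at p)" by (simp add: differentiable_on_eq_differentiable_at)
    then show "f differentiable (at p within U)" by (rule differentiable_at_withinI)
  qed
  moreover have "Ck_on k U (\<lambda>p. frechet_derivative f (at p) b)" if "b \<in> Basis" for b
  proof (rule Suc.IH)
    fix p assume "p \<in> U"
    then obtain V where "open V" "p \<in> V" "Ck_on (Suc k) V f" using Suc.prems by blast
    then show "\<exists>V. open V \<and> p \<in> V \<and> Ck_on k V (\<lambda>p. frechet_derivative f (at p) b)"
      using that Ck_on_Suc_frechet by blast
  qed
  ultimately show ?case by simp
qed

text \<open>The outer function is given with the list of its derivatives, so that functions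
  glued from two formulas can be used as soon as finitely many of their derivatives match.\<close>

lemma Ck_on_compose:
  fixes G :: "nat \<Rightarrow> real \<Rightarrow> real"
  assumes U: "open U" and f: "Ck_on k U f" "\<And>p. p \<in> U \<Longrightarrow> f p \<in> I"
    and der: "\<And>i y. i < k \<Longrightarrow> y \<in> I \<Longrightarrow> (G i has_real_derivative G (Suc i) y) (at y)"
    and cont: "continuous_on I (G k)"
  shows "Ck_on k U (\<lambda>p. G 0 (f p))"
  using f der cont
proof (induction k arbitrary: G f)
  case 0
  have "continuous_on U (\<lambda>p. G 0 (f p))"
    using continuous_on_compose2[OF 0(4), of U f] 0 by auto
  then show ?case by simp
next
  case (Suc k)
  show ?case
  proof (rule Ck_on_Suc_intro[OF U, where f' = "\<lambda>p v. G (Suc 0) (f p) * frechet_derivative f (at p) v"])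
    fix p assume p: "p \<in> U"
    have "(G 0 has_derivative (*) (G (Suc 0) (f p))) (at (f p))"
      using Suc.prems(3)[of 0 "f p"] Suc.prems(2)[OF p] by (simp add: has_field_derivative_def)
    from has_derivative_compose[OF Ck_on_has_derivative[OF U Suc.prems(1) p] this]
    show "((\<lambda>p. G 0 (f p)) has_derivative (\<lambda>v. G (Suc 0) (f p) * frechet_derivative f (at p) v)) (at p)" .
  next
    fix b :: 'a assume b: "b \<in> Basis"
    have "Ck_on k U (\<lambda>p. G (Suc 0) (f p))"
    proof (rule Suc.IH[of f "\<lambda>i. G (Suc i)"])
      show "Ck_on k U f" using Suc.prems(1) by (rule Ck_on_Suc_imp)
    qed (use Suc.prems in auto)
    then show "Ck_on k U (\<lambda>p. G (Suc 0) (f p) * frechet_derivative f (at p) b)"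
      by (intro Ck_on_mult U Ck_on_Suc_frechet Suc.prems(1) b)
  qed
qed

text \<open>Differentiation under the integral sign.  Viewing the kernel as one function on the product space makes its
  parameter derivatives kernels of the same kind, so the induction on the order is immediate.\<close>

lemma Ck_on_parametric_integral:
  fixes k :: "'b::euclidean_space \<times> 'a::euclidean_space \<Rightarrow> real"
  assumes "Ck_on n UNIV k" and u: "continuous_on (cbox a b) u"
  shows "Ck_on n UNIV (\<lambda>p. integral (cbox a b) (\<lambda>q. u q * k (q, p)))"
  using assms(1)
proof (induction n arbitrary: k)
  case 0
  then have k: "continuous_on UNIV k" by simp
  have "continuous_on (UNIV \<times> cbox a b) (\<lambda>(p, q). u q * k (q, p))"
    unfolding case_prod_unfold
    by (intro continuous_intros continuous_on_compose2[OF u] continuous_on_compose2[OF k]) auto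
  then show ?case
    by (simp add: integral_continuous_on_param)
next
  case (Suc n)
  note k1 = Suc.prems
  define D where "D = (\<lambda>c q p. frechet_derivative k (at (q, p)) (0, c))"
  define F where "F = (\<lambda>p q. \<Sum>c\<in>Basis. (u q * D c q p) *\<^sub>R blinfun_inner_left (c::'a))"
  have kd: "(k has_derivative frechet_derivative k (at z)) (at z)" for z
    by (rule Ck_on_has_derivative[OF _ k1]) auto
  have D: "Ck_on n UNIV (\<lambda>z. frechet_derivative k (at z) (0, c))" if "c \<in> Basis" for c :: 'a
    by (rule Ck_on_Suc_frechet[OF k1]) (use that in \<open>auto simp: Basis_prod_def\<close>)
  have Dcont: "continuous_on UNIV (\<lambda>z. frechet_derivative k (at z) (0, c))" if "c \<in> Basis" for c :: 'a
    by (rule Ck_on_continuous[OF D[OF that]])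
  have Fder: "((\<lambda>p. u q * k (q, p)) has_derivative blinfun_apply (F p q)) (at p)" for p q
  proof -
    have "((\<lambda>p. (q, p)) has_derivative (\<lambda>v. (0, v))) (at p)"
      by (auto intro!: derivative_eq_intros)
    from has_derivative_compose[OF this kd]
    have d: "((\<lambda>p. k (q, p)) has_derivative (\<lambda>v. frechet_derivative k (at (q, p)) (0, v))) (at p)" .
    have lin: "linear (\<lambda>v. frechet_derivative k (at (q, p)) (0, v))"
      using has_derivative_linear[OF d] .
    have "u q * frechet_derivative k (at (q, p)) (0, v) = blinfun_apply (F p q) v" for v
    proof -
      have "frechet_derivative k (at (q, p)) (0, v) = (\<Sum>c\<in>Basis. (v \<bullet> c) * D c q p)"
        using linear_sum[OF lin, of "\<lambda>c. (v \<bullet> c) *\<^sub>R c" Basis] linear_cmul[OF lin]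
        by (simp add: euclidean_representation D_def)
      then show ?thesis
        by (simp add: F_def blinfun.sum_left blinfun.scaleR_left sum_distrib_left mult_ac)
    qed
    then have "(\<lambda>v. u q * frechet_derivative k (at (q, p)) (0, v)) = blinfun_apply (F p q)" by auto
    then show ?thesis
      using has_derivative_mult_right[OF d, of "u q"] by simp
  qed
  have Fcont: "continuous_on (UNIV \<times> cbox a b) (\<lambda>(p, q). F p q)"
    unfolding case_prod_unfold F_def D_def
    by (intro continuous_intros continuous_on_compose2[OF u] continuous_on_compose2[OF Dcont]) auto
  have int: "(\<lambda>q. u q * k (q, p)) integrable_on cbox a b" for p
    by (intro integrable_continuous continuous_intros u
          continuous_on_compose2[OF Ck_on_continuous[OF k1]]) auto
  have der: "((\<lambda>p. integral (cbox a b) (\<lambda>q. u q * k (q, p))) has_derivative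
        blinfun_apply (integral (cbox a b) (F p))) (at p)" for p
    using leibniz_rule[of UNIV a b "\<lambda>p q. u q * k (q, p)" F p] Fder int Fcont by auto
  have "blinfun_apply (integral (cbox a b) (F p)) c = integral (cbox a b) (\<lambda>q. u q * frechet_derivative k (at (q, p)) (0, c))"
    if c: "c \<in> Basis" for p c
  proof -
    have "continuous_on (cbox a b) (\<lambda>q. (p, q))"
      by (intro continuous_on_Pair continuous_on_const continuous_on_id)
    moreover have "(\<lambda>q. (p, q)) ` cbox a b \<subseteq> UNIV \<times> cbox a b"
      by auto
    ultimately have "continuous_on (cbox a b) (F p)"
      using continuous_on_compose2[OF Fcont, of "cbox a b" "\<lambda>q. (p, q)"] by simp
    then have "F p integrable_on cbox a b" by (rule integrable_continuous)
    from integral_linear[OF this bounded_linear_apply_blinfun, of c] 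
    have "blinfun_apply (integral (cbox a b) (F p)) c = integral (cbox a b) (\<lambda>q. blinfun_apply (F p q) c)"
      by (simp add: o_def)
    also have "(\<lambda>q. blinfun_apply (F p q) c) = (\<lambda>q. u q * D c q p)"
      using c by (simp add: F_def blinfun.sum_left blinfun.scaleR_left inner_Basis
           if_distrib[of "\<lambda>x. _ * x"] cong: if_cong)
    finally show ?thesis by (simp add: D_def)
  qed
  then show ?case
    by (intro Ck_on_Suc_intro[OF _ der]) (use Suc.IH[OF D] in auto)
qed

section \<open>Horizontal derivatives along one-parameter subgroups\<close>

abbreviation hprod :: "heis \<Rightarrow> heis \<Rightarrow> heis" (infixl "\<star>" 70) where
  "p \<star> q \<equiv> heis_mult p q"

lemma hprod_assoc: "(p \<star> q) \<star> r = p \<star> (q \<star> r)"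
  by (cases p; cases q; cases r) (simp add: algebra_simps)

lemma hprod_0 [simp]: "p \<star> (0, 0, 0) = p" "(0, 0, 0) \<star> p = p" "p \<star> 0 = p" "0 \<star> p = p"
  by (cases p; simp add: zero_prod_def)+

lemma heis_inv_inv [simp]: "heis_inv (heis_inv p) = p"
  by (cases p) simp

lemma hprod_inv_cancel [simp]:
  "heis_inv p \<star> (p \<star> q) = q" "p \<star> (heis_inv p \<star> q) = q"
  by (cases p; cases q; simp add: algebra_simps)+

lemma heis_inv_hprod: "heis_inv (p \<star> q) = heis_inv q \<star> heis_inv p"
  by (cases p; cases q) (simp add: algebra_simps)

lemma hprod_eq: "p \<star> q = (fst p + fst q, fst (snd p) + fst (snd q),
    snd (snd p) + snd (snd q) + 2 * (fst q * fst (snd p) - fst p * fst (snd q)))"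
  by (cases p; cases q) simp

lemma heis_inv_eq: "heis_inv p = - p"
  by (cases p) simp

lemma continuous_on_hprod [continuous_intros]:
  "continuous_on S f \<Longrightarrow> continuous_on S g \<Longrightarrow> continuous_on S (\<lambda>x. f x \<star> g x)"
  unfolding hprod_eq by (intro continuous_intros)

lemma continuous_on_heis_inv [continuous_intros]:
  "continuous_on S f \<Longrightarrow> continuous_on S (\<lambda>x. heis_inv (f x))"
  unfolding heis_inv_eq by (intro continuous_intros)

text \<open>The field \<open>a X + b Y\<close>.\<close>

definition horiz :: "real \<Rightarrow> real \<Rightarrow> heis \<Rightarrow> heis" where
  "horiz a b p = (a, b, 2 * (a * fst (snd p) - b * fst p))"

text \<open>Right multiplication by a horizontal element moves a point along a Euclidean straight line; this is why
  derivatives along left-invariant horizontal fields are ordinary one-variable derivatives.\<close>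

lemma hprod_horizontal: "p \<star> (s * a, s * b, 0) = p + s *\<^sub>R horiz a b p"
  by (cases p) (simp add: horiz_def algebra_simps)

definition hdiff :: "real \<Rightarrow> real \<Rightarrow> (heis \<Rightarrow> real) \<Rightarrow> heis \<Rightarrow> real" where
  "hdiff a b f p = frechet_derivative f (at p) (horiz a b p)"

lemma hdiff_partials:
  assumes "f differentiable (at p)"
  shows "hdiff a b f p = a * partial_x f p + b * partial_y f p
      + 2 * (a * fst (snd p) - b * fst p) * partial_t f p"
proof -
  have lin: "linear (frechet_derivative f (at p))"
    using assms by (rule linear_frechet_derivative)
  have "horiz a b p = a *\<^sub>R (1, 0, 0) + b *\<^sub>R (0, 1, 0) + (2 * (a * fst (snd p) - b * fst p)) *\<^sub>R (0, 0, 1)"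
    by (simp add: horiz_def)
  then show ?thesis
    unfolding hdiff_def partial_x_def partial_y_def partial_t_def
    by (simp only: linear_add[OF lin] linear_cmul[OF lin] real_scaleR_def)
qed

lemma hX_hdiff: "f differentiable (at p) \<Longrightarrow> hX f p = hdiff 1 0 f p"
  by (cases p) (simp add: hdiff_partials hX_def)

lemma hY_hdiff: "f differentiable (at p) \<Longrightarrow> hY f p = hdiff 0 1 f p"
  by (cases p) (simp add: hdiff_partials hY_def)

lemma Ck_on_fst: "open U \<Longrightarrow> Ck_on k U (\<lambda>p::heis. fst p)"
  by (rule Ck_on_bounded_linear) (auto intro: bounded_linear_fst)

lemma Ck_on_fst_snd: "open U \<Longrightarrow> Ck_on k U (\<lambda>p::heis. fst (snd p))"
  by (rule Ck_on_bounded_linear) (auto intro: bounded_linear_fst bounded_linear_snd bounded_linear_compose)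

lemma Ck_on_snd_snd: "open U \<Longrightarrow> Ck_on k U (\<lambda>p::heis. snd (snd p))"
  by (rule Ck_on_bounded_linear) (auto intro: bounded_linear_snd bounded_linear_compose)

lemma Ck_on_hdiff:
  assumes U: "open U" and f: "Ck_on (Suc k) U f"
  shows "Ck_on k U (hdiff a b f)"
proof -
  have P: "Ck_on k U (partial_x f)" "Ck_on k U (partial_y f)" "Ck_on k U (partial_t f)"
    unfolding partial_x_def[abs_def] partial_y_def[abs_def] partial_t_def[abs_def]
    by (rule Ck_on_Suc_frechet[OF f]; simp add: Basis_prod_def zero_prod_def)+
  have "Ck_on k U (\<lambda>p. a * partial_x f p + b * partial_y f p
      + 2 * (a * fst (snd p) - b * fst p) * partial_t f p)"
    by (intro Ck_on_intros U P Ck_on_fst Ck_on_fst_snd)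
  moreover have "f differentiable (at p)" if "p \<in> U" for p
    using f U that by (simp add: differentiable_on_eq_differentiable_at)
  ultimately show ?thesis
    by (elim Ck_on_cong[OF U]) (simp add: hdiff_partials)
qed

lemma Ck_on_Suc_differentiable:
  "open U \<Longrightarrow> Ck_on (Suc k) U f \<Longrightarrow> p \<in> U \<Longrightarrow> f differentiable (at p)"
  by (simp add: differentiable_on_eq_differentiable_at)

lemma hdiff_cong:
  assumes "open U" "p \<in> U" "\<And>q. q \<in> U \<Longrightarrow> f q = g q" "f differentiable (at p)"
  shows "hdiff a b f p = hdiff a b g p"
proof -
  have "(f has_derivative frechet_derivative f (at p)) (at p)"
    using assms(4) by (simp add: frechet_derivative_works)
  then have "(g has_derivative frechet_derivative f (at p)) (at p)"
    by (rule has_derivative_transform_within_open[OF _ assms(1,2)]) (use assms(3) in auto)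
  from frechet_derivative_at[OF this] show ?thesis by (simp add: hdiff_def)
qed

lemma heis_laplacian_hdiff:
  assumes U: "open U" and f: "Ck_on 2 U f" and p: "p \<in> U"
  shows "heis_laplacian f p = hdiff 1 0 (hdiff 1 0 f) p + hdiff 0 1 (hdiff 0 1 f) p"
proof -
  have f': "Ck_on (Suc (Suc 0)) U f" using f by (simp add: numeral_2_eq_2)
  have d: "\<And>q. q \<in> U \<Longrightarrow> f differentiable (at q)"
    using Ck_on_Suc_differentiable[OF U f'] .
  have d2: "hdiff a b f differentiable (at p)" for a b
    by (rule Ck_on_Suc_differentiable[OF U Ck_on_hdiff[OF U f'] p])
  have tr: "g differentiable (at p)"
    if "h differentiable (at p)" "\<And>q. q \<in> U \<Longrightarrow> h q = g q" for g h :: "heis \<Rightarrow> real"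
    using that U p unfolding differentiable_def
    by (meson has_derivative_transform_within_open)
  have "hX f differentiable (at p)" "hY f differentiable (at p)"
    using tr[OF d2[of 1 0], of "hX f"] tr[OF d2[of 0 1], of "hY f"] hX_hdiff[OF d] hY_hdiff[OF d]
    by auto
  moreover have "hdiff 1 0 (hX f) p = hdiff 1 0 (hdiff 1 0 f) p"
    by (rule hdiff_cong[OF U p, symmetric]) (use d d2 hX_hdiff in auto)
  moreover have "hdiff 0 1 (hY f) p = hdiff 0 1 (hdiff 0 1 f) p"
    by (rule hdiff_cong[OF U p, symmetric]) (use d d2 hY_hdiff in auto)
  ultimately show ?thesis
    by (simp add: heis_laplacian_def hX_hdiff hY_hdiff)
qed

lemma horiz_translate: "horiz a b (p \<star> (s * a, s * b, 0)) = horiz a b p"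
  by (cases p) (simp add: horiz_def algebra_simps)

text \<open>The direction \<open>horiz a b\<close> does not change along its own integral line (\<open>horiz_translate\<close>), so the formula holds
  at every point of the line and can be iterated.\<close>

lemma hdiff_along_line:
  assumes "f differentiable (at (p \<star> (s * a, s * b, 0)))"
  shows "((\<lambda>s. f (p \<star> (s * a, s * b, 0))) has_real_derivative hdiff a b f (p \<star> (s * a, s * b, 0))) (at s)"
proof -
  let ?q = "p \<star> (s * a, s * b, 0)"
  have "(f has_derivative frechet_derivative f (at ?q)) (at ?q)"
    using assms by (simp add: frechet_derivative_works)
  moreover have "((\<lambda>s. p \<star> (s * a, s * b, 0)) has_derivative (\<lambda>h. h *\<^sub>R horiz a b p)) (at s)"
    unfolding hprod_horizontal by (auto intro!: derivative_eq_intros)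
  ultimately have "((\<lambda>s. f (p \<star> (s * a, s * b, 0))) has_derivative
      (\<lambda>h. frechet_derivative f (at ?q) (h *\<^sub>R horiz a b p))) (at s)"
    by (rule has_derivative_compose[rotated])
  moreover have "frechet_derivative f (at ?q) (h *\<^sub>R horiz a b p) = hdiff a b f ?q * h" for h
    using linear_cmul[OF linear_frechet_derivative[OF assms]]
    by (simp add: hdiff_def horiz_translate)
  ultimately show ?thesis by (simp add: has_field_derivative_def)
qed

text \<open>Taylor expansion along the integral lines; the uniformity comes from uniform continuity of the second
  horizontal derivative on a compact neighbourhood.\<close>

lemma second_difference_uniform:
  assumes U: "open U" and f: "Ck_on 2 U f" and C: "compact C" "C \<subseteq> U" and \<kappa>: "\<kappa> > 0"
  shows "\<exists>s0>0. \<forall>s p. 0 < s \<longrightarrow> s < s0 \<longrightarrow> p \<in> C \<longrightarrow>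
     \<bar>(f (p \<star> (s * a, s * b, 0)) + f (p \<star> (- s * a, - s * b, 0)) - 2 * f p) / s\<^sup>2 - hdiff a b (hdiff a b f) p\<bar> \<le> \<kappa>"
proof -
  let ?l = "\<lambda>p \<sigma>. p \<star> (\<sigma> * a, \<sigma> * b, 0)"
  let ?h = "hdiff a b (hdiff a b f)"
  have f2: "Ck_on (Suc (Suc 0)) U f" using f by (simp add: numeral_2_eq_2)
  note f1 = Ck_on_hdiff[OF U f2, of a b]
  have h: "continuous_on U ?h" using Ck_on_hdiff[OF U f1] by simp
  obtain e where e: "e > 0" "\<And>x. x \<in> C \<Longrightarrow> cball x e \<subseteq> U"
    by (rule compact_subset_open_imp_cball_epsilon_subset[OF C(1) U C(2)]) blast
  have "continuous_on C (horiz a b)" unfolding horiz_def by (intro continuous_intros)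
  then have "bounded (horiz a b ` C)" using C(1) by (simp add: compact_imp_bounded compact_continuous_image)
  then obtain M where M: "M > 0" "\<And>p. p \<in> C \<Longrightarrow> norm (horiz a b p) \<le> M"
    unfolding bounded_pos by auto
  define s1 where "s1 = e / M"
  have s1: "s1 > 0" using e M by (simp add: s1_def)
  have inU: "?l p \<sigma> \<in> U" if "p \<in> C" "\<bar>\<sigma>\<bar> \<le> s1" for p \<sigma>
  proof -
    have "norm (\<sigma> *\<^sub>R horiz a b p) \<le> s1 * M"
      using that M(2)[OF that(1)] s1 by (simp add: mult_mono)
    then have "?l p \<sigma> \<in> cball p e"
      using M(1) by (simp add: hprod_horizontal dist_norm s1_def)
    then show ?thesis using e(2)[OF that(1)] by auto
  qed
  have cont: "continuous_on (C \<times> {-s1..s1}) (\<lambda>z. ?h (?l (fst z) (snd z)))"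
  proof (rule continuous_on_compose2[OF h])
    show "continuous_on (C \<times> {-s1..s1}) (\<lambda>z. ?l (fst z) (snd z))"
      by (intro continuous_intros)
    show "(\<lambda>z. ?l (fst z) (snd z)) ` (C \<times> {-s1..s1}) \<subseteq> U"
    proof (rule image_subsetI)
      fix z assume "z \<in> C \<times> {-s1..s1}"
      then have "fst z \<in> C" "\<bar>snd z\<bar> \<le> s1" by auto
      then show "?l (fst z) (snd z) \<in> U" by (rule inU)
    qed
  qed
  have "uniformly_continuous_on (C \<times> {-s1..s1}) (\<lambda>z. ?h (?l (fst z) (snd z)))"
    by (rule compact_uniformly_continuous[OF cont]) (auto intro!: compact_Times C)
  then obtain d where d: "d > 0" "\<And>z w. z \<in> C \<times> {-s1..s1} \<Longrightarrow> w \<in> C \<times> {-s1..s1} \<Longrightarrow>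
      dist w z < d \<Longrightarrow> dist (?h (?l (fst w) (snd w))) (?h (?l (fst z) (snd z))) < \<kappa>"
    unfolding uniformly_continuous_on_def using \<kappa> by metis
  have close: "\<bar>?h (?l p \<sigma>) - ?h p\<bar> < \<kappa>" if "p \<in> C" "\<bar>\<sigma>\<bar> < min s1 d" for p \<sigma>
  proof -
    have "- s1 \<le> \<sigma>" "\<sigma> \<le> s1" using that(2) by linarith+
    then show ?thesis
      using d(2)[of "(p, 0)" "(p, \<sigma>)"] that s1 by (auto simp: dist_prod_def dist_real_def)
  qed
  show ?thesis
  proof (intro exI[of _ "min s1 d"] conjI allI impI)
    show "min s1 d > 0" using s1 d by simp
    fix s p assume s: "0 < s" "s < min s1 d" and p: "p \<in> C"
    define G where "G = (\<lambda>m::nat. if m = 0 then (\<lambda>\<sigma>. f (?l p \<sigma>) + f (?l p (-\<sigma>)))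
      else if m = 1 then (\<lambda>\<sigma>. hdiff a b f (?l p \<sigma>) - hdiff a b f (?l p (-\<sigma>)))
      else (\<lambda>\<sigma>. ?h (?l p \<sigma>) + ?h (?l p (-\<sigma>))))"
    have neg: "((\<lambda>\<sigma>. g (?l p (-\<sigma>))) has_real_derivative - D) (at t)"
      if "((\<lambda>\<sigma>. g (?l p \<sigma>)) has_real_derivative D) (at (-t))" for g D t
    proof -
      have "((uminus :: real \<Rightarrow> real) has_real_derivative -1) (at t)"
        by (auto intro!: derivative_eq_intros)
      from DERIV_chain2[where f = "\<lambda>\<sigma>. g (?l p \<sigma>)" and g = uminus, OF that this]
      show ?thesis by simp
    qed
    have D1: "((\<lambda>\<sigma>. f (?l p \<sigma>)) has_real_derivative hdiff a b f (?l p t)) (at t)" if "\<bar>t\<bar> \<le> s" for t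
      by (rule hdiff_along_line[OF Ck_on_Suc_differentiable[OF U f2 inU[OF p]]]) (use that s in auto)
    have D2: "((\<lambda>\<sigma>. hdiff a b f (?l p \<sigma>)) has_real_derivative ?h (?l p t)) (at t)" if "\<bar>t\<bar> \<le> s" for t
      by (rule hdiff_along_line[OF Ck_on_Suc_differentiable[OF U f1 inU[OF p]]]) (use that s in auto)
    have "\<exists>t. 0 < t \<and> t < s \<and> G 0 s = (\<Sum>m<2. G m 0 / fact m * s ^ m) + G 2 t / fact 2 * s ^ 2"
    proof (rule Maclaurin[OF s(1)])
      show "\<forall>m t. m < 2 \<and> 0 \<le> t \<and> t \<le> s \<longrightarrow> (G m has_real_derivative G (Suc m) t) (at t)"
      proof (intro allI impI)
        fix m :: nat and t assume m: "m < 2 \<and> 0 \<le> t \<and> t \<le> s"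
        then have t: "\<bar>t\<bar> \<le> s" "\<bar>-t\<bar> \<le> s" by auto
        have "(G 0 has_real_derivative G 1 t) (at t)"
          using DERIV_add[OF D1[OF t(1)] neg[OF D1[OF t(2)]]] by (simp add: G_def)
        moreover have "(G 1 has_real_derivative G 2 t) (at t)"
          using DERIV_diff[OF D2[OF t(1)] neg[OF D2[OF t(2)]]] by (simp add: G_def)
        ultimately show "(G m has_real_derivative G (Suc m) t) (at t)"
          using m by (cases "m = 0") (auto simp: numeral_2_eq_2 less_Suc_eq)
      qed
    qed auto
    then obtain t where t: "0 < t" "t < s" and G: "G 0 s = (\<Sum>m<2. G m 0 / fact m * s ^ m) + G 2 t / fact 2 * s ^ 2"
      by blast
    have "f (?l p s) + f (?l p (-s)) - 2 * f p = (?h (?l p t) + ?h (?l p (-t))) / 2 * s\<^sup>2"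
      using G by (simp add: G_def numeral_2_eq_2)
    then have "(f (?l p s) + f (?l p (-s)) - 2 * f p) / s\<^sup>2 = (?h (?l p t) + ?h (?l p (-t))) / 2"
      using s by simp
    moreover have "\<bar>?h (?l p t) - ?h p\<bar> < \<kappa>" "\<bar>?h (?l p (-t)) - ?h p\<bar> < \<kappa>"
      using close[OF p, of t] close[OF p, of "-t"] t s by auto
    moreover have "\<bar>(A + B) / 2 - c\<bar> \<le> \<kappa>" if "\<bar>A - c\<bar> < \<kappa>" "\<bar>B - c\<bar> < \<kappa>" for A B c
      using that unfolding abs_le_iff abs_less_iff by (simp add: field_simps)
    ultimately have "\<bar>(f (?l p s) + f (?l p (-s)) - 2 * f p) / s\<^sup>2 - ?h p\<bar> \<le> \<kappa>"
      by metis
    then show "\<bar>(f (?l p s) + f (p \<star> (- s * a, - s * b, 0)) - 2 * f p) / s\<^sup>2 - ?h p\<bar> \<le> \<kappa>" .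
  qed
qed

text \<open>One step of the walk.\<close>

definition avg :: "real \<Rightarrow> (heis \<Rightarrow> real) \<Rightarrow> heis \<Rightarrow> real" where
  "avg s f p = (f (p \<star> (s, 0, 0)) + f (p \<star> (- s, 0, 0)) + f (p \<star> (0, s, 0)) + f (p \<star> (0, - s, 0))) / 4"

text \<open>The sub-Laplacian is the generator of the walk with horizontal steps.  Comparisons with the walk
  below use only this statement about it.\<close>

lemma discrete_laplacian_uniform:
  assumes U: "open U" and f: "Ck_on 2 U f" and C: "compact C" "C \<subseteq> U" and \<kappa>: "\<kappa> > 0"
  obtains s0 where "s0 > 0"
    "\<And>s p. 0 < s \<Longrightarrow> s < s0 \<Longrightarrow> p \<in> C \<Longrightarrow> \<bar>4 * (avg s f p - f p) / s\<^sup>2 - heis_laplacian f p\<bar> \<le> \<kappa>"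
proof -
  have k2: "\<kappa> / 2 > 0" using \<kappa> by simp
  obtain s1 where s1: "s1 > 0" "\<And>s p. 0 < s \<Longrightarrow> s < s1 \<Longrightarrow> p \<in> C \<Longrightarrow>
     \<bar>(f (p \<star> (s, 0, 0)) + f (p \<star> (- s, 0, 0)) - 2 * f p) / s\<^sup>2 - hdiff 1 0 (hdiff 1 0 f) p\<bar> \<le> \<kappa> / 2"
    using second_difference_uniform[OF U f C k2, of 1 0] by auto
  obtain s2 where s2: "s2 > 0" "\<And>s p. 0 < s \<Longrightarrow> s < s2 \<Longrightarrow> p \<in> C \<Longrightarrow>
     \<bar>(f (p \<star> (0, s, 0)) + f (p \<star> (0, - s, 0)) - 2 * f p) / s\<^sup>2 - hdiff 0 1 (hdiff 0 1 f) p\<bar> \<le> \<kappa> / 2"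
    using second_difference_uniform[OF U f C k2, of 0 1] by auto
  show thesis
  proof (rule that[of "min s1 s2"])
    show "min s1 s2 > 0" using s1 s2 by simp
    fix s p assume s: "0 < s" "s < min s1 s2" and p: "p \<in> C"
    have "4 * (avg s f p - f p) / s\<^sup>2 =
       (f (p \<star> (s, 0, 0)) + f (p \<star> (- s, 0, 0)) - 2 * f p) / s\<^sup>2 +
       (f (p \<star> (0, s, 0)) + f (p \<star> (0, - s, 0)) - 2 * f p) / s\<^sup>2"
      using s by (simp add: avg_def field_simps)
    moreover have "\<bar>x + y - (x' + y')\<bar> \<le> \<kappa>" if "\<bar>x - x'\<bar> \<le> \<kappa> / 2" "\<bar>y - y'\<bar> \<le> \<kappa> / 2" for x y x' y'
      using that by linarith
    moreover have "p \<in> U" using p C(2) by auto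
    ultimately show "\<bar>4 * (avg s f p - f p) / s\<^sup>2 - heis_laplacian f p\<bar> \<le> \<kappa>"
      using s1(2)[OF s(1) _ p] s2(2)[OF s(1) _ p] s(2) heis_laplacian_hdiff[OF U f, of p]
      by (simp only: min_less_iff_conj)
  qed
qed

text \<open>Sub-Laplacians of explicit functions are computed from one-variable derivatives, without partial
  derivatives in three variables.\<close>

lemma heis_laplacian_eqI:
  assumes U: "open U" and f: "Ck_on 2 U f" and p: "p \<in> U" and T: "open T" "0 \<in> T"
    and X: "\<And>s. s \<in> T \<Longrightarrow> ((\<lambda>s. f (p \<star> (s, 0, 0))) has_real_derivative gX s) (at s)"
    and XX: "(gX has_real_derivative A) (at 0)"
    and Y: "\<And>s. s \<in> T \<Longrightarrow> ((\<lambda>s. f (p \<star> (0, s, 0))) has_real_derivative gY s) (at s)"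
    and YY: "(gY has_real_derivative B) (at 0)"
  shows "heis_laplacian f p = A + B"
proof -
  have f2: "Ck_on (Suc (Suc 0)) U f" using f by (simp add: numeral_2_eq_2)
  have gen: "hdiff a b (hdiff a b f) p = A"
    if g: "\<And>s. s \<in> T \<Longrightarrow> ((\<lambda>s. f (p \<star> (s * a, s * b, 0))) has_real_derivative g s) (at s)"
      and gA: "(g has_real_derivative A) (at 0)" for a b A g
  proof -
    let ?l = "\<lambda>\<sigma>. p \<star> (\<sigma> * a, \<sigma> * b, 0)"
    have "continuous_on UNIV ?l" by (intro continuous_intros)
    then have "open (?l -` U)" using U by (simp add: continuous_on_open_vimage open_vimage)
    then have o: "open (T \<inter> ?l -` U)" using T by blast
    have z: "0 \<in> T \<inter> ?l -` U" using T p by simp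
    have "hdiff a b f (?l s) = g s" if "s \<in> T \<inter> ?l -` U" for s
      using DERIV_unique[OF hdiff_along_line[OF Ck_on_Suc_differentiable[OF U f2]] g] that by auto
    then have "((\<lambda>\<sigma>. hdiff a b f (?l \<sigma>)) has_real_derivative A) (at 0)"
      using has_field_derivative_transform_within_open[OF gA o z, of "\<lambda>\<sigma>. hdiff a b f (?l \<sigma>)"] by auto
    moreover have "((\<lambda>\<sigma>. hdiff a b f (?l \<sigma>)) has_real_derivative hdiff a b (hdiff a b f) (?l 0)) (at 0)"
      by (rule hdiff_along_line[OF Ck_on_Suc_differentiable[OF U Ck_on_hdiff[OF U f2]]]) (use p in simp)
    ultimately show ?thesis using DERIV_unique by fastforce
  qed
  show ?thesis
    using gen[of 1 0 gX A] gen[of 0 1 gY B] X XX Y YY heis_laplacian_hdiff[OF U f p] by simp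
qed

section \<open>Haar measure and the horizontal random walk\<close>

lemma nn_integral_heis_fubini:
  fixes g :: "heis \<Rightarrow> ennreal"
  assumes [measurable]: "g \<in> borel_measurable borel"
  shows "(\<integral>\<^sup>+p. g p \<partial>lborel) = (\<integral>\<^sup>+x. \<integral>\<^sup>+y. \<integral>\<^sup>+t. g (x, y, t) \<partial>lborel \<partial>lborel \<partial>lborel)"
proof -
  have "(\<integral>\<^sup>+p. g p \<partial>lborel) = (\<integral>\<^sup>+p. g p \<partial>(lborel \<Otimes>\<^sub>M lborel))"
    by (simp add: lborel_prod)
  also have "\<dots> = (\<integral>\<^sup>+x. \<integral>\<^sup>+q. g (x, q) \<partial>lborel \<partial>lborel)"
    by (subst lborel.nn_integral_fst[symmetric]) (auto simp: lborel_prod)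
  also have "\<dots> = (\<integral>\<^sup>+x. \<integral>\<^sup>+q. g (x, q) \<partial>(lborel \<Otimes>\<^sub>M lborel) \<partial>lborel)"
    by (simp add: lborel_prod)
  also have "\<dots> = (\<integral>\<^sup>+x. \<integral>\<^sup>+y. \<integral>\<^sup>+t. g (x, y, t) \<partial>lborel \<partial>lborel \<partial>lborel)"
    by (subst lborel.nn_integral_fst[symmetric]) (auto simp: lborel_prod)
  finally show ?thesis .
qed

text \<open>One formula for translations, shears and dilations: left and right group translations are the case \<open>l = 1\<close>, and
  group dilations scale the volume by the homogeneous dimension \<open>4\<close>.\<close>

lemma nn_integral_heis_affine:
  fixes f :: "heis \<Rightarrow> ennreal"
  assumes [measurable]: "f \<in> borel_measurable borel" and l: "l > 0"
  shows "(\<integral>\<^sup>+p. f p \<partial>lborel) =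
    ennreal (l ^ 4) * (\<integral>\<^sup>+(x, y, t). f (a + l * x, b + l * y, (c + \<alpha> * x + \<beta> * y) + l\<^sup>2 * t) \<partial>lborel)"
proof -
  have "(\<integral>\<^sup>+p. f p \<partial>lborel) = (\<integral>\<^sup>+x. \<integral>\<^sup>+y. \<integral>\<^sup>+t. f (x, y, t) \<partial>lborel \<partial>lborel \<partial>lborel)"
    by (rule nn_integral_heis_fubini) simp
  also have "\<dots> = ennreal l * (\<integral>\<^sup>+x. (\<integral>\<^sup>+y. \<integral>\<^sup>+t. f (a + l * x, y, t) \<partial>lborel \<partial>lborel) \<partial>lborel)"
    using l by (subst nn_integral_real_affine[where c = l and t = a]) auto
  also have "\<dots> = ennreal l * (\<integral>\<^sup>+x. ennreal l * (\<integral>\<^sup>+y. \<integral>\<^sup>+t. f (a + l * x, b + l * y, t) \<partial>lborel \<partial>lborel) \<partial>lborel)"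
  proof -
    have "(\<integral>\<^sup>+y. \<integral>\<^sup>+t. f (X, y, t) \<partial>lborel \<partial>lborel) = ennreal l * (\<integral>\<^sup>+y. \<integral>\<^sup>+t. f (X, b + l * y, t) \<partial>lborel \<partial>lborel)" for X
      using l by (subst nn_integral_real_affine[where c = l and t = b]) auto
    then show ?thesis by presburger
  qed
  also have "\<dots> = ennreal l * (\<integral>\<^sup>+x. ennreal l * (\<integral>\<^sup>+y. ennreal (l\<^sup>2) * (\<integral>\<^sup>+t. f (a + l * x, b + l * y, (c + \<alpha> * x + \<beta> * y) + l\<^sup>2 * t) \<partial>lborel) \<partial>lborel) \<partial>lborel)"
  proof -
    have "(\<integral>\<^sup>+t. f (X, Y, t) \<partial>lborel) = ennreal (l\<^sup>2) * (\<integral>\<^sup>+t. f (X, Y, T + l\<^sup>2 * t) \<partial>lborel)" for X Y T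
      using l by (subst nn_integral_real_affine[where c = "l\<^sup>2" and t = T]) auto
    then show ?thesis by presburger
  qed
  also have "\<dots> = ennreal (l ^ 4) * (\<integral>\<^sup>+x. \<integral>\<^sup>+y. \<integral>\<^sup>+t. f (a + l * x, b + l * y, (c + \<alpha> * x + \<beta> * y) + l\<^sup>2 * t) \<partial>lborel \<partial>lborel \<partial>lborel)"
    using l by (simp add: nn_integral_cmult ennreal_mult[symmetric] mult.assoc[symmetric] power2_eq_square
        power4_eq_xxxx)
  also have "(\<integral>\<^sup>+x. \<integral>\<^sup>+y. \<integral>\<^sup>+t. f (a + l * x, b + l * y, (c + \<alpha> * x + \<beta> * y) + l\<^sup>2 * t) \<partial>lborel \<partial>lborel \<partial>lborel)
     = (\<integral>\<^sup>+(x, y, t). f (a + l * x, b + l * y, (c + \<alpha> * x + \<beta> * y) + l\<^sup>2 * t) \<partial>lborel)"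
  proof (subst nn_integral_heis_fubini)
    have "(\<lambda>p::heis. (a + l * fst p, b + l * fst (snd p), c + \<alpha> * fst p + \<beta> * fst (snd p) + l\<^sup>2 * snd (snd p)))
        \<in> borel_measurable borel"
      by (intro borel_measurable_continuous_onI continuous_intros)
    from measurable_compose[OF this assms(1)]
    show "(\<lambda>(x, y, t). f (a + l * x, b + l * y, (c + \<alpha> * x + \<beta> * y) + l\<^sup>2 * t)) \<in> borel_measurable borel"
      by (simp add: case_prod_unfold)
  qed simp
  finally show ?thesis .
qed

text \<open>Lebesgue measure is a Haar measure from both sides, since group translations are Euclidean translations followed
  by shears.\<close>

lemma distr_lborel_shear:
  assumes T: "\<And>x y t. T (x, y, t) = (a + x, b + y, c + \<alpha> * x + \<beta> * y + t)"
  shows "distr lborel lborel T = (lborel :: heis measure)"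
proof -
  have T': "T = (\<lambda>p. (a + fst p, b + fst (snd p), c + \<alpha> * fst p + \<beta> * fst (snd p) + snd (snd p)))"
    using T by (auto simp: fun_eq_iff)
  have [measurable]: "T \<in> borel_measurable borel"
    unfolding T' by (intro borel_measurable_continuous_onI continuous_intros)
  show ?thesis
  proof (rule measure_eqI)
    fix A assume "A \<in> sets (distr lborel lborel T)"
    then have [measurable]: "A \<in> sets borel" by simp
    have "emeasure lborel A = (\<integral>\<^sup>+p. indicator A p \<partial>lborel)" by simp
    also have "\<dots> = (\<integral>\<^sup>+p. indicator A (T p) \<partial>lborel)"
      by (subst nn_integral_heis_affine[where l = 1 and a = a and b = b and c = c and \<alpha> = \<alpha> and \<beta> = \<beta>])
         (auto simp: T' case_prod_unfold)
    also have "\<dots> = emeasure (distr lborel lborel T) A"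
      by (simp add: emeasure_distr nn_integral_distr flip: nn_integral_indicator)
    finally show "emeasure (distr lborel lborel T) A = emeasure lborel A" by simp
  qed simp
qed

lemma distr_lborel_left: "distr lborel lborel (\<lambda>p. q \<star> p) = lborel"
  by (cases q, rule distr_lborel_shear[where a = "fst q" and b = "fst (snd q)" and c = "snd (snd q)"
        and \<alpha> = "2 * fst (snd q)" and \<beta> = "- 2 * fst q"]) (auto simp: algebra_simps)

lemma distr_lborel_right: "distr lborel lborel (\<lambda>p. p \<star> q) = lborel"
  by (cases q, rule distr_lborel_shear[where a = "fst q" and b = "fst (snd q)" and c = "snd (snd q)"
        and \<alpha> = "- 2 * fst (snd q)" and \<beta> = "2 * fst q"]) (auto simp: algebra_simps)

lemma measurable_hprod [measurable]:
  "(\<lambda>p. q \<star> p) \<in> borel_measurable borel" "(\<lambda>p. p \<star> q) \<in> borel_measurable borel"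
  by (intro borel_measurable_continuous_onI continuous_intros)+

lemma lborel_integral_left:
  fixes f :: "heis \<Rightarrow> real"
  assumes [measurable]: "f \<in> borel_measurable borel"
  shows "(\<integral>p. f (q \<star> p) \<partial>lborel) = (\<integral>p. f p \<partial>lborel)"
proof -
  have "(\<integral>p. f p \<partial>lborel) = (\<integral>p. f p \<partial>(distr lborel lborel (\<lambda>p. q \<star> p)))"
    by (simp only: distr_lborel_left)
  also have "\<dots> = (\<integral>p. f (q \<star> p) \<partial>lborel)" by (rule integral_distr) auto
  finally show ?thesis by simp
qed

lemma lborel_integral_right:
  fixes f :: "heis \<Rightarrow> real"
  assumes [measurable]: "f \<in> borel_measurable borel"
  shows "(\<integral>p. f (p \<star> q) \<partial>lborel) = (\<integral>p. f p \<partial>lborel)"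
proof -
  have "(\<integral>p. f p \<partial>lborel) = (\<integral>p. f p \<partial>(distr lborel lborel (\<lambda>p. p \<star> q)))"
    by (simp only: distr_lborel_right)
  also have "\<dots> = (\<integral>p. f (p \<star> q) \<partial>lborel)" by (rule integral_distr) auto
  finally show ?thesis by simp
qed

lemma lborel_integrable_right:
  fixes f :: "heis \<Rightarrow> real"
  assumes f: "integrable lborel f"
  shows "integrable lborel (\<lambda>p. f (p \<star> q))"
proof -
  have [measurable]: "f \<in> borel_measurable borel" using f by (auto dest: borel_measurable_integrable)
  have "integrable (distr lborel lborel (\<lambda>p. p \<star> q)) f"
    using f by (simp only: distr_lborel_right)
  then show ?thesis by (subst (asm) integrable_distr_eq) auto
qed

definition nbrs :: "real \<Rightarrow> heis \<Rightarrow> heis set" where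
  "nbrs s p = {p \<star> (s, 0, 0), p \<star> (- s, 0, 0), p \<star> (0, s, 0), p \<star> (0, - s, 0)}"

lemma avg_mono: "(\<And>q. q \<in> nbrs s p \<Longrightarrow> f q \<le> g q) \<Longrightarrow> avg s f p \<le> avg s g p"
  by (simp add: avg_def nbrs_def add_mono)

lemma avg_const [simp]: "avg s (\<lambda>_. c) p = c"
  by (simp add: avg_def)

lemma avg_add: "avg s (\<lambda>q. f q + g q) p = avg s f p + avg s g p"
  and avg_diff: "avg s (\<lambda>q. f q - g q) p = avg s f p - avg s g p"
  and avg_minus: "avg s (\<lambda>q. - f q) p = - avg s f p"
  and avg_cmult: "avg s (\<lambda>q. c * f q) p = c * avg s f p"
  by (simp_all add: avg_def field_simps)

text \<open>The steps act from the right, so the averaging commutes with translations from the left.\<close>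

lemma avg_translate: "avg s (\<lambda>q. f (g \<star> q)) p = avg s f (g \<star> p)"
  by (simp add: avg_def hprod_assoc)

lemma avg_fst_square: "avg s (\<lambda>q. (fst q)\<^sup>2) p = (fst p)\<^sup>2 + s\<^sup>2 / 2"
  by (cases p) (simp add: avg_def power2_eq_square algebra_simps)

lemma avg_measurable [measurable]:
  assumes [measurable]: "f \<in> borel_measurable borel"
  shows "avg s f \<in> borel_measurable borel"
  unfolding avg_def[abs_def] by measurable

text \<open>The maximum need not be attained, as nothing is assumed about continuity; adding a small multiple of \<open>x\<^sup>2\<close>, whose
  average gains \<open>s\<^sup>2 / 2\<close>, makes a nearly maximal point contradictory.\<close>

lemma avg_max_principle:
  assumes s: "s > 0" and D: "bounded D" and B: "\<And>p. p \<in> D \<Longrightarrow> f p \<le> B"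
    and sub: "\<And>p. p \<in> D \<Longrightarrow> f p \<le> avg s f p"
    and out: "\<And>p q. p \<in> D \<Longrightarrow> q \<in> nbrs s p \<Longrightarrow> q \<notin> D \<Longrightarrow> f q \<le> m"
    and p0: "p0 \<in> D"
  shows "f p0 \<le> m"
proof -
  obtain X where X: "\<And>p. p \<in> D \<Longrightarrow> norm p \<le> X" using D by (auto simp: bounded_iff)
  define M where "M = (X + s)\<^sup>2"
  have fstX: "\<bar>fst p\<bar> \<le> X" if "p \<in> D" for p
    using X[OF that] norm_fst_le[of "fst p" "snd p"] by simp
  have M1: "(fst p)\<^sup>2 \<le> M" if "p \<in> D" for p
    using fstX[OF that] s abs_le_square_iff[of "fst p" "X + s"] by (simp add: M_def)
  have M2: "(fst q)\<^sup>2 \<le> M" if "p \<in> D" "q \<in> nbrs s p" for p q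
  proof -
    have "\<bar>fst q\<bar> \<le> X + s" using fstX[OF that(1)] that(2) s by (auto simp: nbrs_def hprod_eq)
    then show ?thesis using abs_le_square_iff[of "fst q" "X + s"] by (simp add: M_def)
  qed
  have key: "f p0 \<le> m + \<delta> * M" if \<delta>: "\<delta> > 0" for \<delta>
  proof (rule ccontr)
    assume neg: "\<not> f p0 \<le> m + \<delta> * M"
    define g where "g = (\<lambda>q. f q + \<delta> * (fst q)\<^sup>2)"
    have bdd: "bdd_above (g ` D)"
    proof (rule bdd_aboveI2)
      fix p assume "p \<in> D"
      then show "g p \<le> B + \<delta> * M"
        using B[of p] M1[of p] \<delta> by (simp add: g_def add_mono)
    qed
    define S where "S = Sup (g ` D)"
    have leS: "g p \<le> S" if "p \<in> D" for p
      unfolding S_def using that bdd by (auto intro: cSup_upper)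
    have "f p0 \<le> g p0" using \<delta> by (simp add: g_def)
    then have Sm: "S > m + \<delta> * M" using neg leS[OF p0] by linarith
    have "S - \<delta> * s\<^sup>2 / 2 < S" using \<delta> s by simp
    then obtain p where p: "p \<in> D" "g p > S - \<delta> * s\<^sup>2 / 2"
      unfolding S_def using less_cSup_iff[OF _ bdd] p0 by blast
    have "g q \<le> S" if "q \<in> nbrs s p" for q
    proof (cases "q \<in> D")
      case False
      have "\<delta> * (fst q)\<^sup>2 \<le> \<delta> * M" using M2[OF p(1) that] \<delta> by simp
      then show ?thesis using out[OF p(1) that False] Sm by (simp add: g_def)
    qed (rule leS)
    then have "avg s g p \<le> avg s (\<lambda>_. S) p" by (rule avg_mono)
    moreover have "avg s g p = avg s f p + \<delta> * ((fst p)\<^sup>2 + s\<^sup>2 / 2)"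
      unfolding g_def by (simp add: avg_add avg_cmult avg_fst_square)
    ultimately have "g p \<le> S - \<delta> * s\<^sup>2 / 2"
      using sub[OF p(1)] by (simp add: g_def algebra_simps)
    then show False using p(2) by simp
  qed
  show ?thesis
  proof (rule field_le_epsilon)
    fix e :: real assume e: "e > 0"
    have M0: "M \<ge> 0" by (simp add: M_def)
    have "e / (M + 1) * M \<le> e" using e M0 by (simp add: field_simps)
    then show "f p0 \<le> m + e" using key[of "e / (M + 1)"] e M0 by (simp add: add_nonneg_pos)
  qed
qed

text \<open>The dynamic programming equation of the walk that stops on leaving \<open>\<Omega>\<close>; as the steps are finite, it may land off the
  boundary, so the data are prescribed on the whole complement.\<close>

definition dpp :: "heis set \<Rightarrow> (heis \<Rightarrow> real) \<Rightarrow> real \<Rightarrow> (heis \<Rightarrow> real) \<Rightarrow> bool" where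
  "dpp \<Omega> \<Phi> s u \<longleftrightarrow> (\<forall>p\<in>\<Omega>. u p = avg s u p) \<and> (\<forall>p. p \<notin> \<Omega> \<longrightarrow> u p = \<Phi> p)"

lemma dpp_in: "dpp \<Omega> \<Phi> s u \<Longrightarrow> p \<in> \<Omega> \<Longrightarrow> u p = avg s u p"
  and dpp_out: "dpp \<Omega> \<Phi> s u \<Longrightarrow> p \<notin> \<Omega> \<Longrightarrow> u p = \<Phi> p"
  unfolding dpp_def by blast+

text \<open>Start from the constant \<open>- B\<close> and iterate: the iterates increase and stay bounded, and
  an average over four points passes to the limit.  The construction keeps the functions Borel measurable, which the weak
  formulation needs later.\<close>

lemma dpp_exists:
  assumes \<Omega>: "open \<Omega>" and [measurable]: "\<Phi> \<in> borel_measurable borel" and B: "\<And>p. \<bar>\<Phi> p\<bar> \<le> B"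
  obtains u where "u \<in> borel_measurable borel" "\<And>p. \<bar>u p\<bar> \<le> B" "dpp \<Omega> \<Phi> s u"
proof -
  have [measurable]: "\<Omega> \<in> sets borel" using \<Omega> by simp
  define T where "T = (\<lambda>f p. if p \<in> \<Omega> then avg s f p else \<Phi> p)"
  define F where "F = (\<lambda>n. (T ^^ n) (\<lambda>_. - B))"
  have F0: "F 0 p = - B" and FS: "F (Suc n) p = T (F n) p" for n p by (simp_all add: F_def)
  have meas [measurable]: "F n \<in> borel_measurable borel" for n
    by (induction n) (auto simp: F_def T_def)
  have mono: "T f p \<le> T g p" if "\<And>q. f q \<le> g q" for f g p
    using that by (auto simp: T_def intro: avg_mono)
  have bnd: "F n p \<le> B \<and> - B \<le> F n p" for n p
  proof (induction n arbitrary: p)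
    case 0
    then show ?case using B[of p] by (simp add: F0)
  next
    case (Suc n)
    have "avg s (F n) p \<le> avg s (\<lambda>_. B) p" "avg s (\<lambda>_. - B) p \<le> avg s (F n) p"
      by (rule avg_mono; use Suc in simp)+
    then show ?case using B[of p] by (auto simp: FS T_def)
  qed
  have step: "F n p \<le> F (Suc n) p" for n p
  proof (induction n arbitrary: p)
    case 0
    then show ?case using bnd[of "Suc 0" p] by (simp add: F0)
  next
    case (Suc n)
    have "T (F n) p \<le> T (F (Suc n)) p" by (rule mono) (rule Suc)
    then show ?case by (simp only: FS[symmetric])
  qed
  define u where "u = (\<lambda>p. lim (\<lambda>n. F n p))"
  have lim: "(\<lambda>n. F n p) \<longlonglongrightarrow> u p" for p
  proof -
    have "incseq (\<lambda>n. F n p)" using step by (intro incseq_SucI)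
    then have "convergent (\<lambda>n. F n p)"
      using bnd by (metis convergent_def incseq_convergent)
    then show ?thesis by (simp add: u_def convergent_LIMSEQ_iff)
  qed
  show thesis
  proof (rule that)
    show "u \<in> borel_measurable borel"
      by (rule borel_measurable_LIMSEQ_real[of borel F]) (use lim in auto)
    show "\<bar>u p\<bar> \<le> B" for p
      using LIMSEQ_le_const2[OF lim[of p], of B] LIMSEQ_le_const[OF lim[of p], of "-B"] bnd
      by (auto simp: abs_le_iff)
    have "(\<lambda>n. avg s (F n) p) \<longlonglongrightarrow> avg s u p" for p
      unfolding avg_def by (intro tendsto_intros lim) auto
    then have "u p = avg s u p" if "p \<in> \<Omega>" for p
      using LIMSEQ_unique[OF LIMSEQ_Suc[OF lim[of p]], of "avg s u p"] that by (simp add: FS T_def)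
    moreover have "u p = \<Phi> p" if "p \<notin> \<Omega>" for p
      using LIMSEQ_unique[OF LIMSEQ_Suc[OF lim[of p]], of "\<Phi> p"] that by (simp add: FS T_def)
    ultimately show "dpp \<Omega> \<Phi> s u" by (simp add: dpp_def)
  qed
qed

section \<open>The gauge, its sub-Laplacian and barriers\<close>

definition zsq :: "heis \<Rightarrow> real" where
  "zsq p = (fst p)\<^sup>2 + (fst (snd p))\<^sup>2"

text \<open>The fourth power of the homogeneous norm, a polynomial.\<close>

definition kor :: "heis \<Rightarrow> real" where
  "kor p = (zsq p)\<^sup>2 + (snd (snd p))\<^sup>2"

lemma zsq_nonneg [simp]: "0 \<le> zsq p" and kor_nonneg [simp]: "0 \<le> kor p"
  by (simp_all add: zsq_def kor_def)

lemma rho_kor: "rho p = root 4 (kor p)"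
  by (cases p) (simp add: kor_def zsq_def)

lemma heis_dist_pow4: "heis_dist \<xi> \<eta> ^ 4 = kor (heis_inv \<xi> \<star> \<eta>)"
  by (simp add: heis_dist_def rho_kor)

lemma heis_dist_nonneg [simp]: "0 \<le> heis_dist \<xi> \<eta>"
  by (simp add: heis_dist_def rho_kor)

lemma koranyi_ball_kor:
  assumes "0 < r" shows "koranyi_ball \<xi> r = {q. kor (heis_inv \<xi> \<star> q) < r ^ 4}"
proof -
  have "heis_dist \<xi> q < r \<longleftrightarrow> heis_dist \<xi> q ^ 4 < r ^ 4" for q
    using assms power_mono_iff[of r "heis_dist \<xi> q" 4] by (simp add: not_le[symmetric])
  then show ?thesis by (simp add: koranyi_ball_def heis_dist_pow4)
qed

lemma zsq_inv [simp]: "zsq (heis_inv p) = zsq p" and kor_inv [simp]: "kor (heis_inv p) = kor p"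
  by (simp_all add: kor_def zsq_def heis_inv_eq)

lemma continuous_on_zsq [continuous_intros]: "continuous_on S f \<Longrightarrow> continuous_on S (\<lambda>x. zsq (f x))"
  and continuous_on_kor [continuous_intros]: "continuous_on S f \<Longrightarrow> continuous_on S (\<lambda>x. kor (f x))"
  unfolding kor_def zsq_def by (intro continuous_intros; assumption)+

lemma Ck_on_zsq:
  assumes "open U" "Ck_on n U (\<lambda>p. fst (f p))" "Ck_on n U (\<lambda>p. fst (snd (f p)))"
  shows "Ck_on n U (\<lambda>p. zsq (f p))"
  unfolding zsq_def by (intro Ck_on_intros assms)

lemma Ck_on_kor:
  assumes "open U" "Ck_on n U (\<lambda>p. fst (f p))" "Ck_on n U (\<lambda>p. fst (snd (f p)))"
    "Ck_on n U (\<lambda>p. snd (snd (f p)))"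
  shows "Ck_on n U (\<lambda>p. kor (f p))"
  unfolding kor_def by (intro Ck_on_intros Ck_on_zsq assms)

lemma Ck_on_hprod_components:
  fixes f h :: "'a::euclidean_space \<Rightarrow> heis"
  assumes "open U" "Ck_on n U (\<lambda>p. fst (f p))" "Ck_on n U (\<lambda>p. fst (snd (f p)))"
    "Ck_on n U (\<lambda>p. snd (snd (f p)))" "Ck_on n U (\<lambda>p. fst (h p))" "Ck_on n U (\<lambda>p. fst (snd (h p)))"
    "Ck_on n U (\<lambda>p. snd (snd (h p)))"
  shows "Ck_on n U (\<lambda>p. fst (f p \<star> h p))" "Ck_on n U (\<lambda>p. fst (snd (f p \<star> h p)))"
    "Ck_on n U (\<lambda>p. snd (snd (f p \<star> h p)))"
  unfolding hprod_eq fst_conv snd_conv by (intro Ck_on_intros assms)+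

lemma Ck_on_left_components:
  fixes g :: heis
  assumes "open U"
  shows "Ck_on n U (\<lambda>p. fst (g \<star> p))" "Ck_on n U (\<lambda>p. fst (snd (g \<star> p)))"
    "Ck_on n U (\<lambda>p. snd (snd (g \<star> p)))"
  by (rule Ck_on_hprod_components; intro Ck_on_const Ck_on_fst Ck_on_fst_snd Ck_on_snd_snd assms)+

lemma Ck_on_kor_left: "open U \<Longrightarrow> Ck_on n U (\<lambda>p. kor (g \<star> p))"
  and Ck_on_zsq_left: "open U \<Longrightarrow> Ck_on n U (\<lambda>p. zsq (g \<star> p))"
  by (intro Ck_on_kor Ck_on_zsq Ck_on_left_components; assumption)+

lemma kor_along_X: "((\<lambda>s. kor ((x, y, t) \<star> (s, 0, 0))) has_real_derivative
    4 * (x + s) * ((x + s)\<^sup>2 + y\<^sup>2) + 4 * y * (t + 2 * y * s)) (at s)"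
  unfolding kor_def zsq_def by (auto intro!: derivative_eq_intros simp: power2_eq_square algebra_simps)

lemma kor_along_Y: "((\<lambda>s. kor ((x, y, t) \<star> (0, s, 0))) has_real_derivative
    4 * (y + s) * (x\<^sup>2 + (y + s)\<^sup>2) - 4 * x * (t - 2 * x * s)) (at s)"
  unfolding kor_def zsq_def by (auto intro!: derivative_eq_intros simp: power2_eq_square algebra_simps)

text \<open>For functions \<open>(c\<^sub>0 + c\<^sub>1 |z|\<^sup>2) k(N)\<close> plus an affine function, translated from the left.  The case
  \<open>c\<^sub>1 = 0\<close> reads \<open>|z|\<^sup>2 (24 k' + 16 N k'')\<close>; it covers the barrier and the fundamental solution, the
  other case covers the mean value kernel.\<close>

lemma laplacian_radial_weighted:
  fixes k k1 :: "real \<Rightarrow> real"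
  assumes U: "open U" and p: "p \<in> U"
    and I: "open I" "kor (g \<star> p) \<in> I" and k: "\<And>y. y \<in> I \<Longrightarrow> (k has_real_derivative k1 y) (at y)"
    and k2: "(k1 has_real_derivative k2) (at (kor (g \<star> p)))"
    and f: "f = (\<lambda>p. (c0 + c1 * zsq (g \<star> p)) * k (kor (g \<star> p)) + (\<alpha> * fst (g \<star> p) + \<beta> * fst (snd (g \<star> p)) + \<gamma> * snd (snd (g \<star> p)) + \<delta>))"
    and C2: "Ck_on 2 U f"
  shows "heis_laplacian f p =
    (c0 + c1 * zsq (g \<star> p)) * zsq (g \<star> p) * (24 * k1 (kor (g \<star> p)) + 16 * kor (g \<star> p) * k2)
     + c1 * (16 * (zsq (g \<star> p))\<^sup>2 * k1 (kor (g \<star> p)) + 4 * k (kor (g \<star> p)))"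
proof -
  obtain x y t where \<zeta>: "g \<star> p = (x, y, t)" by (cases "g \<star> p")
  define nx where "nx = (\<lambda>s. kor ((x, y, t) \<star> (s, 0, 0)))"
  define ny where "ny = (\<lambda>s. kor ((x, y, t) \<star> (0, s, 0)))"
  define nx' where "nx' = (\<lambda>s. 4 * (x + s) * ((x + s)\<^sup>2 + y\<^sup>2) + 4 * y * (t + 2 * y * s))"
  define ny' where "ny' = (\<lambda>s. 4 * (y + s) * (x\<^sup>2 + (y + s)\<^sup>2) - 4 * x * (t - 2 * x * s))"
  define T where "T = nx -` I \<inter> ny -` I"
  have dn: "(nx has_real_derivative nx' s) (at s)" "(ny has_real_derivative ny' s) (at s)" for s
    using kor_along_X[of x y t s] kor_along_Y[of x y t s] by (simp_all add: nx_def ny_def nx'_def ny'_def)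
  have n0: "nx 0 = kor (g \<star> p)" "ny 0 = kor (g \<star> p)" by (simp_all add: nx_def ny_def \<zeta>)
  have "continuous_on UNIV nx" "continuous_on UNIV ny"
    unfolding nx_def ny_def by (intro continuous_intros)+
  then have T: "open T" "0 \<in> T"
    using I n0 by (auto simp: T_def continuous_on_open_vimage open_vimage intro!: open_Int)
  have dk: "((\<lambda>s. k (n s)) has_real_derivative k1 (n s) * n') (at s)"
    if "n s \<in> I" "(n has_real_derivative n') (at s)" for n s n'
    using DERIV_chain2[OF k[OF that(1)] that(2)] .
  have dk1: "((\<lambda>s. k1 (n s)) has_real_derivative k2 * n') (at 0)"
    if "n 0 = kor (g \<star> p)" "(n has_real_derivative n') (at 0)" for n n'
    using DERIV_chain2[of k1 k2 n 0 n' UNIV] k2 that by simp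
  have fX: "f (p \<star> (s, 0, 0)) = (c0 + c1 * ((x + s)\<^sup>2 + y\<^sup>2)) * k (nx s) + (\<alpha> * (x + s) + \<beta> * y + \<gamma> * (t + 2 * y * s) + \<delta>)" for s
    using arg_cong[OF \<zeta>, of "\<lambda>w. w \<star> (s, 0, 0)"]
    by (simp add: f hprod_assoc nx_def zsq_def algebra_simps)
  have fY: "f (p \<star> (0, s, 0)) = (c0 + c1 * (x\<^sup>2 + (y + s)\<^sup>2)) * k (ny s) + (\<alpha> * x + \<beta> * (y + s) + \<gamma> * (t - 2 * x * s) + \<delta>)" for s
    using arg_cong[OF \<zeta>, of "\<lambda>w. w \<star> (0, s, 0)"]
    by (simp add: f hprod_assoc ny_def zsq_def algebra_simps)
  define gX where "gX = (\<lambda>s. c1 * (2 * (x + s)) * k (nx s) + (c0 + c1 * ((x + s)\<^sup>2 + y\<^sup>2)) * (k1 (nx s) * nx' s) + (\<alpha> + \<gamma> * (2 * y)))"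
  define gY where "gY = (\<lambda>s. c1 * (2 * (y + s)) * k (ny s) + (c0 + c1 * (x\<^sup>2 + (y + s)\<^sup>2)) * (k1 (ny s) * ny' s) + (\<beta> - \<gamma> * (2 * x)))"
  have X: "((\<lambda>s. f (p \<star> (s, 0, 0))) has_real_derivative gX s) (at s)" if "s \<in> T" for s
    unfolding fX gX_def using that
    by (auto simp: T_def intro!: derivative_eq_intros dk[OF _ dn(1)])
  have Y: "((\<lambda>s. f (p \<star> (0, s, 0))) has_real_derivative gY s) (at s)" if "s \<in> T" for s
    unfolding fY gY_def using that
    by (auto simp: T_def intro!: derivative_eq_intros dk[OF _ dn(2)])
  have dnx': "(nx' has_real_derivative 4 * (x\<^sup>2 + y\<^sup>2) + 8 * x\<^sup>2 + 8 * y\<^sup>2) (at 0)"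
    unfolding nx'_def by (auto intro!: derivative_eq_intros simp: power2_eq_square algebra_simps)
  have dny': "(ny' has_real_derivative 4 * (x\<^sup>2 + y\<^sup>2) + 8 * x\<^sup>2 + 8 * y\<^sup>2) (at 0)"
    unfolding ny'_def by (auto intro!: derivative_eq_intros simp: power2_eq_square algebra_simps)
  have nI: "nx 0 \<in> I" "ny 0 \<in> I" using T by (auto simp: T_def)
  note dX = dk[OF nI(1) dn(1)] dk1[OF n0(1) dn(1)] dnx'
  note dY = dk[OF nI(2) dn(2)] dk1[OF n0(2) dn(2)] dny'
  let ?N = "kor (g \<star> p)" and ?m = "x\<^sup>2 + y\<^sup>2"
  define nx0 where "nx0 = nx' 0"
  define ny0 where "ny0 = ny' 0"
  have XX: "(gX has_real_derivative
     c1 * 2 * k ?N + c1 * (2 * x) * (k1 ?N * nx0)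
      + (c1 * (2 * x) * (k1 ?N * nx0) + (c0 + c1 * ?m) * (k2 * nx0 * nx0 + k1 ?N * (12 * ?m)))) (at 0)"
    unfolding gX_def nx0_def
    by (auto intro!: derivative_eq_intros dX simp: n0 power2_eq_square algebra_simps)
  have YY: "(gY has_real_derivative
     c1 * 2 * k ?N + c1 * (2 * y) * (k1 ?N * ny0)
      + (c1 * (2 * y) * (k1 ?N * ny0) + (c0 + c1 * ?m) * (k2 * ny0 * ny0 + k1 ?N * (12 * ?m)))) (at 0)"
    unfolding gY_def ny0_def
    by (auto intro!: derivative_eq_intros dY simp: n0 power2_eq_square algebra_simps)
  have N: "?N = ?m\<^sup>2 + t\<^sup>2" and m: "zsq (g \<star> p) = ?m" by (simp_all add: \<zeta> kor_def zsq_def)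
  \<comment> \<open>the horizontal gradient of the gauge has squared length \<open>16 N |z|\<^sup>2\<close>\<close>
  have sq: "nx0 * nx0 + ny0 * ny0 = 16 * ?N * ?m"
    unfolding nx0_def ny0_def nx'_def ny'_def N by (simp add: power2_eq_square algebra_simps)
  have dot: "x * nx0 + y * ny0 = 4 * ?m\<^sup>2"
    unfolding nx0_def ny0_def nx'_def ny'_def by (simp add: power2_eq_square algebra_simps)
  have "heis_laplacian f p =
    4 * c1 * k ?N + 4 * c1 * k1 ?N * (x * nx0 + y * ny0)
     + (c0 + c1 * ?m) * (k2 * (nx0 * nx0 + ny0 * ny0) + 24 * k1 ?N * ?m)"
    using heis_laplacian_eqI[OF U C2 p T X XX Y YY] by (simp add: algebra_simps)
  then show ?thesis unfolding sq dot m by (simp add: algebra_simps)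
qed

text \<open>Let the exterior ball be \<open>N < r\<^sup>4\<close>.  The gauge minus its tangent plane at \<open>p\<^sub>0\<close> is a sum of
  squares that vanishes only at \<open>p\<^sub>0\<close>, but its sub-Laplacian is \<open>24 |z|\<^sup>2\<close>.  The function
  \<open>r\<^sup>-\<^sup>4 - 1/N\<close> is nonnegative outside the ball and has sub-Laplacian \<open>- 8 |z|\<^sup>2 / N\<^sup>2\<close>, so a large multiple of it
  restores superharmonicity.  Both sub-Laplacians degenerate in the same way on the vertical axis of the ball, and hence
  no separate argument is needed at characteristic points.\<close>

lemma barrier_exists:
  assumes \<Omega>: "bounded \<Omega>" and r: "r > 0" and p0: "kor (g \<star> p0) = r ^ 4"
    and ext: "\<And>p. p \<in> closure \<Omega> \<Longrightarrow> kor (g \<star> p) \<ge> r ^ 4"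
  obtains U W where "open U" "closure \<Omega> \<subseteq> U" "Ck_on 2 U W" "W p0 = 0"
    "\<And>p. p \<in> closure \<Omega> \<Longrightarrow> p \<noteq> p0 \<Longrightarrow> W p > 0"
    "\<And>p. p \<in> closure \<Omega> \<Longrightarrow> heis_laplacian W p \<le> 0"
proof -
  have "compact (closure \<Omega>)" using \<Omega> by (simp add: compact_closure)
  moreover have "continuous_on (closure \<Omega>) (\<lambda>p. kor (g \<star> p))" by (intro continuous_intros)
  ultimately have "bounded ((\<lambda>p. kor (g \<star> p)) ` closure \<Omega>)"
    by (intro compact_imp_bounded compact_continuous_image)
  then obtain M where M: "\<And>p. p \<in> closure \<Omega> \<Longrightarrow> kor (g \<star> p) \<le> M"
    unfolding bounded_iff by fastforce
  obtain a b c where abc: "g \<star> p0 = (a, b, c)" by (cases "g \<star> p0")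
  define n where "n = a\<^sup>2 + b\<^sup>2"
  have r4: "r ^ 4 = n\<^sup>2 + c\<^sup>2" using p0 by (simp add: abc kor_def zsq_def n_def)
  \<comment> \<open>the smallest multiple for which \<open>24 - 8 K / N\<^sup>2 \<le> 0\<close> wherever \<open>N \<le> M\<close>\<close>
  define K where "K = 3 * M\<^sup>2"
  have K0: "K \<ge> 0" by (simp add: K_def)
  define k where "k = (\<lambda>N. N - K * inverse N)"
  define \<delta> where "\<delta> = K * inverse (r ^ 4) - r ^ 4 + 4 * n * n + 2 * c * c"
  define W where "W = (\<lambda>p. (1 + 0 * zsq (g \<star> p)) * k (kor (g \<star> p)) +
     (- (4 * n * a) * fst (g \<star> p) + - (4 * n * b) * fst (snd (g \<star> p)) + - (2 * c) * snd (snd (g \<star> p)) + \<delta>))"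
  define U where "U = {p. kor (g \<star> p) > 0}"
  have U: "open U" unfolding U_def by (intro open_Collect_less continuous_intros)
  have sub: "closure \<Omega> \<subseteq> U"
    using ext r by (auto simp: U_def intro: less_le_trans[of 0 "r ^ 4"])
  have Wform: "W p = K * (inverse (r ^ 4) - inverse (kor (g \<star> p))) +
     ((zsq (g \<star> p) - n)\<^sup>2 + 2 * n * ((fst (g \<star> p) - a)\<^sup>2 + (fst (snd (g \<star> p)) - b)\<^sup>2) + (snd (snd (g \<star> p)) - c)\<^sup>2)" for p
  proof -
    obtain x y t where \<zeta>: "g \<star> p = (x, y, t)" by (cases "g \<star> p")
    have "kor (x, y, t) - (n\<^sup>2 + c\<^sup>2) + 4 * n * n + 2 * c * c - 4 * n * a * x - 4 * n * b * y - 2 * c * t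
      = (zsq (x, y, t) - n)\<^sup>2 + 2 * n * ((x - a)\<^sup>2 + (y - b)\<^sup>2) + (t - c)\<^sup>2"
      unfolding kor_def zsq_def n_def by (simp add: power2_eq_square algebra_simps)
    then show ?thesis
      unfolding W_def \<delta>_def k_def r4 \<zeta> by (simp add: algebra_simps)
  qed
  have C2k: "Ck_on 2 U (\<lambda>p. k (kor (g \<star> p)))"
  proof -
    define G where "G = (\<lambda>i::nat. if i = 0 then k else if i = 1 then (\<lambda>N. 1 + K * inverse (N ^ 2)) else (\<lambda>N. - 2 * K * inverse (N ^ 3)))"
    have "Ck_on 2 U (\<lambda>p. G 0 (kor (g \<star> p)))"
    proof (rule Ck_on_compose[OF U Ck_on_kor_left[OF U], of g "{0<..}"])
      fix i :: nat and y :: real assume i: "i < 2" and y: "y \<in> {0<..}"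
      have "(k has_real_derivative 1 + K * inverse (y ^ 2)) (at y)"
        unfolding k_def using y by (auto intro!: derivative_eq_intros simp: field_simps power2_eq_square)
      moreover have "((\<lambda>N. 1 + K * inverse (N ^ 2)) has_real_derivative - 2 * K * inverse (y ^ 3)) (at y)"
        using y by (auto intro!: derivative_eq_intros simp: field_simps power2_eq_square power3_eq_cube)
      ultimately show "(G i has_real_derivative G (Suc i) y) (at y)"
        using i by (cases "i = 0") (auto simp: G_def)
    qed (auto simp: U_def G_def intro!: continuous_intros)
    then show ?thesis by (simp add: G_def)
  qed
  have C2: "Ck_on 2 U W"
    unfolding W_def by (intro Ck_on_intros U C2k Ck_on_zsq_left Ck_on_left_components)
  show thesis
  proof (rule that[OF U sub C2])
    show "W p0 = 0"
      unfolding Wform p0 by (simp add: abc zsq_def n_def)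
    fix p assume p: "p \<in> closure \<Omega>"
    have N: "kor (g \<star> p) \<ge> r ^ 4" "r ^ 4 > 0" using ext[OF p] r by auto
    have K1: "K * (inverse (r ^ 4) - inverse (kor (g \<star> p))) \<ge> 0"
      using K0 N by (simp add: le_imp_inverse_le)
    have Npos: "0 < kor (g \<star> p)" using N by linarith
    have n0: "n \<ge> 0" by (simp add: n_def)
    show "W p > 0" if "p \<noteq> p0"
    proof (rule ccontr)
      assume neg: "\<not> W p > 0"
      obtain x y t where \<zeta>: "g \<star> p = (x, y, t)" by (cases "g \<star> p")
      have s: "(zsq (g \<star> p) - n)\<^sup>2 \<ge> 0" "2 * n * ((x - a)\<^sup>2 + (y - b)\<^sup>2) \<ge> 0" "(t - c)\<^sup>2 \<ge> 0"
        using n0 by auto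
      have "(zsq (g \<star> p) - n)\<^sup>2 = 0 \<and> 2 * n * ((x - a)\<^sup>2 + (y - b)\<^sup>2) = 0 \<and> (t - c)\<^sup>2 = 0"
        using neg K1 s unfolding Wform \<zeta> fst_conv snd_conv by (intro conjI; linarith)
      then have z: "x\<^sup>2 + y\<^sup>2 = n" "n = 0 \<or> (x - a)\<^sup>2 + (y - b)\<^sup>2 = 0" "t = c"
        by (auto simp: \<zeta> zsq_def)
      have "x = a \<and> y = b"
        using z(1,2) by (auto simp: n_def sum_power2_eq_zero_iff)
      then have "g \<star> p = g \<star> p0" using z(3) \<zeta> abc by simp
      then have "p = p0" by (metis hprod_inv_cancel(1))
      then show False using that by simp
    qed
    have "(k has_real_derivative 1 + K * inverse (y ^ 2)) (at y)" if "y \<in> {0<..}" for y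
      unfolding k_def using that by (auto intro!: derivative_eq_intros simp: field_simps power2_eq_square)
    moreover have "((\<lambda>N. 1 + K * inverse (N ^ 2)) has_real_derivative - 2 * K * inverse (kor (g \<star> p) ^ 3)) (at (kor (g \<star> p)))"
      using N by (auto intro!: derivative_eq_intros simp: field_simps power2_eq_square power3_eq_cube)
    ultimately have "heis_laplacian W p = (1 + 0 * zsq (g \<star> p)) * zsq (g \<star> p) *
        (24 * (1 + K * inverse (kor (g \<star> p) ^ 2)) + 16 * kor (g \<star> p) * (- 2 * K * inverse (kor (g \<star> p) ^ 3)))
        + 0 * (16 * (zsq (g \<star> p))\<^sup>2 * (1 + K * inverse (kor (g \<star> p) ^ 2)) + 4 * k (kor (g \<star> p)))"
      by (intro laplacian_radial_weighted[OF U _ _ _ _ _ W_def C2, of p "{0<..}"])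
         (use p sub Npos in auto)
    also have "\<dots> = zsq (g \<star> p) * (24 - 8 * K / kor (g \<star> p) ^ 2)"
      using N by (simp add: field_simps power2_eq_square power3_eq_cube)
    also have "\<dots> \<le> 0"
    proof -
      have "kor (g \<star> p) ^ 2 \<le> M\<^sup>2" using M[OF p] by (intro power_mono) auto
      then have "24 - 8 * K / kor (g \<star> p) ^ 2 \<le> 0" using Npos by (simp add: K_def field_simps)
      then show ?thesis by (simp add: mult_nonneg_nonpos)
    qed
    finally show "heis_laplacian W p \<le> 0" .
  qed
qed

section \<open>Boundary values of the walk functions\<close>

text \<open>On a bounded set the Euclidean length of a step is proportional to the step size.\<close>

lemma nbrs_dist:
  assumes "bounded \<Omega>"
  obtains M where "M > 0" "\<And>s p q. 0 \<le> s \<Longrightarrow> p \<in> \<Omega> \<Longrightarrow> q \<in> nbrs s p \<Longrightarrow> dist q p \<le> s * M"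
proof -
  obtain X where X: "\<And>p. p \<in> \<Omega> \<Longrightarrow> norm p \<le> X" using assms by (auto simp: bounded_iff)
  have hb: "norm (horiz a b p) \<le> 2 + 4 * X"
    if "p \<in> \<Omega>" "\<bar>a\<bar> \<le> 1" "\<bar>b\<bar> \<le> 1" for a b p
  proof -
    have p: "\<bar>fst p\<bar> \<le> X" "\<bar>fst (snd p)\<bar> \<le> X"
      using X[OF that(1)] norm_fst_le[of "fst p" "snd p"] norm_snd_le[of "snd p" "fst p"]
        norm_fst_le[of "fst (snd p)" "snd (snd p)"] by auto
    have "\<bar>a * fst (snd p)\<bar> \<le> 1 * X" "\<bar>b * fst p\<bar> \<le> 1 * X"
      unfolding abs_mult by (intro mult_mono p that; simp)+
    moreover have "norm (horiz a b p) \<le> \<bar>a\<bar> + (\<bar>b\<bar> + \<bar>2 * (a * fst (snd p) - b * fst p)\<bar>)"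
      unfolding horiz_def
      by (rule order_trans[OF norm_Pair_le]) (use norm_Pair_le[of b "2 * (a * fst (snd p) - b * fst p)"] in simp)
    moreover have "\<bar>2 * (v - w)\<bar> \<le> 4 * X" if "\<bar>v\<bar> \<le> 1 * X" "\<bar>w\<bar> \<le> 1 * X" for v w
      using that by (simp add: abs_le_iff)
    ultimately show ?thesis using that(2,3) by fastforce
  qed
  show thesis
  proof (rule that[of "\<bar>2 + 4 * X\<bar> + 1"])
    fix s :: real and p q assume s: "0 \<le> s" and p: "p \<in> \<Omega>" and q: "q \<in> nbrs s p"
    obtain a b where ab: "\<bar>a\<bar> \<le> 1" "\<bar>b\<bar> \<le> 1" "q = p \<star> (s * a, s * b, 0)"
    proof -
      have "q = p \<star> (s * 1, s * 0, 0) \<or> q = p \<star> (s * -1, s * 0, 0) \<or> q = p \<star> (s * 0, s * 1, 0) \<or> q = p \<star> (s * 0, s * -1, 0)"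
        using q by (simp add: nbrs_def del: heis_mult.simps)
      then show thesis using that[of 1 0] that[of "-1" 0] that[of 0 1] that[of 0 "-1"]
        by fastforce
    qed
    have "dist q p = s * norm (horiz a b p)"
      using s by (simp add: ab(3) hprod_horizontal dist_norm)
    also have "\<dots> \<le> s * (\<bar>2 + 4 * X\<bar> + 1)"
      using s hb[OF p ab(1,2)] by (intro mult_left_mono) auto
    finally show "dist q p \<le> s * (\<bar>2 + 4 * X\<bar> + 1)" .
  qed auto
qed

text \<open>An open Koranyi ball misses the closure of \<open>\<Omega>\<close> and has the point on its boundary; \<open>g\<close> is the inverse of the centre.\<close>

definition exterior_koranyi :: "heis set \<Rightarrow> heis \<Rightarrow> bool" where
  "exterior_koranyi \<Omega> p0 \<longleftrightarrow> (\<exists>g r. r > 0 \<and> kor (g \<star> p0) = r ^ 4 \<and> (\<forall>p\<in>closure \<Omega>. kor (g \<star> p) \<ge> r ^ 4))"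

text \<open>The barrier is only weakly superharmonic, while comparison with the walk needs a strict inequality that
  absorbs the Taylor error; the term \<open>c (M - x\<^sup>2)\<close> supplies it and stays below \<open>\<kappa> / 3\<close>.\<close>

lemma boundary_upper:
  assumes \<Omega>: "open \<Omega>" "bounded \<Omega>" and \<Phi>: "continuous_on UNIV \<Phi>" "\<And>p. \<bar>\<Phi> p\<bar> \<le> B"
    and p0: "p0 \<in> frontier \<Omega>" and ext: "exterior_koranyi \<Omega> p0" and \<kappa>: "\<kappa> > 0"
  obtains \<omega> where "\<omega> > 0"
    "\<And>s u p. 0 < s \<Longrightarrow> s < \<omega> \<Longrightarrow> dpp \<Omega> \<Phi> s u \<Longrightarrow> (\<And>q. \<bar>u q\<bar> \<le> B) \<Longrightarrow> p \<in> \<Omega> \<Longrightarrow> dist p p0 < \<omega> \<Longrightarrow>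
       u p \<le> \<Phi> p0 + \<kappa>"
proof -
  obtain g r where gr: "r > 0" "kor (g \<star> p0) = r ^ 4" "\<And>p. p \<in> closure \<Omega> \<Longrightarrow> kor (g \<star> p) \<ge> r ^ 4"
    using ext unfolding exterior_koranyi_def by blast
  obtain U W where U: "open U" "closure \<Omega> \<subseteq> U" and W: "Ck_on 2 U W" "W p0 = 0"
    "\<And>p. p \<in> closure \<Omega> \<Longrightarrow> p \<noteq> p0 \<Longrightarrow> W p > 0"
    "\<And>p. p \<in> closure \<Omega> \<Longrightarrow> heis_laplacian W p \<le> 0"
    using barrier_exists[OF \<Omega>(2) gr] by metis
  have cl: "compact (closure \<Omega>)" using \<Omega> by (simp add: compact_closure)
  have p0c: "p0 \<in> closure \<Omega>" using p0 by (simp add: frontier_def)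
  have Wcont: "continuous_on U W" using W(1) by (rule Ck_on_continuous)
  have W0: "W p \<ge> 0" if "p \<in> closure \<Omega>" for p using W(2,3) that by (cases "p = p0") (auto simp: less_imp_le)
  define e where "e = \<kappa> / 3"
  have e: "e > 0" using \<kappa> by (simp add: e_def)
  have B0: "B \<ge> 0" using \<Phi>(2)[of p0] by linarith
  have "isCont \<Phi> p0" using \<Phi>(1) continuous_on_eq_continuous_at[OF open_UNIV, of \<Phi>] by blast
  then obtain d where d: "d > 0" "\<And>q. dist q p0 < d \<Longrightarrow> \<bar>\<Phi> q - \<Phi> p0\<bar> < e"
    using e unfolding continuous_at_eps_delta dist_real_def by blast
  obtain w0 where w0: "w0 > 0" "\<And>p. p \<in> closure \<Omega> - ball p0 d \<Longrightarrow> W p \<ge> w0"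
  proof (cases "closure \<Omega> - ball p0 d = {}")
    case True
    show thesis by (rule that[of 1], simp, unfold True, simp)
  next
    case False
    have "compact (closure \<Omega> - ball p0 d)" using cl by (intro compact_diff) auto
    moreover have "continuous_on (closure \<Omega> - ball p0 d) W"
      by (rule continuous_on_subset[OF Wcont]) (use U in auto)
    ultimately obtain q where q: "q \<in> closure \<Omega> - ball p0 d" "\<And>p. p \<in> closure \<Omega> - ball p0 d \<Longrightarrow> W q \<le> W p"
      using continuous_attains_inf[of "closure \<Omega> - ball p0 d" W] False by blast
    have "q \<noteq> p0" using q(1) d(1) by auto
    then show thesis using that[of "W q"] q W(3) by auto
  qed
  define K where "K = (2 * B + 1) / w0"
  have K: "K > 0" using B0 w0 by (simp add: K_def)
  obtain X where X: "\<And>p. p \<in> closure \<Omega> \<Longrightarrow> norm p \<le> X"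
    using compact_imp_bounded[OF cl] by (auto simp: bounded_iff)
  define M where "M = X\<^sup>2"
  have M: "(fst p)\<^sup>2 \<le> M" if "p \<in> closure \<Omega>" for p
    using X[OF that] norm_fst_le[of "fst p" "snd p"] abs_le_square_iff[of "fst p" X] by (simp add: M_def)
  have M0: "M \<ge> 0" by (simp add: M_def)
  define c where "c = e / (M + 1)"
  have c: "c > 0" using e M0 by (simp add: c_def add_nonneg_pos)
  have cM: "c * (M - x\<^sup>2) \<le> e" for x
  proof -
    have "c * (M - x\<^sup>2) \<le> c * M" using c by (intro mult_left_mono) auto
    also have "\<dots> \<le> e" using e M0 by (simp add: c_def field_simps)
    finally show ?thesis .
  qed
  \<comment> \<open>the comparison function; \<open>K\<close> makes it exceed the data away from \<open>p0\<close>, continuity near \<open>p0\<close>\<close>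
  define V where "V = (\<lambda>q. \<Phi> p0 + e + K * W q + c * (M - (fst q)\<^sup>2))"
  define h where "h = (\<lambda>q. V q - \<Phi> q)"
  have hpos: "h q > 0" if q: "q \<in> closure \<Omega>" for q
  proof -
    have 1: "c * (M - (fst q)\<^sup>2) \<ge> 0" using c M[OF q] by simp
    show ?thesis
    proof (cases "dist q p0 < d")
      case True
      have "K * W q \<ge> 0" using K W0[OF q] by simp
      then show ?thesis using d(2)[OF True] 1 by (simp add: h_def V_def abs_less_iff)
    next
      case False
      then have "W q \<ge> w0" using w0(2)[of q] q by (simp add: dist_commute)
      then have "K * W q \<ge> K * w0" using K by simp
      then have "K * W q \<ge> 2 * B + 1" using w0(1) by (simp add: K_def)
      then show ?thesis using \<Phi>(2)[of q] \<Phi>(2)[of p0] 1 e by (simp add: h_def V_def abs_le_iff)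
    qed
  qed
  have hcont: "continuous_on U h"
    unfolding h_def V_def by (intro continuous_intros Wcont continuous_on_subset[OF \<Phi>(1)]) auto
  have "open (U \<inter> h -` {0<..})" using hcont U(1) by (rule continuous_open_preimage) auto
  moreover have "closure \<Omega> \<subseteq> U \<inter> h -` {0<..}" using hpos U by auto
  \<comment> \<open>a step may leave \<open>\<Omega>\<close>, so the data must be dominated on a neighbourhood of its closure\<close>
  ultimately obtain e1 where e1: "e1 > 0" "(\<Union>x\<in>closure \<Omega>. cball x e1) \<subseteq> U \<inter> h -` {0<..}"
    using compact_subset_open_imp_cball_epsilon_subset[OF cl] by metis
  obtain L where L: "L > 0" "\<And>s p q. 0 \<le> s \<Longrightarrow> p \<in> \<Omega> \<Longrightarrow> q \<in> nbrs s p \<Longrightarrow> dist q p \<le> s * L"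
    using nbrs_dist[OF \<Omega>(2)] by metis
  have cK: "c / K > 0" using c K by simp
  obtain s0 where s0: "s0 > 0" "\<And>s p. 0 < s \<Longrightarrow> s < s0 \<Longrightarrow> p \<in> closure \<Omega> \<Longrightarrow>
       \<bar>4 * (avg s W p - W p) / s\<^sup>2 - heis_laplacian W p\<bar> \<le> c / K"
    using discrete_laplacian_uniform[OF U(1) W(1) cl U(2) cK] by metis
  have "isCont W p0" using Wcont U p0c by (auto simp: continuous_on_eq_continuous_at)
  then obtain d2 where d2: "d2 > 0" "\<And>q. dist q p0 < d2 \<Longrightarrow> \<bar>W q\<bar> < e / K"
    using e K W(2) unfolding continuous_at_eps_delta dist_real_def by (metis diff_zero divide_pos_pos)
  show thesis
  proof (rule that[of "min (min s0 (e1 / L)) d2"])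
    show "min (min s0 (e1 / L)) d2 > 0" using s0 e1 L d2 by simp
    fix s u p assume s: "0 < s" "s < min (min s0 (e1 / L)) d2" and dp: "dpp \<Omega> \<Phi> s u"
      and uB: "\<And>q. \<bar>u q\<bar> \<le> B" and p: "p \<in> \<Omega>" "dist p p0 < min (min s0 (e1 / L)) d2"
    have inc: "q \<in> closure \<Omega>" if "q \<in> \<Omega>" for q using that closure_subset by auto
    have "u p - V p \<le> 0"
    proof (rule avg_max_principle[where f = "\<lambda>q. u q - V q" and D = \<Omega> and B = "B + B", OF s(1) \<Omega>(2)])
      fix q assume q: "q \<in> \<Omega>"
      have "V q \<ge> \<Phi> p0" using K W0[OF inc[OF q]] c M[OF inc[OF q]] e by (simp add: V_def)
      then show "u q - V q \<le> B + B" using uB[of q] \<Phi>(2)[of p0] by (simp add: abs_le_iff)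
      have "4 * (avg s W q - W q) / s\<^sup>2 \<le> c / K"
        using s0(2)[OF s(1) _ inc[OF q]] s(2) W(4)[OF inc[OF q]] by (simp add: abs_le_iff)
      then have "K * (avg s W q - W q) \<le> c * s\<^sup>2 / 4" using K s by (simp add: field_simps)
      moreover have "avg s V q = \<Phi> p0 + e + K * avg s W q + c * (M - ((fst q)\<^sup>2 + s\<^sup>2 / 2))"
        unfolding V_def by (simp add: avg_add avg_cmult avg_diff avg_fst_square)
      moreover have "c * s\<^sup>2 > 0" using c s by simp
      ultimately have "avg s V q \<le> V q" by (simp add: V_def algebra_simps)
      then show "u q - V q \<le> avg s (\<lambda>q. u q - V q) q"
        using dp q by (simp add: avg_diff dpp_def)
    next
      fix q q' assume q: "q \<in> \<Omega>" "q' \<in> nbrs s q" "q' \<notin> \<Omega>"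
      have "dist q' q \<le> s * L" using L(2)[OF _ q(1,2)] s by simp
      also have "\<dots> \<le> e1" using s L by (simp add: field_simps)
      finally have "q' \<in> cball q e1" by (simp add: dist_commute)
      then have "h q' > 0" using e1(2) inc[OF q(1)] by blast
      moreover have "u q' = \<Phi> q'" using dp q(3) by (rule dpp_out)
      ultimately show "u q' - V q' \<le> 0" by (simp add: h_def)
    qed (rule p(1))
    moreover have "K * W p \<le> e"
      using d2(2)[of p] p(2) K by (simp add: field_simps abs_less_iff)
    ultimately show "u p \<le> \<Phi> p0 + \<kappa>"
      using cM[of "fst p"] by (simp add: V_def e_def)
  qed
qed

lemma dpp_minus: "dpp \<Omega> \<Phi> s u \<Longrightarrow> dpp \<Omega> (\<lambda>p. - \<Phi> p) s (\<lambda>p. - u p)"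
  by (simp add: dpp_def avg_minus)

text \<open>Compactness of the boundary makes the threshold independent of the boundary point.\<close>

lemma boundary_uniform:
  assumes \<Omega>: "open \<Omega>" "bounded \<Omega>" and \<Phi>: "continuous_on UNIV \<Phi>" "\<And>p. \<bar>\<Phi> p\<bar> \<le> B"
    and ext: "\<And>p0. p0 \<in> frontier \<Omega> \<Longrightarrow> exterior_koranyi \<Omega> p0" and \<kappa>: "\<kappa> > 0"
  obtains \<omega> where "\<omega> > 0"
    "\<And>s u p p0. 0 < s \<Longrightarrow> s < \<omega> \<Longrightarrow> dpp \<Omega> \<Phi> s u \<Longrightarrow> (\<And>q. \<bar>u q\<bar> \<le> B) \<Longrightarrow> p \<in> \<Omega> \<Longrightarrow>
       p0 \<in> frontier \<Omega> \<Longrightarrow> dist p p0 < \<omega> \<Longrightarrow> \<bar>u p - \<Phi> p\<bar> \<le> \<kappa>"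
proof -
  have k2: "\<kappa> / 2 > 0" using \<kappa> by simp
  have "\<exists>\<omega>>0. \<forall>s u p. 0 < s \<longrightarrow> s < \<omega> \<longrightarrow> dpp \<Omega> \<Phi> s u \<longrightarrow> (\<forall>q. \<bar>u q\<bar> \<le> B) \<longrightarrow> p \<in> \<Omega> \<longrightarrow>
       dist p p0 < \<omega> \<longrightarrow> \<bar>u p - \<Phi> p\<bar> \<le> \<kappa>" if p0: "p0 \<in> frontier \<Omega>" for p0
  proof -
    obtain w1 where w1: "w1 > 0"
      "\<And>s u p. 0 < s \<Longrightarrow> s < w1 \<Longrightarrow> dpp \<Omega> \<Phi> s u \<Longrightarrow> (\<And>q. \<bar>u q\<bar> \<le> B) \<Longrightarrow> p \<in> \<Omega> \<Longrightarrow> dist p p0 < w1 \<Longrightarrow>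
       u p \<le> \<Phi> p0 + \<kappa> / 2"
      using boundary_upper[OF \<Omega> \<Phi> p0 ext[OF p0] k2] by blast
    have m: "continuous_on UNIV (\<lambda>p. - \<Phi> p)" "\<And>p. \<bar>- \<Phi> p\<bar> \<le> B"
      using \<Phi> by (auto intro: continuous_intros)
    obtain w2 where w2: "w2 > 0"
      "\<And>s u p. 0 < s \<Longrightarrow> s < w2 \<Longrightarrow> dpp \<Omega> (\<lambda>p. - \<Phi> p) s u \<Longrightarrow> (\<And>q. \<bar>u q\<bar> \<le> B) \<Longrightarrow> p \<in> \<Omega> \<Longrightarrow> dist p p0 < w2 \<Longrightarrow>
       u p \<le> - \<Phi> p0 + \<kappa> / 2"
      using boundary_upper[OF \<Omega> m p0 ext[OF p0] k2] by blast
    have "isCont \<Phi> p0" using \<Phi>(1) continuous_on_eq_continuous_at[OF open_UNIV, of \<Phi>] by blast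
    then obtain d where d: "d > 0" "\<And>q. dist q p0 < d \<Longrightarrow> \<bar>\<Phi> q - \<Phi> p0\<bar> < \<kappa> / 2"
      using k2 unfolding continuous_at_eps_delta dist_real_def by blast
    show ?thesis
    proof (intro exI[of _ "min (min w1 w2) d"] conjI allI impI)
      show "min (min w1 w2) d > 0" using w1 w2 d by simp
      fix s u p assume a: "0 < s" "s < min (min w1 w2) d" "dpp \<Omega> \<Phi> s u" "\<forall>q. \<bar>u q\<bar> \<le> B" "p \<in> \<Omega>"
        "dist p p0 < min (min w1 w2) d"
      have "u p \<le> \<Phi> p0 + \<kappa> / 2" by (rule w1(2)[of s u p]) (use a in auto)
      moreover have "- u p \<le> - \<Phi> p0 + \<kappa> / 2"
        by (rule w2(2)[of s "\<lambda>p. - u p" p, OF _ _ dpp_minus]) (use a in auto)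
      moreover have "\<bar>\<Phi> p - \<Phi> p0\<bar> < \<kappa> / 2" using d(2) a by simp
      ultimately show "\<bar>u p - \<Phi> p\<bar> \<le> \<kappa>"
        unfolding abs_le_iff abs_less_iff by argo
    qed
  qed
  then obtain w where w: "\<And>p0. p0 \<in> frontier \<Omega> \<Longrightarrow> w p0 > 0"
    "\<And>p0 s u p. p0 \<in> frontier \<Omega> \<Longrightarrow> 0 < s \<Longrightarrow> s < w p0 \<Longrightarrow> dpp \<Omega> \<Phi> s u \<Longrightarrow> (\<And>q. \<bar>u q\<bar> \<le> B) \<Longrightarrow> p \<in> \<Omega> \<Longrightarrow>
       dist p p0 < w p0 \<Longrightarrow> \<bar>u p - \<Phi> p\<bar> \<le> \<kappa>"
    by metis
  have "compact (frontier \<Omega>)" using \<Omega> by (rule_tac compact_frontier_bounded)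
  then obtain F where F: "F \<subseteq> frontier \<Omega>" "finite F" "frontier \<Omega> \<subseteq> (\<Union>c\<in>F. ball c (w c / 2))"
    by (rule compactE_image[of "frontier \<Omega>" "frontier \<Omega>" "\<lambda>c. ball c (w c / 2)"])
       (use w(1) in force)+
  define \<omega> where "\<omega> = Min (insert 1 ((\<lambda>c. w c / 2) ` F))"
  have \<omega>: "\<omega> > 0"
    using F w(1) by (auto simp: \<omega>_def)
  have \<omega>le: "\<omega> \<le> w c / 2" if "c \<in> F" for c
    unfolding \<omega>_def using F(2) that by (intro Min_le) auto
  show thesis
  proof (rule that[OF \<omega>])
    fix s u p p0 assume a: "0 < s" "s < \<omega>" "dpp \<Omega> \<Phi> s u" "\<And>q. \<bar>u q\<bar> \<le> B" "p \<in> \<Omega>" "p0 \<in> frontier \<Omega>" "dist p p0 < \<omega>"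
    obtain c where c: "c \<in> F" "dist c p0 < w c / 2" using F(3) a(6) by auto
    have "dist p c \<le> dist p p0 + dist c p0" by (metis dist_triangle dist_commute)
    then have "dist p c < w c" using a(7) \<omega>le[OF c(1)] c(2) by simp
    moreover have "s < w c" using a(1,2) \<omega>le[OF c(1)] by linarith
    ultimately show "\<bar>u p - \<Phi> p\<bar> \<le> \<kappa>"
      using w(2)[of c s u p] a c F(1) by auto
  qed
qed

lemma segment_meets_frontier:
  fixes p q :: "'a::euclidean_space"
  assumes "p \<in> \<Omega>" "q \<notin> \<Omega>"
  obtains p0 where "p0 \<in> frontier \<Omega>" "dist p p0 \<le> dist p q"
proof -
  have "closed_segment p q \<inter> frontier \<Omega> \<noteq> {}"
    by (rule connected_Int_frontier) (use assms in auto)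
  then obtain p0 where p0: "p0 \<in> closed_segment p q" "p0 \<in> frontier \<Omega>" by blast
  then show thesis using that dist_in_closed_segment[OF p0(1)] by (metis dist_commute)
qed

section \<open>Equicontinuity by left translation\<close>

lemma norm_shear_le:
  fixes d :: heis
  assumes "\<bar>a\<bar> \<le> 2 * X" "\<bar>b\<bar> \<le> 2 * X"
  shows "norm (fst d, fst (snd d), snd (snd d) + (a * fst d + b * fst (snd d))) \<le> (3 + 4 * X) * norm d"
proof -
  have d: "\<bar>fst d\<bar> \<le> norm d" "\<bar>fst (snd d)\<bar> \<le> norm d" "\<bar>snd (snd d)\<bar> \<le> norm d"
    using norm_fst_le[of "fst d" "snd d"] norm_snd_le[of "snd d" "fst d"]
      norm_fst_le[of "fst (snd d)" "snd (snd d)"] norm_snd_le[of "snd (snd d)" "fst (snd d)"] by auto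
  have "\<bar>a * fst d\<bar> \<le> 2 * X * norm d" "\<bar>b * fst (snd d)\<bar> \<le> 2 * X * norm d"
    unfolding abs_mult using assms by (intro mult_mono d; simp)+
  then have "\<bar>snd (snd d) + (a * fst d + b * fst (snd d))\<bar> \<le> norm d + 4 * X * norm d"
    using d(3) by (simp add: abs_le_iff)
  moreover have "norm (fst d, fst (snd d), snd (snd d) + (a * fst d + b * fst (snd d)))
     \<le> \<bar>fst d\<bar> + (\<bar>fst (snd d)\<bar> + \<bar>snd (snd d) + (a * fst d + b * fst (snd d))\<bar>)"
    by (rule order_trans[OF norm_Pair_le])
       (use norm_Pair_le[of "fst (snd d)" "snd (snd d) + (a * fst d + b * fst (snd d))"] in simp)
  ultimately show ?thesis using d by (simp add: algebra_simps)
qed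

text \<open>On bounded sets the left translation that carries \<open>p\<close> to \<open>q\<close> is small exactly when \<open>q\<close> is close to \<open>p\<close>.\<close>

lemma dist_left_translate_le:
  assumes "norm p \<le> X"
  shows "dist (g \<star> p) p \<le> (3 + 4 * X) * norm g" "norm (q \<star> heis_inv p) \<le> (3 + 4 * X) * dist p q"
proof -
  have p: "\<bar>2 * fst p\<bar> \<le> 2 * X" "\<bar>2 * fst (snd p)\<bar> \<le> 2 * X" "\<bar>- 2 * fst p\<bar> \<le> 2 * X" "\<bar>- 2 * fst (snd p)\<bar> \<le> 2 * X"
    using assms norm_fst_le[of "fst p" "snd p"] norm_snd_le[of "snd p" "fst p"]
      norm_fst_le[of "fst (snd p)" "snd (snd p)"] by auto
  have "g \<star> p - p = (fst g, fst (snd g), snd (snd g) + ((- 2 * fst (snd p)) * fst g + (2 * fst p) * fst (snd g)))"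
    by (cases g; cases p) simp
  then show "dist (g \<star> p) p \<le> (3 + 4 * X) * norm g"
    unfolding dist_norm using norm_shear_le[OF p(4,1), of g] by simp
  have "q \<star> heis_inv p = (fst (q - p), fst (snd (q - p)),
      snd (snd (q - p)) + ((2 * fst (snd p)) * fst (q - p) + (- 2 * fst p) * fst (snd (q - p))))"
    by (cases q; cases p) (simp add: algebra_simps)
  then show "norm (q \<star> heis_inv p) \<le> (3 + 4 * X) * dist p q"
    using norm_shear_le[OF p(2,3), of "q - p"] by (simp add: dist_norm norm_minus_commute[of p q])
qed

text \<open>Where a point and its left translate both lie in \<open>\<Omega>\<close>, the difference \<open>u (g \<cdot> x) - u x\<close> is again
  preserved by averaging; where one of them does not, both are near the boundary and the boundary estimate applies.
  The walk functions themselves are not continuous, so continuity holds only up to \<open>\<kappa>\<close> once \<open>s\<close> is small.\<close>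

lemma dpp_equicontinuous:
  assumes \<Omega>: "open \<Omega>" "bounded \<Omega>" and \<Phi>: "continuous_on UNIV \<Phi>" "\<And>p. \<bar>\<Phi> p\<bar> \<le> B"
    and ext: "\<And>p0. p0 \<in> frontier \<Omega> \<Longrightarrow> exterior_koranyi \<Omega> p0" and \<kappa>: "\<kappa> > 0"
  obtains \<omega> where "\<omega> > 0"
    "\<And>s u p q. 0 < s \<Longrightarrow> s < \<omega> \<Longrightarrow> dpp \<Omega> \<Phi> s u \<Longrightarrow> (\<And>q. \<bar>u q\<bar> \<le> B) \<Longrightarrow> p \<in> \<Omega> \<Longrightarrow>
       dist p q < \<omega> \<Longrightarrow> \<bar>u q - u p\<bar> \<le> \<kappa>"
proof -
  have k2: "\<kappa> / 2 > 0" using \<kappa> by simp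
  obtain w where w: "w > 0"
    "\<And>s u p p0. 0 < s \<Longrightarrow> s < w \<Longrightarrow> dpp \<Omega> \<Phi> s u \<Longrightarrow> (\<And>q. \<bar>u q\<bar> \<le> B) \<Longrightarrow> p \<in> \<Omega> \<Longrightarrow>
       p0 \<in> frontier \<Omega> \<Longrightarrow> dist p p0 < w \<Longrightarrow> \<bar>u p - \<Phi> p\<bar> \<le> \<kappa> / 2"
    using boundary_uniform[OF \<Omega> \<Phi> ext k2] by blast
  obtain X where X: "X > 0" "\<And>p. p \<in> \<Omega> \<Longrightarrow> norm p \<le> X" using \<Omega>(2) by (auto simp: bounded_pos)
  obtain L where L: "L > 0" "\<And>s p q. 0 \<le> s \<Longrightarrow> p \<in> \<Omega> \<Longrightarrow> q \<in> nbrs s p \<Longrightarrow> dist q p \<le> s * L"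
    using nbrs_dist[OF \<Omega>(2)] by metis
  define R where "R = X + L"
  have R: "R > 0" using X L by (simp add: R_def)
  define A where "A = 3 + 4 * R"
  have A: "A > 0" using R by (simp add: A_def)
  have "uniformly_continuous_on (cball 0 (R + 1)) \<Phi>"
    by (rule compact_uniformly_continuous) (use continuous_on_subset[OF \<Phi>(1)] in auto)
  then obtain d where d0: "d > 0" "\<forall>x\<in>cball 0 (R + 1). \<forall>x'\<in>cball 0 (R + 1). dist x' x < d \<longrightarrow> dist (\<Phi> x') (\<Phi> x) < \<kappa> / 2"
    using k2 unfolding uniformly_continuous_on_def by blast
  then have d: "d > 0" "\<And>x y. norm x \<le> R + 1 \<Longrightarrow> norm y \<le> R + 1 \<Longrightarrow> dist x y < d \<Longrightarrow> \<bar>\<Phi> x - \<Phi> y\<bar> < \<kappa> / 2"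
    by (auto simp: dist_real_def)
  define \<theta> where "\<theta> = min (min w d) 1"
  have \<theta>: "\<theta> > 0" using w d by (simp add: \<theta>_def)
  define \<omega> where "\<omega> = min \<theta> (\<theta> / (A * A))"
  have \<omega>: "\<omega> > 0" using \<theta> A by (simp add: \<omega>_def)
  show thesis
  proof (rule that[OF \<omega>])
    fix s u p q assume s: "0 < s" "s < \<omega>" and u: "dpp \<Omega> \<Phi> s u" and uB: "\<And>q. \<bar>u q\<bar> \<le> B"
      and p: "p \<in> \<Omega>" and pq: "dist p q < \<omega>"
    have s1: "s < w" "s \<le> 1" using s by (auto simp: \<omega>_def \<theta>_def)
    have cl: "\<bar>u y - u x\<bar> \<le> \<kappa>" if "x \<notin> \<Omega> \<or> y \<notin> \<Omega>" "norm x \<le> R + 1" "norm y \<le> R + 1" "dist x y < \<theta>" for x y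
    proof -
      have one: "\<bar>u y - u x\<bar> \<le> \<kappa>" if "y \<notin> \<Omega>" "norm x \<le> R + 1" "norm y \<le> R + 1" "dist x y < \<theta>" for x y
      proof -
        note yn = that(1)
        have uy: "u y = \<Phi> y" using u that(1) by (rule dpp_out)
        have pos_power: "\<bar>\<Phi> x - \<Phi> y\<bar> < \<kappa> / 2" using d(2) that by (simp add: \<theta>_def)
        have "\<bar>u x - \<Phi> x\<bar> \<le> \<kappa> / 2"
        proof (cases "x \<in> \<Omega>")
          case True
          obtain p0 where "p0 \<in> frontier \<Omega>" "dist x p0 \<le> dist x y"
            using segment_meets_frontier[OF True yn] .
          then show ?thesis using w(2)[OF s(1) s1(1) u uB True] that(4) by (simp add: \<theta>_def)
        next
          case False
          then show ?thesis using dpp_out[OF u] k2 by simp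
        qed
        then show ?thesis using pos_power uy unfolding abs_le_iff abs_less_iff by argo
      qed
      show ?thesis using one[of y x] one[of x y] that by (auto simp: dist_commute abs_minus_commute)
    qed
    \<comment> \<open>the left translation that carries \<open>p\<close> to \<open>q\<close>\<close>
    define g where "g = q \<star> heis_inv p"
    have gp: "g \<star> p = q" by (simp add: g_def hprod_assoc heis_mult_inv)
    have Xp: "norm p \<le> R" using X(2)[OF p] L by (simp add: R_def)
    have "norm g \<le> A * dist p q" unfolding g_def A_def by (rule dist_left_translate_le(2)[OF Xp])
    also have "\<dots> < A * (\<theta> / (A * A))" using pq A by (intro mult_strict_left_mono) (auto simp: \<omega>_def)
    finally have g: "A * norm g < \<theta>" using A by (simp add: field_simps)
    have near: "dist x (g \<star> x) < \<theta>" "norm (g \<star> x) \<le> R + 1" if "norm x \<le> R" for x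
    proof -
      have "dist (g \<star> x) x \<le> A * norm g" unfolding A_def by (rule dist_left_translate_le(1)[OF that])
      then show *: "dist x (g \<star> x) < \<theta>" using g by (simp add: dist_commute)
      have "norm (g \<star> x) \<le> norm x + dist x (g \<star> x)" 
        by (metis dist_norm norm_minus_commute norm_triangle_sub)
      then show "norm (g \<star> x) \<le> R + 1" using * that by (simp add: \<theta>_def)
    qed
    define D where "D = \<Omega> \<inter> {x. g \<star> x \<in> \<Omega>}"
    have out: "\<bar>u (g \<star> x) - u x\<bar> \<le> \<kappa>" if "norm x \<le> R" "x \<notin> D" for x
      by (rule cl) (use that near[OF that(1)] in \<open>auto simp: D_def\<close>)
    show "\<bar>u q - u p\<bar> \<le> \<kappa>"
    proof (cases "p \<in> D")
      case False
      then show ?thesis using out[OF Xp] gp by simp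
    next
      case True
      have D: "bounded D" using \<Omega>(2) by (rule bounded_subset) (auto simp: D_def)
      have nb: "norm x \<le> R" if "y \<in> D" "x \<in> nbrs s y" for x y
      proof -
        have y: "y \<in> \<Omega>" using that by (simp add: D_def)
        have "dist x y \<le> s * L" using L(2)[OF _ y that(2)] s by simp
        also have "\<dots> \<le> 1 * L" using s1 L by (intro mult_right_mono) auto
        finally have "dist x y \<le> L" by simp
        moreover have "norm x \<le> norm y + dist x y"
          by (metis dist_norm norm_triangle_sub)
        ultimately show ?thesis using X(2)[OF y] by (simp add: R_def)
      qed
      have eq: "u (g \<star> x) - u x = avg s (\<lambda>x. u (g \<star> x) - u x) x" if "x \<in> D" for x
        using u that by (simp add: D_def dpp_def avg_diff avg_translate)
      have "u (g \<star> p) - u p \<le> \<kappa>"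
      proof (rule avg_max_principle[where f = "\<lambda>x. u (g \<star> x) - u x" and D = D and B = "B + B", OF s(1) D])
        show "u (g \<star> x) - u x \<le> B + B" for x using uB[of "g \<star> x"] uB[of x] unfolding abs_le_iff by argo
        show "u (g \<star> x) - u x \<le> \<kappa>" if "y \<in> D" "x \<in> nbrs s y" "x \<notin> D" for x y
          using out[OF nb[OF that(1,2)] that(3)] by simp
      qed (use eq True in auto)
      moreover have "- (u (g \<star> p) - u p) \<le> \<kappa>"
      proof (rule avg_max_principle[where f = "\<lambda>x. - (u (g \<star> x) - u x)" and D = D and B = "B + B", OF s(1) D])
        show "- (u (g \<star> x) - u x) \<le> B + B" for x using uB[of "g \<star> x"] uB[of x] unfolding abs_le_iff by argo
        show "- (u (g \<star> x) - u x) \<le> \<kappa>" if "y \<in> D" "x \<in> nbrs s y" "x \<notin> D" for x y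
          using out[OF nb[OF that(1,2)] that(3)] by simp
        show "- (u (g \<star> x) - u x) \<le> avg s (\<lambda>x. - (u (g \<star> x) - u x)) x" if "x \<in> D" for x
          unfolding avg_minus using eq[OF that] by simp
      qed (rule True)
      ultimately show ?thesis by (simp add: gp abs_le_iff)
    qed
  qed
qed

text \<open>Pointwise convergence on a countable dense set extends to all points by asymptotic equicontinuity.\<close>

lemma dpp_limit:
  assumes \<Omega>: "open \<Omega>" "bounded \<Omega>" and \<Phi>: "continuous_on UNIV \<Phi>" "\<And>p. \<bar>\<Phi> p\<bar> \<le> B"
    and ext: "\<And>p0. p0 \<in> frontier \<Omega> \<Longrightarrow> exterior_koranyi \<Omega> p0"
  obtains \<sigma> U u where "\<And>n. \<sigma> n > 0" "\<sigma> \<longlonglongrightarrow> 0" "\<And>n. U n \<in> borel_measurable borel" "\<And>n p. \<bar>U n p\<bar> \<le> B"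
    "\<And>n. dpp \<Omega> \<Phi> (\<sigma> n) (U n)" "\<And>p. (\<lambda>n. U n p) \<longlonglongrightarrow> u p" "continuous_on UNIV u" "\<And>p. p \<notin> \<Omega> \<Longrightarrow> u p = \<Phi> p"
proof -
  have \<Phi>m: "\<Phi> \<in> borel_measurable borel" using \<Phi>(1) by (rule borel_measurable_continuous_onI)
  define s where "s = (\<lambda>n. 1 / real (Suc n))"
  have s: "s n > 0" for n by (simp add: s_def)
  have slim: "s \<longlonglongrightarrow> 0" unfolding s_def using LIMSEQ_inverse_real_of_nat by (simp add: inverse_eq_divide)
  have "\<exists>u. u \<in> borel_measurable borel \<and> (\<forall>p. \<bar>u p\<bar> \<le> B) \<and> dpp \<Omega> \<Phi> (s n) u" for n
    using dpp_exists[OF \<Omega>(1) \<Phi>m \<Phi>(2), of "s n"] by metis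
  then obtain V where V: "\<And>n. V n \<in> borel_measurable borel" "\<And>n p. \<bar>V n p\<bar> \<le> B" "\<And>n. dpp \<Omega> \<Phi> (s n) (V n)"
    by metis
  obtain T :: "heis set" where T: "countable T" "\<And>S. open S \<Longrightarrow> S \<noteq> {} \<Longrightarrow> \<exists>x\<in>T. x \<in> S"
    using countable_dense_setE by blast
  obtain k :: "nat \<Rightarrow> nat" where k: "strict_mono k" "\<And>x. x \<in> T \<Longrightarrow> \<exists>l. (\<lambda>n. V (k n) x) \<longlonglongrightarrow> l"
    by (rule function_convergent_subsequence[OF T(1), of V B]) (use V(2) in auto)
  define U where "U = (\<lambda>n. V (k n))"
  define \<sigma> where "\<sigma> = (\<lambda>n. s (k n))"
  have \<sigma>: "\<sigma> n > 0" for n by (simp add: \<sigma>_def s)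
  have \<sigma>lim: "\<sigma> \<longlonglongrightarrow> 0" unfolding \<sigma>_def using LIMSEQ_subseq_LIMSEQ[OF slim k(1)] by (simp add: o_def)
  have U: "U n \<in> borel_measurable borel" "\<bar>U n p\<bar> \<le> B" "dpp \<Omega> \<Phi> (\<sigma> n) (U n)" for n p
    using V by (auto simp: U_def \<sigma>_def)
  have equi: "\<exists>\<omega>>0. \<exists>N. \<forall>n\<ge>N. \<forall>p\<in>\<Omega>. \<forall>q. dist p q < \<omega> \<longrightarrow> \<bar>U n q - U n p\<bar> \<le> \<kappa>" if \<kappa>: "\<kappa> > 0" for \<kappa>
  proof -
    obtain \<omega> where \<omega>: "\<omega> > 0"
      "\<And>s u p q. 0 < s \<Longrightarrow> s < \<omega> \<Longrightarrow> dpp \<Omega> \<Phi> s u \<Longrightarrow> (\<And>q. \<bar>u q\<bar> \<le> B) \<Longrightarrow> p \<in> \<Omega> \<Longrightarrow>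
         dist p q < \<omega> \<Longrightarrow> \<bar>u q - u p\<bar> \<le> \<kappa>"
      using dpp_equicontinuous[OF \<Omega> \<Phi> ext \<kappa>] by blast
    have "eventually (\<lambda>n. \<sigma> n < \<omega>) sequentially" using order_tendstoD(2)[OF \<sigma>lim \<omega>(1)] .
    then obtain N where "\<And>n. n \<ge> N \<Longrightarrow> \<sigma> n < \<omega>" by (auto simp: eventually_sequentially)
    then show ?thesis using \<omega> \<sigma> U(2,3) by meson
  qed
  have "convergent (\<lambda>n. U n p)" for p
  proof (cases "p \<in> \<Omega>")
    case False
    then have "(\<lambda>n. U n p) = (\<lambda>n. \<Phi> p)" using dpp_out[OF U(3)] by auto
    then show ?thesis by (simp add: convergent_const)
  next
    case True
    have "Cauchy (\<lambda>n. U n p)"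
    proof (rule metric_CauchyI)
      fix e :: real assume e: "e > 0"
      then have "e / 4 > 0" by simp
      from equi[OF this] obtain \<omega> N where \<omega>: "\<omega> > 0" "\<And>n q. n \<ge> N \<Longrightarrow> dist p q < \<omega> \<Longrightarrow> \<bar>U n q - U n p\<bar> \<le> e / 4"
        using True by meson
      obtain q where q: "q \<in> T" "dist p q < \<omega>" using T(2)[of "ball p \<omega>"] \<omega>(1) by auto
      have "convergent (\<lambda>n. U n q)" using k(2)[OF q(1)] by (simp add: U_def convergent_def)
      then have "Cauchy (\<lambda>n. U n q)" by (rule convergent_Cauchy)
      then obtain M where M: "\<And>m n. m \<ge> M \<Longrightarrow> n \<ge> M \<Longrightarrow> dist (U m q) (U n q) < e / 4"
        using e metric_CauchyD[of "\<lambda>n. U n q" "e / 4"] by auto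
      show "\<exists>M. \<forall>m\<ge>M. \<forall>n\<ge>M. dist (U m p) (U n p) < e"
      proof (intro exI[of _ "max M N"] allI impI)
        fix m n assume mn: "m \<ge> max M N" "n \<ge> max M N"
        have "\<bar>U m q - U m p\<bar> \<le> e / 4" "\<bar>U n q - U n p\<bar> \<le> e / 4" "\<bar>U m q - U n q\<bar> < e / 4"
          using \<omega>(2)[OF _ q(2)] M mn by (auto simp: dist_real_def)
        then show "dist (U m p) (U n p) < e" using e unfolding dist_real_def abs_le_iff abs_less_iff by argo
      qed
    qed
    then show ?thesis by (rule Cauchy_convergent)
  qed
  then obtain u where u: "\<And>p. (\<lambda>n. U n p) \<longlonglongrightarrow> u p" unfolding convergent_def by metis
  have uout: "u p = \<Phi> p" if "p \<notin> \<Omega>" for p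
  proof -
    have "(\<lambda>n. U n p) = (\<lambda>n. \<Phi> p)" using dpp_out[OF U(3) that] by auto
    then show ?thesis using LIMSEQ_unique[OF u[of p]] by simp
  qed
  have uequi: "\<exists>\<omega>>0. \<forall>p\<in>\<Omega>. \<forall>q. dist p q < \<omega> \<longrightarrow> \<bar>u q - u p\<bar> \<le> \<kappa>" if "\<kappa> > 0" for \<kappa>
  proof -
    obtain \<omega> N where \<omega>: "\<omega> > 0" "\<And>n p q. n \<ge> N \<Longrightarrow> p \<in> \<Omega> \<Longrightarrow> dist p q < \<omega> \<Longrightarrow> \<bar>U n q - U n p\<bar> \<le> \<kappa>"
      using equi[OF \<open>\<kappa> > 0\<close>] by meson
    have "\<bar>u q - u p\<bar> \<le> \<kappa>" if "p \<in> \<Omega>" "dist p q < \<omega>" for p q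
      by (rule LIMSEQ_le_const2[OF tendsto_rabs[OF tendsto_diff[OF u u]]]) (use \<omega>(2) that in blast)
    then show ?thesis using \<omega>(1) by blast
  qed
  have "continuous_on UNIV u"
    unfolding continuous_on_iff
  proof (intro ballI allI impI)
    fix p :: heis and e :: real assume e: "e > 0"
    then have "e / 2 > 0" by simp
    from uequi[OF this] obtain \<omega> where \<omega>: "\<omega> > 0" "\<And>p q. p \<in> \<Omega> \<Longrightarrow> dist p q < \<omega> \<Longrightarrow> \<bar>u q - u p\<bar> \<le> e / 2"
      by meson
    obtain d where d: "d > 0" "\<And>q. dist q p < d \<Longrightarrow> dist (\<Phi> q) (\<Phi> p) < e"
      using \<Phi>(1) e unfolding continuous_on_iff by (metis UNIV_I)
    show "\<exists>d>0. \<forall>q\<in>UNIV. dist q p < d \<longrightarrow> dist (u q) (u p) < e"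
    proof (intro exI[of _ "min \<omega> d"] conjI ballI impI)
      fix q assume q: "dist q p < min \<omega> d"
      consider "p \<in> \<Omega>" | "q \<in> \<Omega>" | "p \<notin> \<Omega>" "q \<notin> \<Omega>" by blast
      then show "dist (u q) (u p) < e"
      proof cases
        case 1
        then show ?thesis using \<omega>(2)[OF 1, of q] q e by (simp add: dist_real_def dist_commute)
      next
        case 2
        then show ?thesis using \<omega>(2)[OF 2, of p] q e by (simp add: dist_real_def abs_minus_commute)
      next
        case 3
        then show ?thesis using d(2)[of q] q uout by simp
      qed
    qed (use \<omega> d in auto)
  qed
  then show thesis using that[of \<sigma> U u] \<sigma> \<sigma>lim U u uout by blast
qed

section \<open>Weakly harmonic functions\<close>

lemma heis_laplacian_continuous:
  assumes U: "open U" and f: "Ck_on 2 U f"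
  shows "continuous_on U (heis_laplacian f)"
proof -
  have f2: "Ck_on (Suc (Suc 0)) U f" using f by (simp add: numeral_2_eq_2)
  have c: "continuous_on U (hdiff a b (hdiff a b f))" for a b
    using Ck_on_hdiff[OF U Ck_on_hdiff[OF U f2, of a b], of a b] by simp
  have "continuous_on U (\<lambda>p. hdiff 1 0 (hdiff 1 0 f) p + hdiff 0 1 (hdiff 0 1 f) p)"
    by (intro continuous_on_add c)
  then show ?thesis by (rule continuous_on_eq) (simp add: heis_laplacian_hdiff[OF U f])
qed

lemma discrete_laplacian_tendsto:
  assumes U: "open U" and f: "Ck_on 2 U f" and p: "p \<in> U" and \<sigma>: "\<And>n. \<sigma> n > 0" "\<sigma> \<longlonglongrightarrow> 0"
  shows "(\<lambda>n. 4 * (avg (\<sigma> n) f p - f p) / (\<sigma> n)\<^sup>2) \<longlonglongrightarrow> heis_laplacian f p"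
proof (rule metric_LIMSEQ_I)
  fix e :: real assume "e > 0"
  then have "e / 2 > 0" by simp
  then obtain s0 where s0: "s0 > 0"
    "\<And>s q. 0 < s \<Longrightarrow> s < s0 \<Longrightarrow> q \<in> {p} \<Longrightarrow> \<bar>4 * (avg s f q - f q) / s\<^sup>2 - heis_laplacian f q\<bar> \<le> e / 2"
    using discrete_laplacian_uniform[OF U f, of "{p}" "e / 2"] p by auto
  obtain N where N: "\<And>n. n \<ge> N \<Longrightarrow> \<sigma> n < s0"
    using order_tendstoD(2)[OF \<sigma>(2) s0(1)] by (auto simp: eventually_sequentially)
  have "dist (4 * (avg (\<sigma> n) f p - f p) / (\<sigma> n)\<^sup>2) (heis_laplacian f p) < e" if "n \<ge> N" for n
    using s0(2)[OF \<sigma>(1) N[OF that], of p] \<open>e > 0\<close> by (simp add: dist_real_def)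
  then show "\<exists>N. \<forall>n\<ge>N. dist (4 * (avg (\<sigma> n) f p - f p) / (\<sigma> n)\<^sup>2) (heis_laplacian f p) < e"
    by blast
qed

lemma inverse_Suc_seq: "1 / real (Suc n) > 0" "(\<lambda>n. 1 / real (Suc n)) \<longlonglongrightarrow> 0"
  using LIMSEQ_inverse_real_of_nat by (simp_all add: inverse_eq_divide)

lemma heis_laplacian_diff:
  assumes U: "open U" and f: "Ck_on 2 U f" and g: "Ck_on 2 U g" and p: "p \<in> U"
  shows "heis_laplacian (\<lambda>q. f q - g q) p = heis_laplacian f p - heis_laplacian g p"
proof -
  note l = discrete_laplacian_tendsto[OF U _ p inverse_Suc_seq]
  have "4 * (a - b - (c - d)) / s = 4 * (a - c) / s - 4 * (b - d) / s" for a b c d s :: real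
    unfolding diff_divide_distrib[symmetric] by (rule arg_cong[where f = "\<lambda>x. x / s"]) simp
  then have eq: "4 * (avg h (\<lambda>q. f q - g q) p - (f p - g p)) / h\<^sup>2
     = 4 * (avg h f p - f p) / h\<^sup>2 - 4 * (avg h g p - g p) / h\<^sup>2" for h
    unfolding avg_diff by blast
  show ?thesis
    by (rule LIMSEQ_unique[OF l[OF Ck_on_diff[OF U f g]]], unfold eq, rule tendsto_diff[OF l[OF f] l[OF g]])
qed

lemma integrable_bounded_mult_compact:
  fixes U \<psi> :: "heis \<Rightarrow> real"
  assumes [measurable]: "U \<in> borel_measurable borel" and B: "\<And>p. \<bar>U p\<bar> \<le> B"
    and \<psi>: "continuous_on UNIV \<psi>" and S: "compact S" "\<And>p. p \<notin> S \<Longrightarrow> \<psi> p = 0"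
  shows "integrable lborel (\<lambda>p. U p * \<psi> p)"
proof -
  have [measurable]: "\<psi> \<in> borel_measurable borel" using \<psi> by (rule borel_measurable_continuous_onI)
  have "integrable lborel (\<lambda>x. indicator S x *\<^sub>R \<psi> x)"
    by (rule borel_integrable_compact[OF S(1)]) (rule continuous_on_subset[OF \<psi>], simp)
  moreover have "(\<lambda>x. indicator S x *\<^sub>R \<psi> x) = \<psi>"
    using S(2) by (auto simp: fun_eq_iff indicator_def)
  ultimately have "integrable lborel (\<lambda>x. B * \<psi> x)" by simp
  then show ?thesis
  proof (rule Bochner_Integration.integrable_bound)
    show "AE x in lborel. norm (U x * \<psi> x) \<le> norm (B * \<psi> x)"
    proof (rule AE_I2)
      fix x :: heis
      have "\<bar>U x\<bar> \<le> \<bar>B\<bar>" using B[of x] by linarith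
      then show "norm (U x * \<psi> x) \<le> norm (B * \<psi> x)" by (simp add: abs_mult mult_right_mono)
    qed
  qed simp
qed

lemma integral_shift:
  fixes U \<psi> :: "heis \<Rightarrow> real"
  assumes [measurable]: "U \<in> borel_measurable borel" "\<psi> \<in> borel_measurable borel"
  shows "(\<integral>p. U p * \<psi> (p \<star> e) \<partial>lborel) = (\<integral>p. U (p \<star> heis_inv e) * \<psi> p \<partial>lborel)"
proof -
  have "(\<integral>p. U ((p \<star> e) \<star> heis_inv e) * \<psi> (p \<star> e) \<partial>lborel) = (\<integral>p. U (p \<star> heis_inv e) * \<psi> p \<partial>lborel)"
    by (rule lborel_integral_right) simp
  then show ?thesis by (simp add: hprod_assoc heis_mult_inv)
qed

text \<open>Right translations preserve Lebesgue measure and the set of steps is closed under inversion.\<close>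

lemma avg_self_adjoint:
  fixes U \<psi> :: "heis \<Rightarrow> real"
  assumes U [measurable]: "U \<in> borel_measurable borel" and B: "\<And>p. \<bar>U p\<bar> \<le> B"
    and \<psi>: "continuous_on UNIV \<psi>" and S: "compact S" "\<And>p. p \<notin> S \<Longrightarrow> \<psi> p = 0"
  shows "(\<integral>p. U p * avg s \<psi> p \<partial>lborel) = (\<integral>p. avg s U p * \<psi> p \<partial>lborel)"
    "integrable lborel (\<lambda>p. U p * avg s \<psi> p)" "integrable lborel (\<lambda>p. avg s U p * \<psi> p)"
proof -
  have \<psi>m [measurable]: "\<psi> \<in> borel_measurable borel" using \<psi> by (rule borel_measurable_continuous_onI)
  have i2: "integrable lborel (\<lambda>p. U (p \<star> e) * \<psi> p)" for e
    by (rule integrable_bounded_mult_compact[OF _ B \<psi> S]) simp_all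
  have i1: "integrable lborel (\<lambda>p. U p * \<psi> (p \<star> e))" for e
  proof -
    have "integrable lborel (\<lambda>p. U ((p \<star> e) \<star> heis_inv e) * \<psi> (p \<star> e))"
      by (rule lborel_integrable_right) (rule i2)
    then show ?thesis by (simp add: hprod_assoc heis_mult_inv)
  qed
  have e1: "(\<lambda>p. U p * avg s \<psi> p) = (\<lambda>p. (U p * \<psi> (p \<star> (s, 0, 0)) + U p * \<psi> (p \<star> (- s, 0, 0)) +
      U p * \<psi> (p \<star> (0, s, 0)) + U p * \<psi> (p \<star> (0, - s, 0))) / 4)"
    and e2: "(\<lambda>p. avg s U p * \<psi> p) = (\<lambda>p. (U (p \<star> (s, 0, 0)) * \<psi> p + U (p \<star> (- s, 0, 0)) * \<psi> p +
      U (p \<star> (0, s, 0)) * \<psi> p + U (p \<star> (0, - s, 0)) * \<psi> p) / 4)"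
    by (simp_all add: avg_def algebra_simps add_divide_distrib)
  show "integrable lborel (\<lambda>p. U p * avg s \<psi> p)" unfolding e1 by (intro integrable_divide Bochner_Integration.integrable_add i1)
  show "integrable lborel (\<lambda>p. avg s U p * \<psi> p)" unfolding e2 by (intro integrable_divide Bochner_Integration.integrable_add i2)
  have sh: "(\<integral>p. U p * \<psi> (p \<star> (a, b, 0)) \<partial>lborel) = (\<integral>p. U (p \<star> (- a, - b, 0)) * \<psi> p \<partial>lborel)" for a b
    using integral_shift[OF U \<psi>m, of "(a, b, 0)"] by simp
  show "(\<integral>p. U p * avg s \<psi> p \<partial>lborel) = (\<integral>p. avg s U p * \<psi> p \<partial>lborel)"
    unfolding e1 e2
    by (simp add: i1 i2 sh Bochner_Integration.integral_add Bochner_Integration.integrable_add)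
qed

text \<open>Test functions are \<open>C\<^sup>2\<close> only, because the kernels used below are not smoother.\<close>

definition weakly_harmonic :: "heis set \<Rightarrow> (heis \<Rightarrow> real) \<Rightarrow> bool" where
  "weakly_harmonic \<Omega> u \<longleftrightarrow> continuous_on UNIV u \<and>
     (\<forall>\<psi> S. Ck_on 2 UNIV \<psi> \<longrightarrow> compact S \<longrightarrow> S \<subseteq> \<Omega> \<longrightarrow> (\<forall>p. p \<notin> S \<longrightarrow> \<psi> p = 0) \<longrightarrow>
        (\<integral>p. u p * heis_laplacian \<psi> p \<partial>lborel) = 0)"

text \<open>Moving the averages to the test function turns the walk equation into the vanishing of the integrals of \<open>u\<^sub>n\<close>
  against discrete sub-Laplacians of the test function; these converge boundedly with supports in a fixed compact set.\<close>

lemma weakly_harmonic_limit: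
  assumes u: "continuous_on UNIV u" and \<sigma>: "\<And>n. \<sigma> n > 0" "\<sigma> \<longlonglongrightarrow> 0"
    and U [measurable]: "\<And>n. U n \<in> borel_measurable borel" and B: "\<And>n p. \<bar>U n p\<bar> \<le> B"
    and dp: "\<And>n p. p \<in> \<Omega> \<Longrightarrow> U n p = avg (\<sigma> n) (U n) p"
    and lim: "\<And>p. (\<lambda>n. U n p) \<longlonglongrightarrow> u p"
  shows "weakly_harmonic \<Omega> u"
  unfolding weakly_harmonic_def
proof (intro conjI u allI impI)
  fix \<psi> :: "heis \<Rightarrow> real" and S
  assume \<psi>: "Ck_on 2 UNIV \<psi>" and S: "compact S" "S \<subseteq> \<Omega>" "\<forall>p. p \<notin> S \<longrightarrow> \<psi> p = 0"
  have S0: "\<And>p. p \<notin> S \<Longrightarrow> \<psi> p = 0" using S(3) by blast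
  have \<psi>c: "continuous_on UNIV \<psi>" using \<psi> by (rule Ck_on_continuous)
  have [measurable]: "\<psi> \<in> borel_measurable borel" using \<psi>c by (rule borel_measurable_continuous_onI)
  have [measurable]: "u \<in> borel_measurable borel" using u by (rule borel_measurable_continuous_onI)
  have Lc: "continuous_on UNIV (heis_laplacian \<psi>)" by (rule heis_laplacian_continuous[OF _ \<psi>]) simp
  have [measurable]: "heis_laplacian \<psi> \<in> borel_measurable borel" using Lc by (rule borel_measurable_continuous_onI)
  define D where "D = (\<lambda>s p. 4 * (avg s \<psi> p - \<psi> p) / s\<^sup>2)"
  have [measurable]: "D s \<in> borel_measurable borel" for s unfolding D_def by simp
  have zero: "(\<integral>p. U n p * D (\<sigma> n) p \<partial>lborel) = 0" for n
  proof -
    note sa = avg_self_adjoint[OF U[of n] B[of n] \<psi>c S(1) S0, where s = "\<sigma> n"]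
    have i: "integrable lborel (\<lambda>p. U n p * \<psi> p)"
      by (rule integrable_bounded_mult_compact[OF U[of n] B[of n] \<psi>c S(1) S0])
    have "avg (\<sigma> n) (U n) p * \<psi> p = U n p * \<psi> p" for p
      using dp[of p n] S(2) S0[of p] by (cases "p \<in> S") auto
    then have "(\<integral>p. avg (\<sigma> n) (U n) p * \<psi> p \<partial>lborel) = (\<integral>p. U n p * \<psi> p \<partial>lborel)"
      by (intro Bochner_Integration.integral_cong refl)
    then have "(\<integral>p. U n p * avg (\<sigma> n) \<psi> p - U n p * \<psi> p \<partial>lborel) = 0"
      using Bochner_Integration.integral_diff[OF sa(2) i] sa(1) by linarith
    moreover have "(\<lambda>p. U n p * D (\<sigma> n) p) = (\<lambda>p. 4 / (\<sigma> n)\<^sup>2 * (U n p * avg (\<sigma> n) \<psi> p - U n p * \<psi> p))"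
    proof -
      have "v * (4 * (a - b) / s) = 4 / s * (v * a - v * b)" for v a b s :: real
        by (cases "s = 0") (auto simp: field_simps)
      then show ?thesis unfolding D_def by blast
    qed
    ultimately show ?thesis by (simp only: integral_mult_right_zero mult_zero_right)
  qed
  \<comment> \<open>a compact set outside which all discrete sub-Laplacians with steps at most \<open>1\<close> vanish\<close>
  define C where "C = (\<lambda>z. fst z \<star> snd z) ` (S \<times> cball 0 1)"
  have C: "compact C"
    unfolding C_def by (intro compact_continuous_image continuous_intros compact_Times S(1)) auto
  have D0: "D s p = 0" if s: "0 < s" "s \<le> 1" and p: "p \<notin> C" for s p
  proof -
    have "p \<star> e \<notin> S" if "norm e \<le> 1" for e
    proof
      assume "p \<star> e \<in> S"
      then have "(p \<star> e) \<star> heis_inv e \<in> C"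
        using that unfolding C_def by (intro image_eqI[where x = "(p \<star> e, heis_inv e)"]) (auto simp: heis_inv_eq)
      then show False using p by (simp add: hprod_assoc heis_mult_inv)
    qed
    then have "\<psi> (p \<star> e) = 0" if "norm e \<le> 1" for e using S0 that by blast
    from this[of "(s, 0, 0)"] this[of "(- s, 0, 0)"] this[of "(0, s, 0)"] this[of "(0, - s, 0)"] this[of 0]
    show ?thesis using s by (simp add: D_def avg_def norm_Pair)
  qed
  obtain s0 where s0: "s0 > 0" "\<And>s p. 0 < s \<Longrightarrow> s < s0 \<Longrightarrow> p \<in> C \<Longrightarrow> \<bar>D s p - heis_laplacian \<psi> p\<bar> \<le> 1"
    unfolding D_def by (rule discrete_laplacian_uniform[OF _ \<psi> C _ zero_less_one]) auto
  have "bounded (heis_laplacian \<psi> ` C)"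
    by (intro compact_imp_bounded compact_continuous_image C continuous_on_subset[OF Lc]) auto
  then obtain K where K: "\<And>p. p \<in> C \<Longrightarrow> \<bar>heis_laplacian \<psi> p\<bar> \<le> K" by (auto simp: bounded_iff)
  obtain N where N: "\<And>n. n \<ge> N \<Longrightarrow> \<sigma> n < min s0 1"
    using order_tendstoD(2)[OF \<sigma>(2), of "min s0 1"] s0(1) by (auto simp: eventually_sequentially)
  have bound: "\<bar>U (n + N) p * D (\<sigma> (n + N)) p\<bar> \<le> B * ((K + 1) * indicator C p)" for n p
  proof (cases "p \<in> C")
    case True
    have "\<bar>D (\<sigma> (n + N)) p\<bar> \<le> K + 1"
      using s0(2)[OF \<sigma>(1) _ True, of "n + N"] N[of "n + N"] K[OF True] unfolding abs_le_iff by simp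
    then have "\<bar>U (n + N) p\<bar> * \<bar>D (\<sigma> (n + N)) p\<bar> \<le> B * (K + 1)"
      using B[of "n + N" p] by (intro mult_mono) auto
    then show ?thesis using True by (simp only: abs_mult indicator_simps mult_1_right)
  next
    case False
    then show ?thesis using D0[OF \<sigma>(1) _ False, of "n + N"] N[of "n + N"] by simp
  qed
  have Cfin: "emeasure lborel C < \<infinity>"
    using compact_imp_bounded[OF C] by (rule emeasure_bounded_finite)
  have Cb: "C \<in> sets lborel" using C by (simp add: borel_compact)
  have "(\<lambda>n. \<integral>p. U (n + N) p * D (\<sigma> (n + N)) p \<partial>lborel) \<longlonglongrightarrow> (\<integral>p. u p * heis_laplacian \<psi> p \<partial>lborel)"
  proof (rule integral_dominated_convergence)
    show "integrable lborel (\<lambda>p. B * ((K + 1) * indicator C p))"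
      by (intro integrable_mult_right integrable_real_indicator Cfin Cb)
    show "(\<lambda>p. u p * heis_laplacian \<psi> p) \<in> borel_measurable lborel" by simp
    show "(\<lambda>p. U (n + N) p * D (\<sigma> (n + N)) p) \<in> borel_measurable lborel" for n by simp
    have "(\<lambda>n. D (\<sigma> n) p) \<longlonglongrightarrow> heis_laplacian \<psi> p" for p
      unfolding D_def by (rule discrete_laplacian_tendsto[OF _ \<psi> _ \<sigma>]) auto
    then have "(\<lambda>n. U n p * D (\<sigma> n) p) \<longlonglongrightarrow> u p * heis_laplacian \<psi> p" for p
      by (intro tendsto_mult lim)
    then show "AE p in lborel. (\<lambda>n. U (n + N) p * D (\<sigma> (n + N)) p) \<longlonglongrightarrow> u p * heis_laplacian \<psi> p"
      by (intro AE_I2 LIMSEQ_ignore_initial_segment)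
    show "AE p in lborel. norm (U (n + N) p * D (\<sigma> (n + N)) p) \<le> B * ((K + 1) * indicator C p)" for n
      unfolding real_norm_def by (intro AE_I2 bound)
  qed
  then show "(\<integral>p. u p * heis_laplacian \<psi> p \<partial>lborel) = 0"
    unfolding zero by (rule LIMSEQ_unique[OF _ tendsto_const])
qed

text \<open>Applied to this function, identities for weakly harmonic functions yield normalising constants.\<close>

lemma weakly_harmonic_1: "weakly_harmonic \<Omega> (\<lambda>_. 1)"
  by (rule weakly_harmonic_limit[where U = "\<lambda>_ _. 1" and B = 1, OF _ inverse_Suc_seq]) simp_all

section \<open>A compactly supported mean value kernel\<close>

text \<open>Two formulas that agree at the junction together with their derivatives define a differentiable
  function.\<close>

lemma DERIV_glue:
  fixes f g :: "real \<Rightarrow> real"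
  assumes f: "\<And>x. x \<le> a \<Longrightarrow> (f has_real_derivative f' x) (at x)"
    and g: "\<And>x. x \<ge> a \<Longrightarrow> (g has_real_derivative g' x) (at x)"
    and eq: "f a = g a" "f' a = g' a"
  shows "((\<lambda>x. if x < a then f x else g x) has_real_derivative (if x < a then f' x else g' x)) (at x)"
proof -
  let ?h = "\<lambda>x. if x < a then f x else g x"
  consider "x < a" | "x > a" | "x = a" by linarith
  then show ?thesis
  proof cases
    case 1
    have "(?h has_real_derivative f' x) (at x)"
      by (rule has_field_derivative_transform_within_open[OF f, of x "{..<a}"]) (use 1 in auto)
    then show ?thesis using 1 by simp
  next
    case 2
    have "(?h has_real_derivative g' x) (at x)"
      by (rule has_field_derivative_transform_within_open[OF g, of x "{a<..}"]) (use 2 in auto)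
    then show ?thesis using 2 by simp
  next
    case 3
    have F: "((\<lambda>y. (f y - f a) / (y - a)) \<longlongrightarrow> g' a) (at a)"
      using f[of a] eq by (simp add: has_field_derivative_iff)
    have G: "((\<lambda>y. (g y - g a) / (y - a)) \<longlongrightarrow> g' a) (at a)"
      using g[of a] by (simp add: has_field_derivative_iff)
    have "((\<lambda>y. (?h y - ?h a) / (y - a)) \<longlongrightarrow> g' a) (at_left a)"
      by (rule Lim_transform_eventually[OF filterlim_at_split[THEN iffD1, OF F, THEN conjunct1]])
         (auto simp: eventually_at_filter eq)
    moreover have "((\<lambda>y. (?h y - ?h a) / (y - a)) \<longlongrightarrow> g' a) (at_right a)"
      by (rule Lim_transform_eventually[OF filterlim_at_split[THEN iffD1, OF G, THEN conjunct2]])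
         (auto simp: eventually_at_filter)
    ultimately show ?thesis
      using 3 by (simp add: has_field_derivative_iff filterlim_at_split)
  qed
qed

text \<open>The profile \<open>x\<^sup>-\<^sup>1\<^sup>/\<^sup>2\<close> of the fundamental solution as a function of \<open>N / R\<close>, continued to \<open>x < 1\<close> by its Taylor polynomial
  of degree four at \<open>1\<close>; \<open>fund1\<close> and \<open>fund2\<close> are its first two derivatives.\<close>

definition fund0 :: "real \<Rightarrow> real" where
  "fund0 x = (if x < 1 then 1 + (1 - x) / 2 + 3 * (1 - x)^2 / 8 + 5 * (1 - x)^3 / 16 + 35 * (1 - x)^4 / 128
     else 1 / sqrt x)"

definition fund1 :: "real \<Rightarrow> real" where
  "fund1 x = (if x < 1 then - (1/2 + 3 * (1 - x) / 4 + 15 * (1 - x)^2 / 16 + 35 * (1 - x)^3 / 32)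
     else - 1 / (2 * x * sqrt x))"

definition fund2 :: "real \<Rightarrow> real" where
  "fund2 x = (if x < 1 then 3/4 + 15 * (1 - x) / 8 + 105 * (1 - x)^2 / 32 else 3 / (4 * x^2 * sqrt x))"

lemma fund0_deriv: "(fund0 has_real_derivative fund1 x) (at x)"
  unfolding fund0_def[abs_def] fund1_def
proof (rule DERIV_glue)
  fix x :: real assume "x \<ge> 1"
  then have "x > 0" by simp
  then show "((\<lambda>x. 1 / sqrt x) has_real_derivative - 1 / (2 * x * sqrt x)) (at x)"
    by (auto intro!: derivative_eq_intros simp: field_simps)
qed (auto intro!: derivative_eq_intros simp: field_simps power2_eq_square power3_eq_cube)

lemma fund1_deriv: "(fund1 has_real_derivative fund2 x) (at x)"
  unfolding fund1_def[abs_def] fund2_def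
proof (rule DERIV_glue)
  fix x :: real assume "x \<ge> 1"
  then have x: "x > 0" by simp
  have s: "sqrt x * sqrt x = x" using x by simp
  have "((\<lambda>x. 2 * x * sqrt x) has_real_derivative 2 * sqrt x + 2 * x * (inverse (sqrt x) / 2)) (at x)"
    using x by (auto intro!: derivative_eq_intros)
  from DERIV_divide[OF DERIV_const[of "-1"] this]
  have "((\<lambda>x. - 1 / (2 * x * sqrt x)) has_real_derivative
     (2 * sqrt x + 2 * x * (inverse (sqrt x) / 2)) / (2 * x * sqrt x)^2) (at x)"
    using x by (simp add: power2_eq_square add.commute)
  also have "(2 * sqrt x + 2 * x * (inverse (sqrt x) / 2)) / (2 * x * sqrt x)^2 = 3 / (4 * x^2 * sqrt x)"
  proof -
    have "x * inverse (sqrt x) = sqrt x" using s x by (simp add: field_simps)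
    then have "2 * sqrt x + 2 * x * (inverse (sqrt x) / 2) = 3 * sqrt x" by simp
    moreover have "(2 * x * sqrt x)^2 = (4 * x^2 * sqrt x) * sqrt x" by (simp add: power2_eq_square)
    ultimately show ?thesis using x by simp
  qed
  finally show "((\<lambda>x. - 1 / (2 * x * sqrt x)) has_real_derivative 3 / (4 * x^2 * sqrt x)) (at x)" .
qed (auto intro!: derivative_eq_intros simp: field_simps power2_eq_square power3_eq_cube)

lemma fund2_continuous: "continuous_on UNIV fund2"
proof -
  have "continuous_on ({..1} \<union> {1..}) (\<lambda>x::real. if x < 1 then 3/4 + 15 * (1 - x) / 8 + 105 * (1 - x)^2 / 32 else 3 / (4 * x^2 * sqrt x))"
    by (rule continuous_on_cases) (auto intro!: continuous_intros)
  moreover have "{..1} \<union> {1..} = (UNIV :: real set)" by auto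
  ultimately show ?thesis unfolding fund2_def[abs_def] by simp
qed

text \<open>Powers of the positive part, given by cases so that the junction lemma for derivatives applies.\<close>

definition pos_power :: "nat \<Rightarrow> real \<Rightarrow> real" where
  "pos_power n x = (if x < 0 then 0 else x ^ n)"

lemma pos_power_deriv: "n \<ge> 1 \<Longrightarrow> (pos_power (Suc n) has_real_derivative real (Suc n) * pos_power n x) (at x)"
proof -
  assume n: "n \<ge> 1"
  have "((\<lambda>x. if x < 0 then 0 else x ^ Suc n) has_real_derivative (if x < 0 then 0 else real (Suc n) * x ^ n)) (at x)"
  proof (rule DERIV_glue)
    show "((\<lambda>x. x ^ Suc n) has_real_derivative real (Suc n) * x ^ n) (at x)" for x
      using DERIV_pow[of "Suc n" x UNIV] by simp
  qed (use n in auto)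
  then show ?thesis unfolding pos_power_def[abs_def] by (simp split: if_splits)
qed

lemma pos_power_nonneg [simp]: "pos_power n x \<ge> 0" by (simp add: pos_power_def)

lemma pos_power1_continuous: "continuous_on UNIV (pos_power 1)"
proof -
  have "pos_power 1 = (\<lambda>x. max 0 x)" by (auto simp: pos_power_def fun_eq_iff)
  then show ?thesis by (auto intro: continuous_intros)
qed

text \<open>The polynomial branch matches \<open>x\<^sup>-\<^sup>1\<^sup>/\<^sup>2\<close> to fourth order at \<open>x = 1\<close>, and the left-hand side
  vanishes for the outer branch because the fundamental solution is harmonic.  For the inner branch it is a cubic, which must
  therefore be a multiple of \<open>(1 - x)\<^sup>3\<close>; this order of vanishing makes the mean value kernel \<open>C\<^sup>2\<close>.\<close>

lemma fund_equation: "24 * fund1 x + 16 * x * fund2 x = - (315 / 4) * pos_power 3 (1 - x)"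
proof (cases "x < 1")
  case True
  define y where "y = 1 - x"
  have x: "x = 1 - y" by (simp add: y_def)
  have "24 * (- (1/2 + 3 * y / 4 + 15 * y^2 / 16 + 35 * y^3 / 32)) + 16 * (1 - y) * (3/4 + 15 * y / 8 + 105 * y^2 / 32)
     = - (315 / 4) * y^3"
    by (simp add: field_simps power2_eq_square power3_eq_cube)
  then show ?thesis using True by (simp add: fund1_def fund2_def pos_power_def y_def)
next
  case False
  then have "x > 0" by simp
  then show ?thesis using False by (simp add: fund1_def fund2_def pos_power_def field_simps power2_eq_square)
qed

text \<open>Up to a constant factor the sub-Laplacian of the regularised fundamental solution.\<close>

definition weight :: "real \<Rightarrow> heis \<Rightarrow> real" where
  "weight R p = zsq p * (pos_power 3 (1 - kor p / R) / (R * sqrt R))"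

lemma weight_inv [simp]: "weight R (heis_inv p) = weight R p"
  by (simp add: weight_def)

lemma weight_nonneg: "R > 0 \<Longrightarrow> weight R p \<ge> 0"
  by (simp add: weight_def)

lemma weight_outside: "R > 0 \<Longrightarrow> kor p \<ge> R \<Longrightarrow> weight R p = 0"
  by (cases "kor p = R") (auto simp: weight_def pos_power_def field_simps)

lemma Ck_on_pos_power3_kor:
  assumes "open U" "Ck_on 2 U (\<lambda>p. N p)"
  shows "Ck_on 2 U (\<lambda>p. pos_power 3 (1 - N p / R) / c)"
proof -
  define G where "G = (\<lambda>i::nat. if i = 0 then pos_power 3 else if i = 1 then (\<lambda>x. 3 * pos_power 2 x) else (\<lambda>x. 6 * pos_power 1 x))"
  have l: "Ck_on 2 U (\<lambda>p. 1 - N p * inverse R)"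
    by (intro Ck_on_intros assms)
  have "Ck_on 2 U (\<lambda>p. G 0 (1 - N p * inverse R))"
  proof (rule Ck_on_compose[OF assms(1) l, of UNIV])
    fix i :: nat and y :: real assume i: "i < 2"
    have "(pos_power 3 has_real_derivative 3 * pos_power 2 y) (at y)"
      using pos_power_deriv[of 2 y] by (simp add: eval_nat_numeral)
    moreover have "((\<lambda>x. 3 * pos_power 2 x) has_real_derivative 6 * pos_power 1 y) (at y)"
      using DERIV_cmult[OF pos_power_deriv[of 1 y], of 3] by (simp add: eval_nat_numeral)
    ultimately show "(G i has_real_derivative G (Suc i) y) (at y)"
      using i by (cases "i = 0") (auto simp: G_def)
  qed (auto simp: G_def intro!: continuous_intros pos_power1_continuous[simplified])
  then have "Ck_on 2 U (\<lambda>p. G 0 (1 - N p * inverse R) * inverse c)"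
    by (intro Ck_on_mult Ck_on_const assms)
  then show ?thesis by (simp add: G_def divide_inverse)
qed

lemma Ck_on_weight_left: "open U \<Longrightarrow> Ck_on 2 U (\<lambda>p. weight R (g \<star> p))"
  unfolding weight_def by (intro Ck_on_mult Ck_on_pos_power3_kor Ck_on_zsq_left Ck_on_kor_left)

lemma Ck_on_weight_kernel: "Ck_on 2 UNIV (\<lambda>z. weight R (heis_inv (fst z) \<star> snd z))"
proof -
  have bl: "bounded_linear (\<lambda>z::heis \<times> heis. fst (fst z))" "bounded_linear (\<lambda>z::heis \<times> heis. fst (snd (fst z)))"
    "bounded_linear (\<lambda>z::heis \<times> heis. snd (snd (fst z)))" "bounded_linear (\<lambda>z::heis \<times> heis. fst (snd z))"
    "bounded_linear (\<lambda>z::heis \<times> heis. fst (snd (snd z)))" "bounded_linear (\<lambda>z::heis \<times> heis. snd (snd (snd z)))"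
    by (intro bounded_linear_fst_comp bounded_linear_snd_comp bounded_linear_ident)+
  note c = bl[THEN Ck_on_bounded_linear[OF open_UNIV, of _ 2]]
  note comp = Ck_on_hprod_components[of UNIV 2 "\<lambda>z. heis_inv (fst z)" snd]
  have inv: "Ck_on 2 UNIV (\<lambda>z::heis \<times> heis. fst (heis_inv (fst z)))"
    "Ck_on 2 UNIV (\<lambda>z::heis \<times> heis. fst (snd (heis_inv (fst z))))"
    "Ck_on 2 UNIV (\<lambda>z::heis \<times> heis. snd (snd (heis_inv (fst z))))"
    unfolding heis_inv_eq fst_uminus snd_uminus by (intro Ck_on_minus open_UNIV c)+
  show ?thesis
    unfolding weight_def
    by (intro Ck_on_mult Ck_on_pos_power3_kor Ck_on_zsq Ck_on_kor comp inv c open_UNIV)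
qed

lemma continuous_on_weight [continuous_intros]:
  assumes "continuous_on S f" shows "continuous_on S (\<lambda>x. weight R (f x))"
proof -
  have "continuous_on UNIV (weight R)"
    using Ck_on_continuous[OF Ck_on_weight_left[OF open_UNIV, of R 0]] by simp
  then show ?thesis using assms by (rule continuous_on_compose2) auto
qed

text \<open>Gauge balls are compact and shrink to points.\<close>

lemma gauge_norm_le:
  assumes "kor p \<le> e ^ 4" "e \<ge> 0" shows "norm p \<le> 2 * e + e\<^sup>2"
proof -
  have e4: "(e\<^sup>2)\<^sup>2 = e ^ 4" by (simp flip: power_mult)
  have z: "(zsq p)\<^sup>2 \<le> (e\<^sup>2)\<^sup>2" and t: "(snd (snd p))\<^sup>2 \<le> (e\<^sup>2)\<^sup>2"
    using assms(1) zero_le_power2[of "zsq p"] zero_le_power2[of "snd (snd p)"]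
    unfolding kor_def e4 by linarith+
  have "zsq p \<le> e\<^sup>2" using z by (rule power2_le_imp_le) simp
  then have "(fst p)\<^sup>2 \<le> e\<^sup>2" "(fst (snd p))\<^sup>2 \<le> e\<^sup>2"
    using zero_le_power2[of "fst p"] zero_le_power2[of "fst (snd p)"]
    unfolding zsq_def by linarith+
  then have "\<bar>fst p\<bar> \<le> e" "\<bar>fst (snd p)\<bar> \<le> e" using assms(2) by (simp_all add: abs_le_square_iff[symmetric])
  moreover have "\<bar>snd (snd p)\<bar> \<le> e\<^sup>2" using t abs_le_square_iff[of "snd (snd p)" "e\<^sup>2"] by simp
  moreover have "norm p \<le> \<bar>fst p\<bar> + (\<bar>fst (snd p)\<bar> + \<bar>snd (snd p)\<bar>)"
    using norm_Pair_le[of "fst p" "snd p"] norm_Pair_le[of "fst (snd p)" "snd (snd p)"] by simp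
  ultimately show ?thesis by linarith
qed

lemma compact_gauge_ball: "compact {q. kor (heis_inv p \<star> q) \<le> R}"
proof -
  define e where "e = root 4 (max R 0)"
  have e: "e \<ge> 0" "e ^ 4 = max R 0" by (simp_all add: e_def)
  have "bounded {\<zeta>. kor \<zeta> \<le> R}"
    unfolding bounded_iff using gauge_norm_le[OF _ e(1)] e(2) by (intro exI[of _ "2 * e + e\<^sup>2"]) auto
  moreover have "closed {\<zeta>. kor \<zeta> \<le> R}" by (intro closed_Collect_le continuous_intros)
  ultimately have "compact {\<zeta>. kor \<zeta> \<le> R}" by (simp add: compact_eq_bounded_closed)
  then have "compact ((\<lambda>\<zeta>. p \<star> \<zeta>) ` {\<zeta>. kor \<zeta> \<le> R})"
    by (intro compact_continuous_image continuous_intros)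
  moreover have "(\<lambda>\<zeta>. p \<star> \<zeta>) ` {\<zeta>. kor \<zeta> \<le> R} = {q. kor (heis_inv p \<star> q) \<le> R}"
  proof (intro set_eqI iffI)
    fix q assume "q \<in> {q. kor (heis_inv p \<star> q) \<le> R}"
    then show "q \<in> (\<lambda>\<zeta>. p \<star> \<zeta>) ` {\<zeta>. kor \<zeta> \<le> R}"
      by (intro image_eqI[where x = "heis_inv p \<star> q"]) auto
  qed auto
  ultimately show ?thesis by simp
qed

lemma small_gauge_balls:
  assumes "open S" "p0 \<in> S"
  obtains R \<delta> where "R > 0" "\<delta> > 0" "\<And>p q. dist p p0 < \<delta> \<Longrightarrow> kor (heis_inv p \<star> q) \<le> R \<Longrightarrow> q \<in> S"
proof -
  have "open ((\<lambda>z. fst z \<star> snd z) -` S)"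
    using assms(1) by (intro open_vimage continuous_intros)
  moreover have "(p0, 0) \<in> (\<lambda>z. fst z \<star> snd z) -` S" using assms(2) by simp
  ultimately obtain A B where AB: "open A" "open B" "p0 \<in> A" "0 \<in> B" "A \<times> B \<subseteq> (\<lambda>z. fst z \<star> snd z) -` S"
    by (rule open_prod_elim[of _ "(p0, 0)"]) auto
  obtain \<delta> where \<delta>: "\<delta> > 0" "ball p0 \<delta> \<subseteq> A" using AB open_contains_ball by blast
  obtain d where d: "d > 0" "ball 0 d \<subseteq> B" using AB open_contains_ball by blast
  define e where "e = min 1 (d / 4)"
  have e: "e > 0" "e \<le> 1" "4 * e \<le> d" using d by (auto simp: e_def)
  show thesis
  proof (rule that[of "e ^ 4" \<delta>])
    fix p q assume p: "dist p p0 < \<delta>" and q: "kor (heis_inv p \<star> q) \<le> e ^ 4"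
    have "norm (heis_inv p \<star> q) \<le> 2 * e + e\<^sup>2" using gauge_norm_le[OF q] e by simp
    also have "e\<^sup>2 \<le> e" using e by (simp add: power2_eq_square mult_left_le)
    finally have "norm (heis_inv p \<star> q) < d" using e by simp
    then have "heis_inv p \<star> q \<in> B" using d by auto
    moreover have "p \<in> A" using p \<delta> by (auto simp: dist_commute)
    ultimately have "(p, heis_inv p \<star> q) \<in> (\<lambda>z. fst z \<star> snd z) -` S" using AB(5) by blast
    then show "q \<in> S" by simp
  qed (use e \<delta> in auto)
qed

section \<open>Regularity and solvability of the Dirichlet problem\<close>

text \<open>The exact fundamental solution \<open>N\<^sup>-\<^sup>1\<^sup>/\<^sup>2\<close> is harmonic away from the pole, so the regularised one has a
  sub-Laplacian supported in the ball \<open>N \<le> R\<close>.\<close>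

lemma regularised_fundamental:
  assumes R: "R > 0"
  shows "Ck_on 2 UNIV (\<lambda>q. fund0 (kor (g \<star> q) / R) / sqrt R)"
    "heis_laplacian (\<lambda>q. fund0 (kor (g \<star> q) / R) / sqrt R) p = - (315 / 4) * weight R (g \<star> p)"
proof -
  define k where "k = (\<lambda>N. fund0 (N / R) / sqrt R)"
  define k1 where "k1 = (\<lambda>N. fund1 (N / R) / (R * sqrt R))"
  define k2 where "k2 = (\<lambda>N. fund2 (N / R) / (R * R * sqrt R))"
  have sc: "((\<lambda>N. N / R) has_real_derivative 1 / R) (at N)" for N
    using R by (auto intro!: derivative_eq_intros)
  have dk: "(k has_real_derivative k1 N) (at N)" for N
    using DERIV_cdivide[OF DERIV_chain2[OF fund0_deriv sc], where c = "sqrt R"]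
    by (simp add: k_def k1_def)
  have dk1: "(k1 has_real_derivative k2 N) (at N)" for N
    using DERIV_cdivide[OF DERIV_chain2[OF fund1_deriv sc], where c = "R * sqrt R"]
    by (simp add: k1_def k2_def mult.assoc)
  define G where "G = (\<lambda>i::nat. if i = 0 then k else if i = 1 then k1 else k2)"
  have "Ck_on 2 UNIV (\<lambda>q. G 0 (kor (g \<star> q)))"
  proof (rule Ck_on_compose[OF open_UNIV Ck_on_kor_left[OF open_UNIV], of g UNIV])
    fix i :: nat and y :: real assume "i < 2"
    then show "(G i has_real_derivative G (Suc i) y) (at y)"
      using dk[of y] dk1[of y] by (cases "i = 0") (auto simp: G_def)
  next
    have "continuous_on UNIV k2"
      unfolding k2_def by (intro continuous_on_divide continuous_on_const continuous_on_compose2[OF fund2_continuous]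
          continuous_intros) (use R in auto)
    then show "continuous_on UNIV (G 2)" by (simp add: G_def)
  qed auto
  then show C2: "Ck_on 2 UNIV (\<lambda>q. fund0 (kor (g \<star> q) / R) / sqrt R)" by (simp add: G_def k_def)
  let ?N = "kor (g \<star> p)"
  have "heis_laplacian (\<lambda>q. fund0 (kor (g \<star> q) / R) / sqrt R) p =
    (1 + 0 * zsq (g \<star> p)) * zsq (g \<star> p) * (24 * k1 ?N + 16 * ?N * k2 ?N)
     + 0 * (16 * (zsq (g \<star> p))\<^sup>2 * k1 ?N + 4 * k ?N)"
    by (rule laplacian_radial_weighted[where U = UNIV and I = UNIV and g = g and k = k and ?k1.0 = k1 and ?k2.0 = "k2 ?N" and ?c0.0 = 1 and ?c1.0 = 0 and \<alpha> = 0 and \<beta> = 0 and \<gamma> = 0 and \<delta> = 0])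
       (use dk dk1 C2 in \<open>auto simp: k_def\<close>)
  also have "\<dots> = zsq (g \<star> p) * ((24 * fund1 (?N / R) + 16 * (?N / R) * fund2 (?N / R)) / (R * sqrt R))"
    using R by (simp add: k1_def k2_def add_divide_distrib)
  also have "\<dots> = - (315 / 4) * weight R (g \<star> p)"
    unfolding fund_equation weight_def by simp
  finally show "heis_laplacian (\<lambda>q. fund0 (kor (g \<star> q) / R) / sqrt R) p = - (315 / 4) * weight R (g \<star> p)" .
qed

lemma integrable_weight:
  assumes u: "continuous_on UNIV u" and R: "R > 0"
  shows "integrable lborel (\<lambda>q. u q * weight R (heis_inv p \<star> q))"
proof -
  have c: "continuous_on UNIV (\<lambda>q. u q * weight R (heis_inv p \<star> q))"
    by (intro continuous_intros u)
  have "integrable lborel (\<lambda>q. 1 * (u q * weight R (heis_inv p \<star> q)))"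
    by (rule integrable_bounded_mult_compact[where B = 1 and S = "{q. kor (heis_inv p \<star> q) \<le> R}"])
       (use R in \<open>simp_all add: compact_gauge_ball weight_outside c\<close>)
  then show ?thesis by simp
qed

text \<open>Two regularisations of the fundamental solution coincide outside the larger ball, so their difference is
  a compactly supported test function.\<close>

lemma weighted_mean_independent_of_radius:
  assumes u: "weakly_harmonic \<Omega> u" and R: "0 < R1" "R1 \<le> R" "0 < R2" "R2 \<le> R"
    and sub: "{q. kor (heis_inv p \<star> q) \<le> R} \<subseteq> \<Omega>"
  shows "(\<integral>q. u q * weight R1 (heis_inv p \<star> q) \<partial>lborel) = (\<integral>q. u q * weight R2 (heis_inv p \<star> q) \<partial>lborel)"
proof -
  let ?f = "\<lambda>R q. fund0 (kor (heis_inv p \<star> q) / R) / sqrt R"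
  define \<psi> where "\<psi> = (\<lambda>q. ?f R1 q - ?f R2 q)"
  have uc: "continuous_on UNIV u" using u by (simp add: weakly_harmonic_def)
  note reg1 = regularised_fundamental[OF R(1), of "heis_inv p"]
  note reg2 = regularised_fundamental[OF R(3), of "heis_inv p"]
  have C2: "Ck_on 2 UNIV \<psi>" unfolding \<psi>_def by (intro Ck_on_diff reg1 reg2) auto
  have L: "heis_laplacian \<psi> q = - (315 / 4) * weight R1 (heis_inv p \<star> q) - - (315 / 4) * weight R2 (heis_inv p \<star> q)" for q
    unfolding \<psi>_def by (subst heis_laplacian_diff[OF open_UNIV reg1(1) reg2(1)]) (simp_all only: reg1 reg2 UNIV_I)
  have f: "?f r q = 1 / sqrt (kor (heis_inv p \<star> q))" if "0 < r" "r \<le> R" "\<not> kor (heis_inv p \<star> q) \<le> R" for r q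
    using that by (simp add: fund0_def real_sqrt_divide)
  have "\<psi> q = 0" if "q \<notin> {q. kor (heis_inv p \<star> q) \<le> R}" for q
    using f[of R1 q] f[of R2 q] R that by (simp add: \<psi>_def)
  then have "(\<integral>q. u q * heis_laplacian \<psi> q \<partial>lborel) = 0"
    using u C2 sub compact_gauge_ball[of p R] unfolding weakly_harmonic_def by blast
  moreover have "(\<lambda>q. u q * heis_laplacian \<psi> q) = (\<lambda>q. (315 / 4) * (u q * weight R2 (heis_inv p \<star> q) - u q * weight R1 (heis_inv p \<star> q)))"
    unfolding L by (simp add: fun_eq_iff algebra_simps)
  ultimately have "(315 / 4) * (\<integral>q. u q * weight R2 (heis_inv p \<star> q) - u q * weight R1 (heis_inv p \<star> q) \<partial>lborel) = 0"
    by (simp only: integral_mult_right_zero)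
  then have "(\<integral>q. u q * weight R2 (heis_inv p \<star> q) - u q * weight R1 (heis_inv p \<star> q) \<partial>lborel) = 0"
    unfolding mult_eq_0_iff by (rule disjE) (simp, assumption)
  then show ?thesis
    using Bochner_Integration.integral_diff[OF integrable_weight[OF uc R(3), of p] integrable_weight[OF uc R(1), of p]]
    by simp
qed

definition weight_mass :: real where "weight_mass = (\<integral>q. weight 1 q \<partial>lborel)"

lemma weight_measurable [measurable]: "weight R \<in> borel_measurable borel"
  by (intro borel_measurable_continuous_onI) (rule continuous_on_weight, rule continuous_on_id)

text \<open>The constant function is weakly harmonic on the whole group, hence the kernels have the same mass for all radii.\<close>

lemma weight_mass_eq:
  assumes "R > 0"
  shows "(\<integral>q. weight R (heis_inv p \<star> q) \<partial>lborel) = weight_mass"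
proof -
  have "(\<integral>q. weight R (heis_inv p \<star> q) \<partial>lborel) = (\<integral>q. weight 1 (heis_inv p \<star> q) \<partial>lborel)"
    using weighted_mean_independent_of_radius[OF weakly_harmonic_1, of R "max R 1" 1 p UNIV] assms by simp
  also have "\<dots> = weight_mass" unfolding weight_mass_def by (rule lborel_integral_left) simp
  finally show ?thesis .
qed

lemma weight_mass_pos: "weight_mass > 0"
proof -
  define A :: "heis set" where "A = cbox (1/4, 1/4, 1/4) (1/2, 1/2, 1/2)"
  have bnd: "1/64 * indicator A q \<le> weight 1 q" for q
  proof (cases "q \<in> A")
    case True
    obtain x y t where q: "q = (x, y, t)" by (cases q)
    have xyt: "1/4 \<le> x" "x \<le> 1/2" "1/4 \<le> y" "y \<le> 1/2" "1/4 \<le> t" "t \<le> 1/2"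
      using True by (auto simp: A_def q mem_box Basis_prod_def)
    have sq: "(1/4)^2 \<le> v^2" "v^2 \<le> (1/2)^2" if "1/4 \<le> v" "v \<le> 1/2" for v :: real
      using that by (intro power_mono; simp)+
    have z: "1/8 \<le> zsq q" "zsq q \<le> 1/2"
      using sq[OF xyt(1,2)] sq[OF xyt(3,4)] by (simp_all add: q zsq_def power2_eq_square)
    have "(zsq q)^2 \<le> (1/2)^2" using z by (intro power_mono) auto
    then have k: "kor q \<le> 1/2" using sq[OF xyt(5,6)] by (simp add: kor_def q power2_eq_square)
    have "(1/2)^3 \<le> (1 - kor q)^3" using k by (intro power_mono) auto
    then have "1/8 \<le> pos_power 3 (1 - kor q)" using k by (simp add: pos_power_def power3_eq_cube)
    then have "(1/8) * (1/8) \<le> zsq q * pos_power 3 (1 - kor q)" using z by (intro mult_mono) auto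
    then show ?thesis using True by (simp add: weight_def)
  qed (simp add: weight_nonneg)
  have A: "measure lborel A > 0"
    unfolding A_def by (simp add: content_pos_lt Basis_prod_def)
  have "0 < 1/64 * measure lborel A" using A by simp
  also have "\<dots> = (\<integral>q. 1/64 * indicator A q \<partial>lborel)" by (simp add: A_def)
  also have "\<dots> \<le> weight_mass"
    unfolding weight_mass_def
  proof (rule integral_mono[OF _ _ bnd])
    show "integrable lborel (\<lambda>q. 1/64 * indicator A q :: real)"
      by (intro integrable_mult_right integrable_real_indicator) (use emeasure_bounded_finite[OF bounded_cbox] in \<open>auto simp: A_def\<close>)
    show "integrable lborel (weight 1)"
      using integrable_weight[OF continuous_on_const, of 1 1 0] by (simp add: heis_inv_eq)
  qed
  finally show ?thesis .
qed

text \<open>The weighted mean does not depend on the radius, and as the radius shrinks it tends to the value at the centre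
  by continuity.\<close>

lemma mean_value:
  assumes u: "weakly_harmonic \<Omega> u" and R: "0 < R" and sub: "{q. kor (heis_inv p \<star> q) \<le> R} \<subseteq> \<Omega>"
  shows "(\<integral>q. u q * weight R (heis_inv p \<star> q) \<partial>lborel) = weight_mass * u p"
proof -
  have uc: "continuous_on UNIV u" using u by (simp add: weakly_harmonic_def)
  let ?I = "\<integral>q. u q * weight R (heis_inv p \<star> q) \<partial>lborel"
  have "\<bar>?I - weight_mass * u p\<bar> \<le> 0 + e * weight_mass" if e: "e > 0" for e
  proof -
    have "open {q. \<bar>u q - u p\<bar> < e}"
      by (intro open_Collect_less continuous_intros uc)
    then obtain R0 \<delta> where R0: "R0 > 0" "\<delta> > 0"
      "\<And>p' q. dist p' p < \<delta> \<Longrightarrow> kor (heis_inv p' \<star> q) \<le> R0 \<Longrightarrow> q \<in> {q. \<bar>u q - u p\<bar> < e}"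
      by (rule small_gauge_balls[of _ p]) (use e in auto)
    define r where "r = min R R0"
    have r: "0 < r" "r \<le> R" "r \<le> R0" using R R0 by (auto simp: r_def)
    have close: "\<bar>u q - u p\<bar> < e" if "kor (heis_inv p \<star> q) \<le> r" for q
      using R0(3)[of p q] that r R0(2) by auto
    have I: "?I = (\<integral>q. u q * weight r (heis_inv p \<star> q) \<partial>lborel)"
      by (rule weighted_mean_independent_of_radius[OF u R order_refl r(1,2) sub])
    note iu = integrable_weight[OF uc r(1), of p]
    have i1: "integrable lborel (\<lambda>q. weight r (heis_inv p \<star> q))"
      using integrable_weight[OF continuous_on_const r(1), of 1 p] by simp
    have "?I - weight_mass * u p = (\<integral>q. (u q - u p) * weight r (heis_inv p \<star> q) \<partial>lborel)"
      unfolding I left_diff_distrib using iu i1 weight_mass_eq[OF r(1), of p] by simp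
    also have "\<bar>\<dots>\<bar> \<le> (\<integral>q. e * weight r (heis_inv p \<star> q) \<partial>lborel)"
    proof (rule order_trans[OF integral_abs_bound], rule integral_mono)
      show "integrable lborel (\<lambda>q. \<bar>(u q - u p) * weight r (heis_inv p \<star> q)\<bar>)"
        unfolding left_diff_distrib using iu i1 by (intro integrable_abs Bochner_Integration.integrable_diff) auto
      show "integrable lborel (\<lambda>q. e * weight r (heis_inv p \<star> q))" using i1 by simp
      show "\<bar>(u q - u p) * weight r (heis_inv p \<star> q)\<bar> \<le> e * weight r (heis_inv p \<star> q)" for q
      proof (cases "kor (heis_inv p \<star> q) \<le> r")
        case True
        then show ?thesis using close[OF True] weight_nonneg[OF r(1)] by (simp add: abs_mult mult_right_mono)
      next
        case False
        then show ?thesis using weight_outside[OF r(1)] by simp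
      qed
    qed
    also have "\<dots> = e * weight_mass" using weight_mass_eq[OF r(1), of p] by simp
    finally show ?thesis by simp
  qed
  note key = this
  have "\<bar>?I - weight_mass * u p\<bar> \<le> 0"
  proof (rule field_le_epsilon)
    fix e :: real assume "e > 0"
    then show "\<bar>?I - weight_mass * u p\<bar> \<le> 0 + e" using key[of "e / weight_mass"] weight_mass_pos by simp
  qed
  then show ?thesis by simp
qed

text \<open>Only the symmetry of the sub-Laplacian under inversion and its support matter, so no formula is
  exported.\<close>

lemma laplacian_weight:
  assumes R: "R > 0"
  obtains E where "\<And>g p. heis_laplacian (\<lambda>q. weight R (g \<star> q)) p = E (g \<star> p)" "\<And>p. E (heis_inv p) = E p"
    "\<And>p. kor p \<ge> R \<Longrightarrow> E p = 0"
proof -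
  define k where "k = (\<lambda>N. pos_power 3 (1 - N / R) / (R * sqrt R))"
  define k1 where "k1 = (\<lambda>N. 3 * pos_power 2 (1 - N / R) * (- 1 / R) / (R * sqrt R))"
  define k2 where "k2 = (\<lambda>N. 6 * pos_power 1 (1 - N / R) * (- 1 / R) * (- 1 / R) / (R * sqrt R))"
  have sc: "((\<lambda>N. 1 - N / R) has_real_derivative - 1 / R) (at N)" for N
    using R by (auto intro!: derivative_eq_intros)
  have p3: "(pos_power 3 has_real_derivative 3 * pos_power 2 y) (at y)" for y
    using pos_power_deriv[of 2 y] by (simp add: eval_nat_numeral)
  have p2: "((\<lambda>x. 3 * pos_power 2 x) has_real_derivative 6 * pos_power 1 y) (at y)" for y
    using DERIV_cmult[OF pos_power_deriv[of 1 y], of 3] by (simp add: eval_nat_numeral)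
  have dk: "(k has_real_derivative k1 N) (at N)" for N
    unfolding k_def k1_def by (intro DERIV_cdivide DERIV_chain2[OF p3 sc])
  have dk1: "(k1 has_real_derivative k2 N) (at N)" for N
    unfolding k1_def k2_def by (intro DERIV_cdivide DERIV_cmult_right DERIV_chain2[OF p2 sc])
  define E where "E = (\<lambda>\<zeta>. (0 + 1 * zsq \<zeta>) * zsq \<zeta> * (24 * k1 (kor \<zeta>) + 16 * kor \<zeta> * k2 (kor \<zeta>))
     + 1 * (16 * (zsq \<zeta>)\<^sup>2 * k1 (kor \<zeta>) + 4 * k (kor \<zeta>)))"
  show thesis
  proof (rule that)
    show "heis_laplacian (\<lambda>q. weight R (g \<star> q)) p = E (g \<star> p)" for g p
      unfolding E_def
      by (rule laplacian_radial_weighted[where I = UNIV and U = UNIV and g = g and k = k and ?k1.0 = k1 and ?k2.0 = "k2 (kor (g \<star> p))" and ?c0.0 = 0 and ?c1.0 = 1 and \<alpha> = 0 and \<beta> = 0 and \<gamma> = 0 and \<delta> = 0])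
         (use dk dk1 Ck_on_weight_left[OF open_UNIV] in \<open>auto simp: k_def weight_def\<close>)
    show "E (heis_inv p) = E p" for p by (simp add: E_def)
    have "pos_power n (1 - kor p / R) = 0" if "kor p \<ge> R" "n > 0" for p n
      using that R by (cases "kor p = R") (auto simp: pos_power_def field_simps)
    then show "E p = 0" if "kor p \<ge> R" for p
      using that by (simp add: E_def k_def k1_def k2_def)
  qed
qed

text \<open>By the mean value formula \<open>u\<close> is locally an integral of \<open>u\<close> against a \<open>C\<^sup>2\<close> kernel in the parameter \<open>p\<close>.
  The kernel is symmetric in its two points, so its sub-Laplacian in the parameter equals its sub-Laplacian in the
  integration variable, and the kernel is itself a test function: the weak formulation says that the sub-Laplacian of
  the integral vanishes.\<close>

lemma weakly_harmonic_smooth: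
  assumes \<Omega>: "open \<Omega>" "bounded \<Omega>" and u: "weakly_harmonic \<Omega> u"
  shows "Ck_on 2 \<Omega> u" "\<And>p. p \<in> \<Omega> \<Longrightarrow> heis_laplacian u p = 0"
proof -
  have uc: "continuous_on UNIV u" using u by (simp add: weakly_harmonic_def)
  obtain a b where ab: "\<Omega> \<subseteq> cbox a b" using bounded_subset_cbox_symmetric[OF \<Omega>(2)] by blast
  have ucc: "continuous_on (cbox a b) u" by (rule continuous_on_subset[OF uc]) simp
  have loc: "\<exists>V. open V \<and> p0 \<in> V \<and> Ck_on 2 V u \<and> heis_laplacian u p0 = 0" if p0: "p0 \<in> \<Omega>" for p0
  proof -
    obtain R \<delta> where R: "R > 0" "\<delta> > 0" "\<And>p q. dist p p0 < \<delta> \<Longrightarrow> kor (heis_inv p \<star> q) \<le> R \<Longrightarrow> q \<in> \<Omega>"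
      using small_gauge_balls[OF \<Omega>(1) p0] by metis
    define V where "V = ball p0 \<delta>"
    have V: "open V" "p0 \<in> V" using R by (auto simp: V_def)
    define v where "v = (\<lambda>p. integral (cbox a b) (\<lambda>q. u q * weight R (heis_inv q \<star> p)))"
    have flip: "weight R (heis_inv q \<star> p) = weight R (heis_inv p \<star> q)" for p q
      using weight_inv[of R "heis_inv p \<star> q"] by (simp add: heis_inv_hprod)
    have int: "(\<lambda>q. u q * h (heis_inv q \<star> p)) integrable_on cbox a b" if "continuous_on UNIV h" for h p
      by (intro integrable_continuous continuous_intros ucc continuous_on_compose2[OF that]) auto
    have wc: "continuous_on UNIV (weight R)" by (intro continuous_intros)
    have to_cbox: "(\<integral>q. f q \<partial>lborel) = integral (cbox a b) f"
      if "integrable lborel f" "\<And>q. q \<notin> \<Omega> \<Longrightarrow> f q = 0" for f :: "heis \<Rightarrow> real"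
    proof -
      have "(\<integral>q. f q \<partial>lborel) = integral UNIV f" using integral_lborel[OF that(1)] by simp
      also have "\<dots> = integral UNIV (\<lambda>q. if q \<in> cbox a b then f q else 0)"
        using that(2) ab by (intro arg_cong[where f = "integral UNIV"] ext) auto
      also have "\<dots> = integral (cbox a b) f" by (rule integral_restrict_UNIV)
      finally show ?thesis .
    qed
    have out: "weight R (heis_inv p \<star> q) = 0" if "p \<in> V" "q \<notin> \<Omega>" for p q
      using R(3)[of p q] that weight_outside[OF R(1), of "heis_inv p \<star> q"] by (force simp: V_def dist_commute)
    have uv: "u p = v p / weight_mass" if p: "p \<in> V" for p
    proof -
      have "weight_mass * u p = (\<integral>q. u q * weight R (heis_inv p \<star> q) \<partial>lborel)"
        by (rule mean_value[OF u R(1), symmetric]) (use R(3)[of p] p in \<open>auto simp: V_def dist_commute\<close>)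
      also have "\<dots> = integral (cbox a b) (\<lambda>q. u q * weight R (heis_inv p \<star> q))"
        by (rule to_cbox[OF integrable_weight[OF uc R(1)]]) (simp add: out[OF p])
      finally show ?thesis using weight_mass_pos by (simp add: v_def flip field_simps)
    qed
    have "Ck_on 2 UNIV v"
      using Ck_on_parametric_integral[OF Ck_on_weight_kernel[of R] ucc] by (simp add: v_def)
    then have "Ck_on 2 V v" by (rule Ck_on_mono) simp
    then have "Ck_on 2 V (\<lambda>p. v p * inverse weight_mass)" by (intro Ck_on_mult Ck_on_const V)
    then have C2: "Ck_on 2 V u" by (rule Ck_on_cong[OF V(1)]) (simp add: uv divide_inverse)
    obtain E where E: "\<And>g p. heis_laplacian (\<lambda>q. weight R (g \<star> q)) p = E (g \<star> p)"
      "\<And>p. E (heis_inv p) = E p" "\<And>p. kor p \<ge> R \<Longrightarrow> E p = 0"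
      using laplacian_weight[OF R(1)] by metis
    have Ew: "heis_laplacian (weight R) p = E p" for p using E(1)[of 0 p] by simp
    have Ec: "continuous_on UNIV E"
      using heis_laplacian_continuous[OF open_UNIV Ck_on_weight_left[OF open_UNIV, of R 0]] by (simp add: Ew)
    have wC2: "Ck_on 2 UNIV (weight R)" using Ck_on_weight_left[OF open_UNIV, of R 0] by simp
    define C where "C = (\<lambda>q. heis_inv q \<star> p0) ` cbox a b"
    have C: "compact C" unfolding C_def by (intro compact_continuous_image continuous_intros compact_cbox)
    have "bounded (u ` cbox a b)" by (intro compact_imp_bounded compact_continuous_image ucc compact_cbox)
    then obtain B where B: "B > 0" "\<And>q. q \<in> cbox a b \<Longrightarrow> \<bar>u q\<bar> \<le> B" by (auto simp: bounded_pos)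
    \<comment> \<open>the sub-Laplacian of \<open>v\<close> at \<open>p0\<close>, with the differentiation moved under the integral\<close>
    define J where "J = integral (cbox a b) (\<lambda>q. u q * E (heis_inv q \<star> p0))"
    have "J = 0"
    proof -
      have E0: "E (heis_inv p0 \<star> q) = 0" if "q \<notin> \<Omega>" for q
        using R(3)[of p0 q] R(2) that by (intro E(3)) force
      have "(\<integral>q. u q * heis_laplacian (\<lambda>q. weight R (heis_inv p0 \<star> q)) q \<partial>lborel) = 0"
      proof -
        have "weight R (heis_inv p0 \<star> q) = 0" if "q \<notin> {q. kor (heis_inv p0 \<star> q) \<le> R}" for q
          using that weight_outside[OF R(1)] by simp
        moreover have "{q. kor (heis_inv p0 \<star> q) \<le> R} \<subseteq> \<Omega>" using R(2) R(3)[of p0] by auto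
        ultimately show ?thesis
          using u Ck_on_weight_left[OF open_UNIV, of R "heis_inv p0"] compact_gauge_ball[of p0 R]
          unfolding weakly_harmonic_def by blast
      qed
      then have "(\<integral>q. u q * E (heis_inv p0 \<star> q) \<partial>lborel) = 0" by (simp add: E)
      moreover have "integrable lborel (\<lambda>q. 1 * (u q * E (heis_inv p0 \<star> q)))"
      proof (rule integrable_bounded_mult_compact[where B = 1 and S = "closure \<Omega>"])
        show "continuous_on UNIV (\<lambda>q. u q * E (heis_inv p0 \<star> q))"
          by (intro continuous_intros uc continuous_on_compose2[OF Ec]) auto
        show "compact (closure \<Omega>)" using \<Omega>(2) by simp
        show "u q * E (heis_inv p0 \<star> q) = 0" if "q \<notin> closure \<Omega>" for q
          using E0[of q] that closure_subset by auto
      qed auto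
      ultimately have "integral (cbox a b) (\<lambda>q. u q * E (heis_inv p0 \<star> q)) = 0"
        using to_cbox[of "\<lambda>q. u q * E (heis_inv p0 \<star> q)"] E0 by simp
      moreover have "E (heis_inv p0 \<star> q) = E (heis_inv q \<star> p0)" for q
        using E(2)[of "heis_inv q \<star> p0"] by (simp add: heis_inv_hprod)
      ultimately show ?thesis by (simp add: J_def)
    qed
    have avgv: "avg s v p0 = integral (cbox a b) (\<lambda>q. u q * avg s (weight R) (heis_inv q \<star> p0))" for s
    proof -
      have i: "(\<lambda>q. u q * weight R (heis_inv q \<star> p)) integrable_on cbox a b" for p by (rule int[OF wc])
      have "avg s v p0 = integral (cbox a b) (\<lambda>q. (u q * weight R (heis_inv q \<star> (p0 \<star> (s, 0, 0))) + u q * weight R (heis_inv q \<star> (p0 \<star> (- s, 0, 0)))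
        + u q * weight R (heis_inv q \<star> (p0 \<star> (0, s, 0))) + u q * weight R (heis_inv q \<star> (p0 \<star> (0, - s, 0)))) / 4)"
        unfolding avg_def v_def
        by (simp only: integral_divide integral_add[OF i i] integral_add[OF integrable_add[OF i i] i]
             integral_add[OF integrable_add[OF integrable_add[OF i i] i] i])
      also have "\<dots> = integral (cbox a b) (\<lambda>q. u q * avg s (weight R) (heis_inv q \<star> p0))"
        by (rule arg_cong[where f = "integral (cbox a b)"]) (simp add: fun_eq_iff avg_def hprod_assoc algebra_simps add_divide_distrib)
      finally show ?thesis .
    qed
    have wavg: "continuous_on UNIV (avg s (weight R))" for s
      unfolding avg_def[abs_def] by (intro continuous_intros) auto
    have "heis_laplacian u p0 = 0"
    proof -
      have vC2: "Ck_on 2 UNIV v" by fact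
      have lim: "(\<lambda>n. 4 * (avg (1 / real (Suc n)) v p0 - v p0) / (1 / real (Suc n))\<^sup>2) \<longlonglongrightarrow> heis_laplacian v p0"
        by (rule discrete_laplacian_tendsto[OF open_UNIV vC2 UNIV_I inverse_Suc_seq])
      have "\<bar>heis_laplacian v p0\<bar> \<le> 0 + e" if e: "e > 0" for e
      proof -
        define c where "c = measure lborel (cbox a b) * B + 1"
        have c: "c > 0" using B by (simp add: c_def add_nonneg_pos)
        have "e / c > 0" using e c by simp
        then obtain s0 where s0: "s0 > 0" "\<And>s p. 0 < s \<Longrightarrow> s < s0 \<Longrightarrow> p \<in> C \<Longrightarrow>
           \<bar>4 * (avg s (weight R) p - weight R p) / s\<^sup>2 - heis_laplacian (weight R) p\<bar> \<le> e / c"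
          using discrete_laplacian_uniform[OF open_UNIV wC2 C subset_UNIV] by metis
        have bd: "\<bar>4 * (avg s v p0 - v p0) / s\<^sup>2\<bar> \<le> e" if s: "0 < s" "s < s0" for s
        proof -
          let ?g = "\<lambda>q. u q * (4 * (avg s (weight R) (heis_inv q \<star> p0) - weight R (heis_inv q \<star> p0)) / s\<^sup>2 - E (heis_inv q \<star> p0))"
          have A: "(\<lambda>q. 4 / s\<^sup>2 * (u q * avg s (weight R) (heis_inv q \<star> p0) - u q * weight R (heis_inv q \<star> p0))) integrable_on cbox a b"
            by (intro integrable_continuous continuous_intros ucc continuous_on_compose2[OF wavg] continuous_on_compose2[OF wc]) auto
          have "4 * (avg s v p0 - v p0) / s\<^sup>2 = 4 / s\<^sup>2 * (avg s v p0 - v p0) - J" using \<open>J = 0\<close> by simp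
          also have "\<dots> = integral (cbox a b) (\<lambda>q. 4 / s\<^sup>2 * (u q * avg s (weight R) (heis_inv q \<star> p0) - u q * weight R (heis_inv q \<star> p0)) - u q * E (heis_inv q \<star> p0))"
            unfolding avgv unfolding v_def J_def
            by (simp only: integral_mult_right[symmetric] integral_diff[OF int[OF wavg] int[OF wc], symmetric]
                integral_diff[OF A int[OF Ec], symmetric])
          also have "\<dots> = integral (cbox a b) ?g"
            by (rule arg_cong[where f = "integral (cbox a b)"]) (simp add: fun_eq_iff algebra_simps diff_divide_distrib)
          also have "\<bar>\<dots>\<bar> \<le> (B * (e / c)) * measure lborel (cbox a b)"
          proof -
            have "norm (integral (cbox a b) ?g) \<le> (B * (e / c)) * measure lborel (cbox a b)"
            proof (rule integrable_bound)
              show "0 \<le> B * (e / c)" using B e c by simp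
              show "?g integrable_on cbox a b"
                by (rule int[where h = "\<lambda>\<zeta>. 4 * (avg s (weight R) \<zeta> - weight R \<zeta>) / s\<^sup>2 - E \<zeta>"])
                   (use s in \<open>auto intro!: continuous_intros wavg Ec\<close>)
              fix q assume q: "q \<in> cbox a b"
              then have "heis_inv q \<star> p0 \<in> C" by (simp add: C_def)
              from s0(2)[OF s this] show "norm (?g q) \<le> B * (e / c)"
                unfolding real_norm_def abs_mult Ew using B(2)[OF q] B(1) by (intro mult_mono) auto
            qed
            then show ?thesis by simp
          qed
          also have "\<dots> \<le> e" using c e by (simp add: c_def field_simps)
          finally show ?thesis .
        qed
        obtain N where N: "\<And>n. n \<ge> N \<Longrightarrow> 1 / real (Suc n) < s0"
          using order_tendstoD(2)[OF inverse_Suc_seq(2) s0(1)] by (auto simp: eventually_sequentially)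
        have "\<bar>heis_laplacian v p0\<bar> \<le> e"
          by (rule LIMSEQ_le_const2[OF tendsto_rabs[OF lim]]) (use N bd inverse_Suc_seq(1) in blast)
        then show ?thesis by simp
      qed
      then have "\<bar>heis_laplacian v p0\<bar> \<le> 0" by (rule field_le_epsilon)
      then have v0: "heis_laplacian v p0 = 0" by simp
      have "(\<lambda>n. 4 * (avg (1 / real (Suc n)) u p0 - u p0) / (1 / real (Suc n))\<^sup>2) \<longlonglongrightarrow> heis_laplacian u p0"
        by (rule discrete_laplacian_tendsto[OF V(1) C2 V(2) inverse_Suc_seq])
      moreover have "(\<lambda>n. (4 * (avg (1 / real (Suc n)) v p0 - v p0) / (1 / real (Suc n))\<^sup>2) / weight_mass) \<longlonglongrightarrow> 0"
        using tendsto_divide[OF lim[unfolded v0] tendsto_const, of weight_mass] weight_mass_pos by simp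
      moreover have "eventually (\<lambda>n. (4 * (avg (1 / real (Suc n)) v p0 - v p0) / (1 / real (Suc n))\<^sup>2) / weight_mass
         = 4 * (avg (1 / real (Suc n)) u p0 - u p0) / (1 / real (Suc n))\<^sup>2) sequentially"
      proof -
        obtain L where L: "L > 0" "\<And>s p q. 0 \<le> s \<Longrightarrow> p \<in> \<Omega> \<Longrightarrow> q \<in> nbrs s p \<Longrightarrow> dist q p \<le> s * L"
          using nbrs_dist[OF \<Omega>(2)] by metis
        have "\<delta> / L > 0" using R L by simp
        from order_tendstoD(2)[OF inverse_Suc_seq(2) this] show ?thesis
        proof eventually_elim
          case (elim n)
          define s where "s = 1 / real (Suc n)"
          have s: "s > 0" "s * L < \<delta>" using elim L by (simp_all add: s_def field_simps)
          have "q \<in> V" if "q \<in> nbrs s p0" for q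
            using L(2)[OF _ p0 that] s by (auto simp: V_def dist_commute)
          then have nb: "u q = v q / weight_mass" if "q \<in> nbrs s p0" for q using uv that by blast
          have "avg s u p0 = avg s v p0 / weight_mass"
            using nb by (simp add: avg_def nbrs_def add_divide_distrib)
          moreover have "(4 * (x - y) / z) / m = 4 * (x / m - y / m) / z" for x y z m :: real
            by (simp only: diff_divide_distrib[symmetric] times_divide_eq_right divide_divide_eq_left mult.commute[of z])
          ultimately show ?case by (simp only: s_def[symmetric] uv[OF V(2)])
        qed
      qed
      ultimately show ?thesis
        using LIMSEQ_unique[OF _ Lim_transform_eventually] by blast
    qed
    then show ?thesis using V C2 by blast
  qed
  show "Ck_on 2 \<Omega> u" by (rule Ck_on_Union) (use loc in blast)
  show "heis_laplacian u p = 0" if "p \<in> \<Omega>" for p using loc[OF that] by blast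
qed

text \<open>The data are given on the whole space because the walk may overshoot the boundary; boundedness starts the monotone
  iteration.\<close>

theorem dirichlet_solution_exists:
  assumes \<Omega>: "open \<Omega>" "bounded \<Omega>" and ext: "\<And>p. p \<in> frontier \<Omega> \<Longrightarrow> exterior_koranyi \<Omega> p"
    and \<Phi>: "continuous_on UNIV \<Phi>" "\<And>p. \<bar>\<Phi> p\<bar> \<le> B"
  obtains u where "dirichlet_solution \<Omega> \<Phi> u"
proof -
  obtain \<sigma> U u where *: "\<And>n. \<sigma> n > 0" "\<sigma> \<longlonglongrightarrow> 0" "\<And>n. U n \<in> borel_measurable borel" "\<And>n p. \<bar>U n p\<bar> \<le> B"
    "\<And>n. dpp \<Omega> \<Phi> (\<sigma> n) (U n)" "\<And>p. (\<lambda>n. U n p) \<longlonglongrightarrow> u p" "continuous_on UNIV u" "\<And>p. p \<notin> \<Omega> \<Longrightarrow> u p = \<Phi> p"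
    using dpp_limit[OF \<Omega> \<Phi> ext] by blast
  have "weakly_harmonic \<Omega> u"
    by (rule weakly_harmonic_limit[OF *(7,1,2,3,4) dpp_in[OF *(5)] *(6)])
  note h = weakly_harmonic_smooth[OF \<Omega> this]
  have "p \<notin> \<Omega>" if "p \<in> frontier \<Omega>" for p
    using that \<Omega>(1) by (auto simp: frontier_def interior_open)
  then have "dirichlet_solution \<Omega> \<Phi> u"
    unfolding dirichlet_solution_def using h *(8) continuous_on_subset[OF *(7)] by blast
  then show thesis by (rule that)
qed

section \<open>The harmonic part of the Green function\<close>

lemma kor_eq_0: "kor p = 0 \<longleftrightarrow> p = 0"
  by (cases p) (auto simp: kor_def zsq_def zero_prod_def add_nonneg_eq_0_iff sum_power2_eq_zero_iff)

text \<open>By continuity of the gauge, a point in the frontier of a Koranyi ball lies on the corresponding level set.\<close>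

lemma exterior_koranyi_of_uniform:
  assumes "uniform_exterior_ball \<Omega>" "p \<in> frontier \<Omega>"
  shows "exterior_koranyi \<Omega> p"
proof -
  obtain r0 where r0: "r0 > 0" "\<And>r. 0 < r \<Longrightarrow> r \<le> r0 \<Longrightarrow>
      \<exists>\<eta>. koranyi_ball \<eta> r \<inter> \<Omega> = {} \<and> p \<in> frontier (koranyi_ball \<eta> r)"
    using assms unfolding uniform_exterior_ball_def by blast
  obtain \<eta> where \<eta>: "koranyi_ball \<eta> r0 \<inter> \<Omega> = {}" "p \<in> frontier (koranyi_ball \<eta> r0)"
    using r0(2)[OF r0(1) order_refl] by blast
  let ?N = "\<lambda>q. kor (heis_inv \<eta> \<star> q)"
  note ball = koranyi_ball_kor[OF r0(1), of \<eta>]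
  have o: "open {q. ?N q < r0 ^ 4}" by (intro open_Collect_less continuous_intros)
  have "closed {q. ?N q \<le> r0 ^ 4}" by (intro closed_Collect_le continuous_intros)
  then have "closure {q. ?N q < r0 ^ 4} \<subseteq> {q. ?N q \<le> r0 ^ 4}"
    by (rule closure_minimal[rotated]) auto
  then have N: "?N p = r0 ^ 4"
    using \<eta>(2) o unfolding ball by (auto simp: frontier_def interior_open)
  have "closed {q. ?N q \<ge> r0 ^ 4}" by (intro closed_Collect_le continuous_intros)
  then have "closure \<Omega> \<subseteq> {q. ?N q \<ge> r0 ^ 4}"
    by (rule closure_minimal[rotated]) (use \<eta>(1) in \<open>auto simp: ball not_less[symmetric]\<close>)
  then show ?thesis
    unfolding exterior_koranyi_def using N r0(1) by blast
qed

lemma nonzero_divide_cancel: "b \<noteq> 0 \<Longrightarrow> a / b * b = (a::real)"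
  by simp

text \<open>At an interior minimum of \<open>u - \<delta> x\<^sup>2\<close> all discrete sub-Laplacians are nonnegative, but they converge to
  \<open>- 2 \<delta>\<close>.\<close>

lemma dirichlet_minimum_principle:
  assumes \<Omega>: "open \<Omega>" "bounded \<Omega>" and u: "dirichlet_solution \<Omega> \<phi> u"
    and m: "\<And>p. p \<in> frontier \<Omega> \<Longrightarrow> \<phi> p \<ge> m" and p: "p \<in> \<Omega>"
  shows "u p \<ge> m"
proof (rule ccontr)
  assume neg: "\<not> u p \<ge> m"
  have C2: "Ck_on 2 \<Omega> u" and uc: "continuous_on (closure \<Omega>) u"
    and L: "\<And>p. p \<in> \<Omega> \<Longrightarrow> heis_laplacian u p = 0" and bd: "\<And>p. p \<in> frontier \<Omega> \<Longrightarrow> u p = \<phi> p"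
    using u by (auto simp: dirichlet_solution_def)
  have cl: "compact (closure \<Omega>)" using \<Omega> by (simp add: compact_closure)
  obtain X where X: "\<And>p. p \<in> closure \<Omega> \<Longrightarrow> norm p \<le> X"
    using compact_imp_bounded[OF cl] by (auto simp: bounded_iff)
  define M where "M = X\<^sup>2"
  have M: "(fst p)\<^sup>2 \<le> M" if "p \<in> closure \<Omega>" for p
    using X[OF that] norm_fst_le[of "fst p" "snd p"] abs_le_square_iff[of "fst p" X] by (simp add: M_def)
  have M0: "M \<ge> 0" by (simp add: M_def)
  define \<delta> where "\<delta> = (m - u p) / 2 / (M + 1)"
  have \<delta>: "\<delta> > 0" using neg M0 by (simp add: \<delta>_def)
  have \<delta>M: "\<delta> * M < m - u p"
  proof -
    have "\<delta> * M \<le> \<delta> * (M + 1)" using \<delta> by simp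
    also have "\<dots> = (m - u p) / 2"
      unfolding \<delta>_def by (rule nonzero_divide_cancel) (use M0 in linarith)
    also have "\<dots> < m - u p" using neg by simp
    finally show ?thesis .
  qed
  define w where "w = (\<lambda>q. u q - \<delta> * (fst q)\<^sup>2)"
  have wc: "continuous_on (closure \<Omega>) w" unfolding w_def by (intro continuous_intros uc)
  have pc: "p \<in> closure \<Omega>" using p closure_subset by auto
  obtain q where q: "q \<in> closure \<Omega>" "\<And>x. x \<in> closure \<Omega> \<Longrightarrow> w q \<le> w x"
  proof -
    have "closure \<Omega> \<noteq> {}" using pc by auto
    from continuous_attains_inf[OF cl this wc] show thesis using that by blast
  qed
  have "q \<in> \<Omega>"
  proof (rule ccontr)
    assume "q \<notin> \<Omega>"
    then have "q \<in> frontier \<Omega>" using q(1) \<Omega>(1) by (simp add: frontier_def interior_open)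
    then have "u q \<ge> m" using m bd by simp
    moreover have "\<delta> * (fst q)\<^sup>2 \<le> \<delta> * M" using M[OF q(1)] \<delta> by simp
    moreover have "w p \<le> u p" using \<delta> by (simp add: w_def)
    ultimately show False using q(2)[OF pc] \<delta>M by (simp add: w_def)
  qed
  have lim: "(\<lambda>n. 4 * (avg (1 / real (Suc n)) u q - u q) / (1 / real (Suc n))\<^sup>2) \<longlonglongrightarrow> 0"
    using discrete_laplacian_tendsto[OF \<Omega>(1) C2 \<open>q \<in> \<Omega>\<close> inverse_Suc_seq] L[OF \<open>q \<in> \<Omega>\<close>] by simp
  obtain e where e: "e > 0" "ball q e \<subseteq> \<Omega>" using \<Omega>(1) \<open>q \<in> \<Omega>\<close> open_contains_ball by blast
  obtain K where K: "K > 0" "\<And>s p q. 0 \<le> s \<Longrightarrow> p \<in> \<Omega> \<Longrightarrow> q \<in> nbrs s p \<Longrightarrow> dist q p \<le> s * K"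
    using nbrs_dist[OF \<Omega>(2)] by metis
  have "e / K > 0" using e K by simp
  from order_tendstoD(2)[OF inverse_Suc_seq(2) this]
  have "eventually (\<lambda>n. 4 * (avg (1 / real (Suc n)) u q - u q) / (1 / real (Suc n))\<^sup>2 \<ge> 2 * \<delta>) sequentially"
  proof eventually_elim
    case (elim n)
    define s where "s = 1 / real (Suc n)"
    have s: "s > 0" "s * K < e" using elim K by (simp_all add: s_def field_simps)
    have "w q \<le> w x" if "x \<in> nbrs s q" for x
    proof -
      have "dist x q < e" using K(2)[OF _ \<open>q \<in> \<Omega>\<close> that] s by simp
      then have "x \<in> \<Omega>" using e(2) by (auto simp: dist_commute)
      then have "x \<in> closure \<Omega>" by (rule closure_subset[THEN subsetD])
      then show ?thesis by (rule q(2))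
    qed
    then have "avg s (\<lambda>_. w q) q \<le> avg s w q" by (rule avg_mono)
    moreover have "avg s w q = avg s u q - \<delta> * ((fst q)\<^sup>2 + s\<^sup>2 / 2)"
      unfolding w_def by (simp only: avg_diff avg_cmult avg_fst_square)
    ultimately have "avg s u q - u q \<ge> \<delta> * s\<^sup>2 / 2" by (simp add: w_def algebra_simps)
    then have "4 * (avg s u q - u q) / s\<^sup>2 \<ge> 2 * \<delta>" using s by (simp add: pos_le_divide_eq)
    then show ?case by (simp only: s_def)
  qed
  then have "2 * \<delta> \<le> 0" by (rule tendsto_lowerbound[OF lim]) simp
  then show False using \<delta> by simp
qed

lemma rho_square: "(rho p)\<^sup>2 = sqrt (kor p)"
proof -
  have "(rho p ^ 2) ^ 2 = kor p" by (simp add: rho_kor flip: power_mult)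
  then show ?thesis by (metis real_sqrt_abs abs_of_nonneg zero_le_power2)
qed

lemma fund0_bounded:
  assumes "x \<ge> 0" shows "\<bar>fund0 x\<bar> \<le> 3"
proof (cases "x < 1")
  case True
  have "(1 - x) ^ n \<le> 1 \<and> 0 \<le> (1 - x) ^ n" for n using assms True by (simp add: power_le_one)
  note pw = this
  have "\<bar>1 + a / 2 + 3 * b / 8 + 5 * c / 16 + 35 * d / 128\<bar> \<le> 3"
    if "0 \<le> a" "a \<le> 1" "0 \<le> b" "b \<le> 1" "0 \<le> c" "c \<le> 1" "0 \<le> d" "d \<le> 1" for a b c d :: real
    unfolding abs_le_iff using that by (simp add: field_simps)
  from this[of "1 - x" "(1 - x)^2" "(1 - x)^3" "(1 - x)^4"]
  show ?thesis using True pw[of 1] pw[of 2] pw[of 3] pw[of 4] by (simp add: fund0_def)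
next
  case False
  then have "1 \<le> sqrt x" by simp
  then have "1 / sqrt x \<le> 1" "1 / sqrt x \<ge> 0" by simp_all
  then show ?thesis using False order_trans[of "1 / sqrt x" 1 3] by (simp add: fund0_def)
qed

text \<open>The data have a pole at \<open>\<xi>\<close>; the regularised fundamental solution extends them continuously and boundedly from
  the boundary to the whole space.\<close>

lemma dirichlet_solution_Gamma_exists:
  assumes \<Omega>: "open \<Omega>" "bounded \<Omega>" and ext: "\<And>p. p \<in> frontier \<Omega> \<Longrightarrow> exterior_koranyi \<Omega> p"
    and d: "d > 0" "\<And>p. p \<in> frontier \<Omega> \<Longrightarrow> d \<le> kor (heis_inv \<xi> \<star> p)"
  shows "\<exists>u. dirichlet_solution \<Omega> (Gamma_fund \<xi>) u"
proof -
  define \<Phi> where "\<Phi> = (\<lambda>q. fund0 (kor (heis_inv \<xi> \<star> q) / d) / sqrt d / (8 * pi))"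
  have "continuous_on UNIV (\<lambda>q. fund0 (kor (heis_inv \<xi> \<star> q) / d) / sqrt d)"
    using regularised_fundamental(1)[OF d(1)] by (rule Ck_on_continuous)
  then have c: "continuous_on UNIV \<Phi>"
    unfolding \<Phi>_def by (rule continuous_on_divide[OF _ continuous_on_const]) simp
  have "\<bar>\<Phi> q\<bar> \<le> 3 / sqrt d / (8 * pi)" for q
  proof -
    have "\<bar>fund0 (kor (heis_inv \<xi> \<star> q) / d)\<bar> \<le> 3" by (rule fund0_bounded) (use d in simp)
    then show ?thesis using d by (simp add: \<Phi>_def abs_mult divide_right_mono)
  qed
  with dirichlet_solution_exists[OF \<Omega> ext c] obtain u where u: "dirichlet_solution \<Omega> \<Phi> u" by metis
  have "\<Phi> p = Gamma_fund \<xi> p" if "p \<in> frontier \<Omega>" for p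
  proof -
    have "kor (heis_inv \<xi> \<star> p) / d \<ge> 1" using d that by simp
    then have "\<Phi> p = 1 / sqrt (kor (heis_inv \<xi> \<star> p)) / (8 * pi)"
      using d(1) by (simp add: \<Phi>_def fund0_def real_sqrt_divide)
    then show ?thesis by (simp add: Gamma_fund_def rho_square)
  qed
  then have "dirichlet_solution \<Omega> (Gamma_fund \<xi>) u" using u by (simp add: dirichlet_solution_def)
  then show ?thesis by blast
qed

section \<open>An upper bound for the first eigenvalue\<close>

text \<open>\<open>flat 0\<close> is Cauchy's function \<open>exp (- 1 / y)\<close>; the powers of \<open>1 / y\<close> occur in its derivatives.\<close>

definition flat :: "nat \<Rightarrow> real \<Rightarrow> real" where
  "flat j y = (if y > 0 then exp (- inverse y) * inverse y ^ j else 0)"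

lemma flat_tendsto_0: "(flat j \<longlongrightarrow> 0) (at 0)"
proof (rule filterlim_split_at)
  show "(flat j \<longlongrightarrow> 0) (at_left 0)"
    by (rule Lim_transform_eventually[OF tendsto_const]) (auto simp: eventually_at_filter flat_def)
  have "((\<lambda>y::real. inverse y ^ j / exp (inverse y)) \<longlongrightarrow> 0) (at_right 0)"
    by (rule filterlim_compose[OF tendsto_power_div_exp_0 filterlim_inverse_at_top_right])
  then show "(flat j \<longlongrightarrow> 0) (at_right 0)"
    by (rule Lim_transform_eventually)
       (auto simp: eventually_at_filter flat_def exp_minus divide_inverse mult.commute)
qed

text \<open>The family is closed under differentiation, which makes every member infinitely differentiable.\<close>

lemma flat_deriv: "(flat j has_real_derivative flat (j + 2) y - real j * flat (j + 1) y) (at y)"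
proof -
  consider "y > 0" | "y < 0" | "y = 0" by linarith
  then show ?thesis
  proof cases
    case 1
    have "((\<lambda>y. exp (- inverse y) * inverse y ^ j) has_real_derivative flat (j + 2) y - real j * flat (j + 1) y) (at y)"
    proof -
      have i: "(inverse has_real_derivative - (inverse y * inverse y)) (at y)"
        using 1 by (auto intro!: derivative_eq_intros)
      have pj: "((\<lambda>y. inverse y ^ j) has_real_derivative - (real j * inverse y ^ (j + 1))) (at y)"
        using DERIV_power[OF i, of j] by (cases j) (simp_all add: mult_ac)
      have pe: "((\<lambda>y. exp (- inverse y)) has_real_derivative exp (- inverse y) * (inverse y * inverse y)) (at y)"
        using DERIV_chain2[OF DERIV_exp DERIV_minus[OF i]] by simp
      show ?thesis
        using DERIV_mult[OF pe pj] 1 by (simp add: flat_def algebra_simps)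
    qed
    then show ?thesis
      by (rule has_field_derivative_transform_within_open[where S = "{0<..}"]) (use 1 in \<open>auto simp: flat_def\<close>)
  next
    case 2
    have "(flat j has_real_derivative 0) (at y)"
      by (rule has_field_derivative_transform_within_open[where S = "{..<0}", OF DERIV_const[of 0]]) (use 2 in \<open>auto simp: flat_def\<close>)
    then show ?thesis using 2 by (simp add: flat_def)
  next
    case 3
    have "flat j h / h = flat (Suc j) h" for h
      by (simp add: flat_def divide_inverse)
    moreover have "flat k 0 = 0" for k by (simp add: flat_def)
    ultimately show ?thesis using 3 flat_tendsto_0[of "Suc j"] by (simp add: has_field_derivative_iff)
  qed
qed

lemma flat_continuous: "continuous_on S (flat j)"
  using flat_deriv by (meson DERIV_isCont continuous_at_imp_continuous_on)

lemma Ck_on_flat: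
  assumes U: "open U" and f: "\<And>k. Ck_on k U f"
  shows "Ck_on k U (\<lambda>p. flat j (f p))"
proof (induction k arbitrary: j)
  case 0
  then show ?case using f[of 0] continuous_on_compose2[OF flat_continuous[of UNIV j], of U f] by simp
next
  case (Suc k)
  show ?case
  proof (rule Ck_on_Suc_intro[OF U, where f' = "\<lambda>p v. (flat (j + 2) (f p) - real j * flat (j + 1) (f p)) * frechet_derivative f (at p) v"])
    fix p assume p: "p \<in> U"
    have "(flat j has_derivative (*) (flat (j + 2) (f p) - real j * flat (j + 1) (f p))) (at (f p))"
      using flat_deriv[of j "f p"] by (simp add: has_field_derivative_def)
    from has_derivative_compose[OF Ck_on_has_derivative[OF U f p] this]
    show "((\<lambda>p. flat j (f p)) has_derivative (\<lambda>v. (flat (j + 2) (f p) - real j * flat (j + 1) (f p)) * frechet_derivative f (at p) v)) (at p)" .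
  next
    fix b :: 'a assume b: "b \<in> Basis"
    show "Ck_on k U (\<lambda>p. (flat (j + 2) (f p) - real j * flat (j + 1) (f p)) * frechet_derivative f (at p) b)"
      by (intro Ck_on_intros U Suc.IH Ck_on_Suc_frechet[OF f b])
  qed
qed

definition bump :: "heis \<Rightarrow> real \<Rightarrow> heis \<Rightarrow> real" where
  "bump g c q = flat 0 (1 - kor (g \<star> q) * inverse c)"

lemma Ck_on_bump: "Ck_on k UNIV (bump g c)"
  unfolding bump_def[abs_def] by (intro Ck_on_flat Ck_on_intros Ck_on_kor_left open_UNIV)

lemma bump_outside: "c > 0 \<Longrightarrow> kor (g \<star> q) \<ge> c \<Longrightarrow> bump g c q = 0"
  by (simp add: bump_def flat_def field_simps)

lemma test_function_bump:
  assumes c: "c > 0" and sub: "{q. kor (heis_inv \<xi> \<star> q) \<le> c} \<subseteq> \<Omega>"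
  shows "test_function \<Omega> (bump (heis_inv \<xi>) c)"
proof -
  let ?K = "{q. kor (heis_inv \<xi> \<star> q) \<le> c}"
  have "p \<in> ?K" if "bump (heis_inv \<xi>) c p \<noteq> 0" for p
    using bump_outside[OF c, of "heis_inv \<xi>" p] that by (cases "kor (heis_inv \<xi> \<star> p) \<le> c") auto
  then have s: "closure {p. bump (heis_inv \<xi>) c p \<noteq> 0} \<subseteq> ?K"
    by (intro closure_minimal compact_imp_closed[OF compact_gauge_ball]) auto
  have "bounded {p. bump (heis_inv \<xi>) c p \<noteq> 0}"
    by (rule bounded_subset[OF compact_imp_bounded[OF compact_gauge_ball] order_trans[OF closure_subset s]])
  then have "compact (closure {p. bump (heis_inv \<xi>) c p \<noteq> 0})" by (simp add: compact_closure)
  then show ?thesis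
    unfolding test_function_def smooth_on_def using Ck_on_bump s sub by blast
qed

lemma bump_gradient:
  assumes c: "c > 0"
  shows "(hX (bump g c) p)\<^sup>2 + (hY (bump g c) p)\<^sup>2 =
    (flat 2 (1 - kor (g \<star> p) * inverse c))\<^sup>2 * (16 * kor (g \<star> p) * zsq (g \<star> p)) / c\<^sup>2"
proof -
  have d: "bump g c differentiable (at q)" for q
    by (rule Ck_on_Suc_differentiable[OF open_UNIV Ck_on_bump[of "Suc 0"]]) simp
  obtain x y t where \<zeta>: "g \<star> p = (x, y, t)" by (cases "g \<star> p")
  let ?f = "flat 2 (1 - kor (g \<star> p) * inverse c)"
  have eX: "g \<star> (p \<star> (s, 0, 0)) = (x, y, t) \<star> (s, 0, 0)" and eY: "g \<star> (p \<star> (0, s, 0)) = (x, y, t) \<star> (0, s, 0)" for s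
    by (simp_all only: hprod_assoc[symmetric] \<zeta>)
  have chain: "((\<lambda>s. flat 0 (1 - n s * inverse c)) has_real_derivative ?f * (0 - n' * inverse c)) (at 0)"
    if "(n has_real_derivative n') (at 0)" "n 0 = kor (g \<star> p)" for n n'
  proof -
    have "((\<lambda>s. 1 - n s * inverse c) has_real_derivative (0 - n' * inverse c)) (at 0)"
      by (intro DERIV_diff DERIV_const DERIV_cmult_right that(1))
    from DERIV_chain2[OF flat_deriv this, of 0] show ?thesis by (simp add: that(2) numeral_2_eq_2)
  qed
  have "((\<lambda>s. bump g c (p \<star> (s, 0, 0))) has_real_derivative hX (bump g c) p) (at 0)"
    using hdiff_along_line[OF d, where p = p and s = 0 and a = 1 and b = 0] by (simp add: hX_hdiff[OF d])
  moreover have "((\<lambda>s. bump g c (p \<star> (s, 0, 0))) has_real_derivative ?f * (0 - (4 * x * (x\<^sup>2 + y\<^sup>2) + 4 * y * t) * inverse c)) (at 0)"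
    unfolding bump_def eX by (rule chain) (use kor_along_X[of x y t 0] in \<open>simp_all add: \<zeta>\<close>)
  ultimately have X: "hX (bump g c) p = - ?f * (4 * x * (x\<^sup>2 + y\<^sup>2) + 4 * y * t) / c"
    using DERIV_unique by (fastforce simp: divide_inverse)
  have "((\<lambda>s. bump g c (p \<star> (0, s, 0))) has_real_derivative hY (bump g c) p) (at 0)"
    using hdiff_along_line[OF d, where p = p and s = 0 and a = 0 and b = 1] by (simp add: hY_hdiff[OF d])
  moreover have "((\<lambda>s. bump g c (p \<star> (0, s, 0))) has_real_derivative ?f * (0 - (4 * y * (x\<^sup>2 + y\<^sup>2) - 4 * x * t) * inverse c)) (at 0)"
    unfolding bump_def eY by (rule chain) (use kor_along_Y[of x y t 0] in \<open>simp_all add: \<zeta>\<close>)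
  ultimately have Y: "hY (bump g c) p = - ?f * (4 * y * (x\<^sup>2 + y\<^sup>2) - 4 * x * t) / c"
    using DERIV_unique by (fastforce simp: divide_inverse)
  have "(4 * x * (x\<^sup>2 + y\<^sup>2) + 4 * y * t)\<^sup>2 + (4 * y * (x\<^sup>2 + y\<^sup>2) - 4 * x * t)\<^sup>2 = 16 * kor (g \<star> p) * zsq (g \<star> p)"
    unfolding \<zeta> kor_def zsq_def by (simp add: power2_eq_square algebra_simps)
  then show ?thesis unfolding X Y
    by (simp add: power_divide power_mult_distrib add_divide_distrib[symmetric] distrib_left[symmetric])
qed

text \<open>Split \<open>exp (2 m - 3/4) = exp (5 m / 12)\<^sup>3 exp (3 (m - 1) / 4)\<close> and apply the tangent inequality
  \<open>exp x \<ge> e x\<close> to each factor; the two factors are then nearly optimal at the same \<open>m\<close>.\<close>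

lemma exp_bound_aux:
  assumes "m \<ge> (1::real)"
  shows "m ^ 3 * (m - 1) * exp (- 2 * m) \<le> 18.432 * exp (- 19 / 4)"
proof -
  have e: "exp x \<ge> exp 1 * x" for x :: real
    using exp_ge_add_one_self[of "x - 1"] by (simp add: exp_diff field_simps)
  have "(exp 1 * (5 * m / 12)) ^ 3 \<le> exp (5 * m / 12) ^ 3"
    by (rule power_mono[OF e]) (use assms in simp)
  moreover have "exp 1 * (3 * (m - 1) / 4) \<le> exp (3 * (m - 1) / 4)" by (rule e)
  ultimately have "(exp 1 * (5 * m / 12)) ^ 3 * (exp 1 * (3 * (m - 1) / 4)) \<le> exp (5 * m / 12) ^ 3 * exp (3 * (m - 1) / 4)"
    using assms by (intro mult_mono) auto
  also have "\<dots> = exp (2 * m - 3 / 4)"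
    by (simp add: exp_of_nat_mult[symmetric] exp_add[symmetric] field_simps)
  also have "(exp 1 * (5 * m / 12)) ^ 3 * (exp 1 * (3 * (m - 1) / 4)) = exp 4 * (m ^ 3 * (m - 1) / 18.432)"
  proof -
    have "exp 4 = exp (1::real) ^ 4" by (simp add: exp_of_nat_mult[symmetric])
    then show ?thesis by (simp add: field_simps power_mult_distrib power_divide eval_nat_numeral)
  qed
  finally have "exp 4 * (m ^ 3 * (m - 1)) \<le> 18.432 * exp (2 * m - 3 / 4)" by simp
  then have "exp 4 * (m ^ 3 * (m - 1)) * exp (- 2 * m - 4) \<le> 18.432 * exp (2 * m - 3 / 4) * exp (- 2 * m - 4)"
    by (rule mult_right_mono) simp
  moreover have "18.432 * exp (2 * m - 3 / 4) * exp (- 2 * m - 4) = 18.432 * exp (- 19 / 4)"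
    unfolding mult.assoc by (simp add: exp_add[symmetric])
  moreover have "exp 4 * (m ^ 3 * (m - 1)) * exp (- 2 * m - 4) = m ^ 3 * (m - 1) * exp (- 2 * m)"
  proof -
    have "exp 4 * exp (- 2 * m - 4) = exp (- 2 * m)" by (simp add: exp_add[symmetric])
    then show ?thesis by (metis mult.assoc mult.commute)
  qed
  ultimately show ?thesis by (simp only:)
qed

text \<open>With \<open>m = 1 / y\<close>, where \<open>y = 1 - N / c\<close>, the squared gradient is
  \<open>16 N |z|\<^sup>2 m\<^sup>4 exp (- 2 m) / c\<^sup>2\<close>; inserting \<open>|z|\<^sup>2 \<le> \<surd>c\<close> and \<open>N = c (1 - y)\<close>
  leaves a function of \<open>m\<close> alone.\<close>

lemma bump_gradient_le:
  assumes c: "c > 0"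
  shows "(hX (bump g c) p)\<^sup>2 + (hY (bump g c) p)\<^sup>2 \<le> 16 * (18.432 * exp (- 19 / 4)) / sqrt c * indicator {q. kor (g \<star> q) < c} p"
proof (cases "kor (g \<star> p) < c")
  case False
  then have "1 - kor (g \<star> p) * inverse c \<le> 0" using c by (simp add: field_simps)
  then show ?thesis using False by (simp add: bump_gradient[OF c] flat_def)
next
  case True
  define N where "N = kor (g \<star> p)"
  define y where "y = 1 - N * inverse c"
  have N: "0 \<le> N" "N < c" using True by (simp_all add: N_def)
  have y: "0 < y" "y \<le> 1" using N c by (simp_all add: y_def field_simps)
  define m where "m = inverse y"
  have m: "m \<ge> 1" using y by (simp add: m_def one_le_inverse)
  have Ny: "N = c * (1 - y)" using c by (simp add: y_def)
  have z: "zsq (g \<star> p) \<le> sqrt c"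
  proof (rule real_le_rsqrt)
    show "(zsq (g \<star> p))\<^sup>2 \<le> c" using N(2) unfolding N_def kor_def using zero_le_power2[of "snd (snd (g \<star> p))"] by linarith
  qed
  have ff: "(flat 2 y)\<^sup>2 = exp (- 2 * m) * m ^ 4"
    using y by (simp add: flat_def m_def power_mult_distrib exp_double[symmetric] flip: power_mult)
  have my: "m ^ 4 * (1 - y) = m ^ 3 * (m - 1)"
    using y by (simp add: m_def field_simps eval_nat_numeral)
  have "(flat 2 y)\<^sup>2 * (16 * N * zsq (g \<star> p)) / c\<^sup>2 \<le> (flat 2 y)\<^sup>2 * (16 * N * sqrt c) / c\<^sup>2"
    using z N c by (intro divide_right_mono mult_left_mono) auto
  also have "\<dots> = 16 * (m ^ 4 * (1 - y) * exp (- 2 * m)) * (sqrt c / c)"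
    unfolding ff Ny using c by (simp add: power2_eq_square)
  also have "sqrt c / c = 1 / sqrt c" using c by (simp add: real_div_sqrt field_simps)
  also have "16 * (m ^ 4 * (1 - y) * exp (- 2 * m)) * (1 / sqrt c) \<le> 16 * (18.432 * exp (- 19 / 4)) * (1 / sqrt c)"
    unfolding my using exp_bound_aux[OF m] c by (intro mult_right_mono mult_left_mono) auto
  finally show ?thesis using True by (simp add: bump_gradient[OF c] N_def y_def)
qed

lemma gauge_ball_measure:
  assumes s: "s > 0"
  shows "emeasure lborel {q. kor (g \<star> q) < s} < \<infinity>"
    "measure lborel {q. kor (g \<star> q) < s} > 0"
    "measure lborel {q. kor (g \<star> q) < 3 * s} = 3 * measure lborel {q. kor (g \<star> q) < s}"
proof -
  have sets [measurable]: "{q. kor (g \<star> q) < s} \<in> sets borel" for g s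
    by (intro borel_open open_Collect_less continuous_intros)
  have fin: "emeasure lborel {q. kor (g \<star> q) < s} < \<infinity>" for g s
  proof -
    have "bounded {q. kor (heis_inv (heis_inv g) \<star> q) \<le> s}" by (rule compact_imp_bounded[OF compact_gauge_ball])
    then have "bounded {q. kor (g \<star> q) < s}" by (rule bounded_subset) auto
    then show ?thesis by (rule emeasure_bounded_finite)
  qed
  show "emeasure lborel {q. kor (g \<star> q) < s} < \<infinity>" by (rule fin)
  have "open {q. kor (g \<star> q) < s}" by (intro open_Collect_less continuous_intros)
  moreover have "heis_inv g \<in> {q. kor (g \<star> q) < s}" using s by (simp add: heis_mult_inv kor_def zsq_def)
  ultimately obtain e where e: "e > 0" "ball (heis_inv g) e \<subseteq> {q. kor (g \<star> q) < s}"
    using open_contains_ball by blast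
  have "0 < measure lborel (ball (heis_inv g) e)" using e(1) by (rule content_ball_pos)
  also have "\<dots> \<le> measure lborel {q. kor (g \<star> q) < s}"
    by (rule measure_mono_fmeasurable[OF e(2)]) (use fin[of g s] in \<open>auto simp: fmeasurable_def\<close>)
  finally show "measure lborel {q. kor (g \<star> q) < s} > 0" .
  have left: "emeasure lborel {q. kor (g \<star> q) < s} = emeasure lborel {q. kor q < s}" for s
  proof -
    have "emeasure lborel {q. kor q < s} = emeasure (distr lborel lborel (\<lambda>q. g \<star> q)) {q. kor q < s}"
      by (simp only: distr_lborel_left)
    also have "\<dots> = emeasure lborel ((\<lambda>q. g \<star> q) -` {q. kor q < s} \<inter> space lborel)"
      using sets[of 0 s] by (intro emeasure_distr) auto
    finally show ?thesis by (simp add: vimage_def)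
  qed
  define l where "l = root 4 (3::real)"
  have l: "l > 0" "l ^ 4 = 3" by (simp_all add: l_def)
  have "emeasure lborel {q. kor q < 3 * s} = (\<integral>\<^sup>+q. indicator {q. kor q < 3 * s} q \<partial>lborel)"
    using sets[of 0 "3 * s"] by simp
  also have "\<dots> = ennreal (l ^ 4) * (\<integral>\<^sup>+(x, y, t). indicator {q. kor q < 3 * s} (0 + l * x, 0 + l * y, (0 + 0 * x + 0 * y) + l\<^sup>2 * t) \<partial>lborel)"
    by (rule nn_integral_heis_affine[OF _ l(1)]) (use sets[of 0 "3 * s"] in simp)
  also have "(\<lambda>(x, y, t). indicator {q. kor q < 3 * s} (0 + l * x, 0 + l * y, (0 + 0 * x + 0 * y) + l\<^sup>2 * t)) = (indicator {q. kor q < s} :: heis \<Rightarrow> ennreal)"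
  proof -
    have "kor (l * x, l * y, l\<^sup>2 * t) = 3 * kor (x, y, t)" for x y t
      unfolding l(2)[symmetric] kor_def zsq_def by (simp add: power_mult_distrib algebra_simps eval_nat_numeral)
    then show ?thesis by (auto simp: fun_eq_iff indicator_def)
  qed
  also have "(\<integral>\<^sup>+q. indicator {q. kor q < s} q \<partial>lborel) = emeasure lborel {q. kor q < s}"
    using sets[of 0 s] by simp
  finally have "emeasure lborel {q. kor (g \<star> q) < 3 * s} = ennreal 3 * emeasure lborel {q. kor (g \<star> q) < s}"
    by (simp add: left l(2))
  then show "measure lborel {q. kor (g \<star> q) < 3 * s} = 3 * measure lborel {q. kor (g \<star> q) < s}"
    by (simp add: measure_def enn2real_mult)
qed

lemma lebesgue_on_integral:
  fixes f :: "heis \<Rightarrow> real"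
  assumes \<Omega>: "open \<Omega>" and f: "f \<in> borel_measurable borel" "\<And>p. p \<notin> \<Omega> \<Longrightarrow> f p = 0"
  shows "(LINT p|lebesgue_on \<Omega>. f p) = (\<integral>p. f p \<partial>lborel)"
    "integrable (lebesgue_on \<Omega>) f \<longleftrightarrow> integrable lborel f"
proof -
  have s: "\<Omega> \<inter> space lebesgue \<in> sets lebesgue" using \<Omega> by simp
  have eq: "(\<lambda>p. indicator \<Omega> p *\<^sub>R f p) = f" using f(2) by (auto simp: fun_eq_iff indicator_def)
  have m: "f \<in> borel_measurable lborel" using f(1) by simp
  show "(LINT p|lebesgue_on \<Omega>. f p) = (\<integral>p. f p \<partial>lborel)"
    using integral_restrict_space[OF s, of f] integral_completion[OF m] by (simp only: eq)
  show "integrable (lebesgue_on \<Omega>) f \<longleftrightarrow> integrable lborel f"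
    using integrable_restrict_space[OF s, of f] integrable_completion[OF m] by (simp only: eq)
qed

text \<open>The numerator of the Rayleigh quotient is bounded by the supremum of the squared gradient times the volume of the
  ball \<open>N < c\<close>, the denominator from below by the values on the ball \<open>N < c / 3\<close>.  The volume of \<open>N < s\<close> is proportional to
  \<open>s\<close>, so it cancels.\<close>

lemma lambda1_le:
  assumes \<Omega>: "open \<Omega>" and c: "c > 0" and sub: "{q. kor (heis_inv \<xi> \<star> q) \<le> c} \<subseteq> \<Omega>"
  shows "lambda1 \<Omega> \<le> 884.736 * exp (- 7 / 4) / sqrt c"
proof -
  define g where "g = heis_inv \<xi>"
  define v where "v = bump g c"
  define V where "V = measure lborel {q. kor (g \<star> q) < c / 3}"
  have V: "V > 0" "measure lborel {q. kor (g \<star> q) < c} = 3 * V"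
    using gauge_ball_measure[of "c / 3" g] c by (simp_all add: V_def)
  have fin: "emeasure lborel {q. kor (g \<star> q) < s} < \<infinity>" if "s > 0" for s
    using gauge_ball_measure(1)[OF that] .
  have sets: "{q. kor (g \<star> q) < s} \<in> sets lborel" for s
    unfolding sets_lborel by (intro borel_open open_Collect_less continuous_intros)
  have C: "Ck_on k UNIV v" for k unfolding v_def by (rule Ck_on_bump)
  have dv: "v differentiable (at p)" for p by (rule Ck_on_Suc_differentiable[OF open_UNIV C[of "Suc 0"]]) simp
  have vc: "continuous_on UNIV v" using C[of 0] by simp
  have hx: "hX v = hdiff 1 0 v" and hy: "hY v = hdiff 0 1 v"
    using hX_hdiff[OF dv] hY_hdiff[OF dv] by auto
  have xc: "continuous_on UNIV (hX v)" and yc: "continuous_on UNIV (hY v)"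
    unfolding hx hy using Ck_on_hdiff[OF open_UNIV C[of "Suc 0"]] by simp_all
  have v0: "v p = 0" if "p \<notin> {q. kor (heis_inv \<xi> \<star> q) \<le> c}" for p
    using bump_outside[OF c, of g p] that by (simp add: v_def g_def)
  have grad: "(hX v p)\<^sup>2 + (hY v p)\<^sup>2 \<le> 16 * (18.432 * exp (- 19 / 4)) / sqrt c * indicator {q. kor (g \<star> q) < c} p" for p
    unfolding v_def by (rule bump_gradient_le[OF c])
  have xy0: "hX v p = 0 \<and> hY v p = 0" if "p \<notin> {q. kor (heis_inv \<xi> \<star> q) \<le> c}" for p
  proof -
    have "(hX v p)\<^sup>2 + (hY v p)\<^sup>2 \<le> 0" using grad[of p] that by (simp add: g_def)
    then show ?thesis by (simp add: sum_power2_le_zero_iff)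
  qed
  have isq: "integrable lborel (\<lambda>p. (f p)\<^sup>2)" if "continuous_on UNIV f" "\<And>p. p \<notin> {q. kor (heis_inv \<xi> \<star> q) \<le> c} \<Longrightarrow> f p = 0" for f :: "heis \<Rightarrow> real"
  proof -
    have "integrable lborel (\<lambda>p. 1 * (f p)\<^sup>2)"
      by (rule integrable_bounded_mult_compact[where B = 1 and U = "\<lambda>_. 1" and \<psi> = "\<lambda>p. (f p)\<^sup>2", OF _ _ _ compact_gauge_ball[of \<xi> c]])
         (use that in \<open>auto intro!: continuous_intros\<close>)
    then show ?thesis by simp
  qed
  have bm: "f \<in> borel_measurable borel" if "continuous_on UNIV f" for f :: "heis \<Rightarrow> real"
    using that by (rule borel_measurable_continuous_onI)
  have L2: "L2_on \<Omega> f" if f: "continuous_on UNIV f" "\<And>p. p \<notin> {q. kor (heis_inv \<xi> \<star> q) \<le> c} \<Longrightarrow> f p = 0" for f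
    unfolding L2_on_def
  proof
    have "f \<in> borel_measurable lebesgue" using bm[OF f(1)] by (simp add: measurable_completion)
    then show "f \<in> borel_measurable (lebesgue_on \<Omega>)" by (rule measurable_restrict_space1)
    show "integrable (lebesgue_on \<Omega>) (\<lambda>p. (f p)\<^sup>2)"
      by (subst lebesgue_on_integral(2)[OF \<Omega>]) (use isq[OF f] f bm[OF f(1)] sub in \<open>auto\<close>)
  qed
  have S0: "S0_12 \<Omega> v (hX v) (hY v)"
    unfolding S0_12_def
  proof (intro conjI exI[of _ "\<lambda>n. v"] allI)
    show "L2_on \<Omega> v" by (rule L2[OF vc v0])
    show "L2_on \<Omega> (hX v)" "L2_on \<Omega> (hY v)" using L2 xc yc xy0 by blast+
    show "test_function \<Omega> v" unfolding v_def g_def by (rule test_function_bump[OF c sub])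
  qed (simp_all add: L2_tendsto_def)
  have num: "(LINT p|lebesgue_on \<Omega>. (hX v p)\<^sup>2 + (hY v p)\<^sup>2) \<le> 16 * (18.432 * exp (- 19 / 4)) / sqrt c * (3 * V)"
  proof -
    have "(LINT p|lebesgue_on \<Omega>. (hX v p)\<^sup>2 + (hY v p)\<^sup>2) = (\<integral>p. (hX v p)\<^sup>2 + (hY v p)\<^sup>2 \<partial>lborel)"
    proof (rule lebesgue_on_integral(1)[OF \<Omega>])
      show "(\<lambda>p. (hX v p)\<^sup>2 + (hY v p)\<^sup>2) \<in> borel_measurable borel"
        by (intro bm continuous_intros xc yc)
      show "(hX v p)\<^sup>2 + (hY v p)\<^sup>2 = 0" if "p \<notin> \<Omega>" for p using xy0[of p] that sub by auto
    qed
    also have "\<dots> \<le> (\<integral>p. 16 * (18.432 * exp (- 19 / 4)) / sqrt c * indicator {q. kor (g \<star> q) < c} p \<partial>lborel)"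
    proof (rule integral_mono[OF _ _ grad])
      show "integrable lborel (\<lambda>p. (hX v p)\<^sup>2 + (hY v p)\<^sup>2)"
        using isq xc yc xy0 by (intro Bochner_Integration.integrable_add) blast+
      show "integrable lborel (\<lambda>p. 16 * (18.432 * exp (- 19 / 4)) / sqrt c * indicator {q. kor (g \<star> q) < c} p)"
        by (intro integrable_mult_right integrable_real_indicator sets fin c)
    qed
    also have "\<dots> = 16 * (18.432 * exp (- 19 / 4)) / sqrt c * (3 * V)"
      using sets[of c] by (simp add: V(2))
    finally show ?thesis .
  qed
  have den: "(LINT p|lebesgue_on \<Omega>. (v p)\<^sup>2) \<ge> exp (- 3) * V"
  proof -
    have "exp (- 3) * V = (\<integral>p. exp (- 3) * indicator {q. kor (g \<star> q) < c / 3} p \<partial>lborel)"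
      using sets[of "c / 3"] by (simp add: V_def)
    also have "\<dots> \<le> (\<integral>p. (v p)\<^sup>2 \<partial>lborel)"
    proof (rule integral_mono)
      show "integrable lborel (\<lambda>p. exp (- 3) * indicator {q. kor (g \<star> q) < c / 3} p :: real)"
        by (intro integrable_mult_right integrable_real_indicator sets fin) (use c in simp)
      show "integrable lborel (\<lambda>p. (v p)\<^sup>2)" by (rule isq[OF vc v0])
      show "exp (- 3) * indicator {q. kor (g \<star> q) < c / 3} p \<le> (v p)\<^sup>2" for p
      proof (cases "kor (g \<star> p) < c / 3")
        case True
        define y where "y = 1 - kor (g \<star> p) * inverse c"
        have y: "2 / 3 < y" using True c by (simp add: y_def field_simps)
        have "inverse y < inverse (2 / 3)" using y by (intro less_imp_inverse_less) auto
        then have "exp (- 3) \<le> exp (2 * (- inverse y))" by simp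
        also have "\<dots> = (exp (- inverse y))\<^sup>2" by (rule exp_double)
        also have "\<dots> = (v p)\<^sup>2" using y by (simp add: v_def bump_def flat_def y_def[symmetric])
        finally show ?thesis using True by simp
      qed simp
    qed
    also have "\<dots> = (LINT p|lebesgue_on \<Omega>. (v p)\<^sup>2)"
    proof (rule lebesgue_on_integral(1)[OF \<Omega>, symmetric])
      show "(\<lambda>p. (v p)\<^sup>2) \<in> borel_measurable borel" by (intro bm continuous_intros vc)
      show "(v p)\<^sup>2 = 0" if "p \<notin> \<Omega>" for p using v0[of p] that sub by auto
    qed
    finally show ?thesis .
  qed
  have ev: "exp (- 3) * V > 0" using V by simp
  have nz: "\<not> (AE p in lebesgue_on \<Omega>. v p = 0)"
  proof
    assume "AE p in lebesgue_on \<Omega>. v p = 0"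
    then have "AE p in lebesgue_on \<Omega>. (v p)\<^sup>2 = 0" by eventually_elim simp
    then have "(LINT p|lebesgue_on \<Omega>. (v p)\<^sup>2) = 0" by (rule integral_eq_zero_AE)
    then show False using den ev by simp
  qed
  let ?S = "{(LINT p|lebesgue_on \<Omega>. (a p)\<^sup>2 + (b p)\<^sup>2) / (LINT p|lebesgue_on \<Omega>. (v p)\<^sup>2) |v a b.
      S0_12 \<Omega> v a b \<and> \<not> (AE p in lebesgue_on \<Omega>. v p = 0)}"
  have "lambda1 \<Omega> \<le> (LINT p|lebesgue_on \<Omega>. (hX v p)\<^sup>2 + (hY v p)\<^sup>2) / (LINT p|lebesgue_on \<Omega>. (v p)\<^sup>2)"
    unfolding lambda1_def
  proof (rule cInf_lower)
    show "(LINT p|lebesgue_on \<Omega>. (hX v p)\<^sup>2 + (hY v p)\<^sup>2) / (LINT p|lebesgue_on \<Omega>. (v p)\<^sup>2) \<in> ?S"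
      using S0 nz by blast
    show "bdd_below ?S" by (rule bdd_belowI[of _ 0]) auto
  qed
  also have "\<dots> \<le> (16 * (18.432 * exp (- 19 / 4)) / sqrt c * (3 * V)) / (exp (- 3) * V)"
    using num den ev c V by (intro frac_le) auto
  also have "\<dots> = 884.736 * exp (- 7 / 4) / sqrt c"
  proof -
    have "exp (- 19 / 4) = exp (- 7 / 4) * exp (- 3 :: real)" by (simp add: exp_add[symmetric])
    then show ?thesis using V by simp
  qed
  finally show ?thesis .
qed

section \<open>The first zero of the Bessel function and the estimate\<close>

text \<open>With \<open>z = (x / 2)\<^sup>2\<close> the alternating series of these terms is \<open>J\<^sub>1 x\<close> divided by \<open>x / 2\<close>.\<close>

definition bessel_coeff :: "real \<Rightarrow> nat \<Rightarrow> real" where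
  "bessel_coeff z k = z ^ k / (fact k * fact (Suc k))"

lemma bessel_coeff_Suc: "bessel_coeff z (Suc k) = bessel_coeff z k * (z / (real (Suc k) * real (Suc (Suc k))))"
  by (simp add: bessel_coeff_def field_simps)

lemma bessel_coeff_tendsto_0: "bessel_coeff z \<longlonglongrightarrow> 0"
  and bessel_coeff_summable: "summable (\<lambda>k. (- 1) ^ k * bessel_coeff z k)"
proof -
  have le: "norm ((- 1) ^ k * bessel_coeff z k) \<le> \<bar>z\<bar> ^ k / fact k" for k
  proof -
    have "(fact k :: real) * 1 \<le> fact k * fact (Suc k)" by (intro mult_left_mono fact_ge_1) simp
    then have "\<bar>z\<bar> ^ k / (fact k * fact (Suc k)) \<le> \<bar>z\<bar> ^ k / fact k"
      by (intro divide_left_mono) (auto simp: mult_pos_pos simp del: fact_Suc)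
    then show ?thesis by (simp add: bessel_coeff_def abs_mult power_abs del: fact_Suc)
  qed
  have "summable (\<lambda>k. \<bar>z\<bar> ^ k / fact k)"
    using summable_exp[of "\<bar>z\<bar>"] by (simp add: field_simps)
  then show s: "summable (\<lambda>k. (- 1) ^ k * bessel_coeff z k)"
    by (rule summable_comparison_test') (rule le)
  have "(\<lambda>k. \<bar>(- 1) ^ k * bessel_coeff z k\<bar>) \<longlonglongrightarrow> 0"
    using tendsto_rabs_zero[OF summable_LIMSEQ_zero[OF s]] .
  then have "(\<lambda>k. \<bar>bessel_coeff z k\<bar>) \<longlonglongrightarrow> 0" by (simp add: abs_mult)
  then show "bessel_coeff z \<longlonglongrightarrow> 0" by (simp add: tendsto_rabs_zero_iff)
qed

definition bessel_series :: "real \<Rightarrow> real" where "bessel_series z = (\<Sum>k. (- 1) ^ k * bessel_coeff z k)"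

lemma bessel_J_1: "bessel_J 1 x = x / 2 * bessel_series ((x / 2)\<^sup>2)"
proof -
  have t: "(- 1) ^ k / (fact k * fact (k + 1)) * (x / 2) ^ (2 * k + 1) = x / 2 * ((- 1) ^ k * bessel_coeff ((x / 2)\<^sup>2) k)" for k
  proof -
    have "p / a * (q * h) = h * (p * (q / a))" for p a q h :: real by simp
    then show ?thesis unfolding power_add power_mult power_one_right bessel_coeff_def Suc_eq_plus1 .
  qed
  have "bessel_J 1 x = (\<Sum>k. x / 2 * ((- 1) ^ k * bessel_coeff ((x / 2)\<^sup>2) k))"
    unfolding bessel_J_def t ..
  also have "\<dots> = x / 2 * bessel_series ((x / 2)\<^sup>2)"
    unfolding bessel_series_def by (rule suminf_mult[OF bessel_coeff_summable])
  finally show ?thesis .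
qed

lemma bessel_series_continuous: "isCont bessel_series z"
proof -
  have eq: "bessel_series = (\<lambda>z. \<Sum>k. ((- 1) ^ k / (fact k * fact (Suc k))) * z ^ k)"
    by (simp add: bessel_series_def bessel_coeff_def fun_eq_iff del: fact_Suc)
  have "summable (\<lambda>k. ((- 1) ^ k / (fact k * fact (Suc k))) * (\<bar>z\<bar> + 1) ^ k)"
    using bessel_coeff_summable[of "\<bar>z\<bar> + 1"] by (simp add: bessel_coeff_def del: fact_Suc)
  then show ?thesis unfolding eq by (rule isCont_powser) simp
qed

text \<open>For \<open>z \<le> 6\<close> the terms decrease from the second one on, so the partial sums enclose the sum alternately.\<close>

lemma bessel_series_tail:
  assumes z: "0 \<le> z" "z \<le> 6"
  shows "bessel_series z \<ge> (\<Sum>k<4. (- 1) ^ k * bessel_coeff z k)" "bessel_series z \<le> (\<Sum>k<5. (- 1) ^ k * bessel_coeff z k)"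
proof -
  have nn: "bessel_coeff z k \<ge> 0" for k using z by (simp add: bessel_coeff_def)
  have dec: "bessel_coeff z (Suc k) \<le> bessel_coeff z k" if "k \<ge> 1" for k
  proof -
    have "2 * 3 \<le> real (Suc k) * real (Suc (Suc k))" using that by (intro mult_mono) auto
    then have "z / (real (Suc k) * real (Suc (Suc k))) \<le> 1" using z by (simp del: of_nat_Suc)
    then show ?thesis unfolding bessel_coeff_Suc using nn[of k] by (rule mult_left_le)
  qed
  have tail: "0 \<le> (\<Sum>k. (- 1) ^ k * bessel_coeff z (k + n))" if "n \<ge> 1" for n
    using summable_Leibniz'(2)[of "\<lambda>k. bessel_coeff z (k + n)" 0] LIMSEQ_ignore_initial_segment[OF bessel_coeff_tendsto_0] nn dec that
    by simp
  have split: "bessel_series z = (\<Sum>k. (- 1) ^ (k + n) * bessel_coeff z (k + n)) + (\<Sum>k<n. (- 1) ^ k * bessel_coeff z k)" for n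
    unfolding bessel_series_def by (rule suminf_split_initial_segment[OF bessel_coeff_summable])
  show "bessel_series z \<ge> (\<Sum>k<4. (- 1) ^ k * bessel_coeff z k)"
    using split[of 4] tail[of 4] by (simp add: power_add)
  have s5: "summable (\<lambda>k. (- 1) ^ k * bessel_coeff z (k + 5))"
  proof (rule summable_Leibniz'(1))
    show "bessel_coeff z (Suc n + 5) \<le> bessel_coeff z (n + 5)" for n using dec[of "n + 5"] by simp
  qed (use LIMSEQ_ignore_initial_segment[OF bessel_coeff_tendsto_0] nn in auto)
  have "(\<Sum>k. (- 1) ^ (k + 5) * bessel_coeff z (k + 5)) = - (\<Sum>k. (- 1) ^ k * bessel_coeff z (k + 5))"
    using suminf_minus[OF s5] by (simp add: power_add)
  then show "bessel_series z \<le> (\<Sum>k<5. (- 1) ^ k * bessel_coeff z k)"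
    using split[of 5] tail[of 5] by linarith
qed

lemma bessel_J_1_pos:
  assumes "0 < x" "x\<^sup>2 \<le> 12" shows "bessel_J 1 x > 0"
proof -
  define z where "z = (x / 2)\<^sup>2"
  have z: "0 \<le> z" "z \<le> 3" using assms by (simp_all add: z_def power_divide)
  \<comment> \<open>expanded at \<open>z = 3\<close> the partial sum has nonnegative coefficients only\<close>
  define w where "w = 3 - z"
  have w: "w \<ge> 0" "z = 3 - w" using z by (simp_all add: w_def)
  have "(\<Sum>k<4. (- 1) ^ k * bessel_coeff z k) = 1 - z / 2 + z\<^sup>2 / 12 - z ^ 3 / 144"
    by (simp add: bessel_coeff_def eval_nat_numeral)
  also have "\<dots> = 1 / 16 + 3 * w / 16 + w\<^sup>2 / 48 + w ^ 3 / 144"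
    unfolding w(2) by (simp add: field_simps power2_eq_square power3_eq_cube)
  also have "\<dots> > 0" using w(1) by (intro add_pos_nonneg) auto
  finally have "bessel_series z > 0" using bessel_series_tail(1)[of z] z by linarith
  then show ?thesis unfolding bessel_J_1 z_def[symmetric] using assms by simp
qed

lemma bessel_J_1_continuous: "continuous_on S (bessel_J 1)"
proof -
  have "continuous_on UNIV bessel_series"
    by (intro continuous_at_imp_continuous_on ballI bessel_series_continuous)
  then have "continuous_on S (\<lambda>x. bessel_series ((x / 2)\<^sup>2))"
    by (rule continuous_on_compose2) (auto intro!: continuous_intros)
  then have "continuous_on S (\<lambda>x. x / 2 * bessel_series ((x / 2)\<^sup>2))"
    by (intro continuous_on_mult continuous_on_divide continuous_on_id continuous_on_const) auto
  then show ?thesis unfolding bessel_J_1[abs_def] by simp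
qed

text \<open>A least positive zero exists because \<open>J\<^sub>1\<close> is continuous, positive up to \<open>\<surd>12\<close> and not positive at \<open>4\<close>.\<close>

lemma l11_square_ge: "l11\<^sup>2 \<ge> 12"
proof -
  have pos: "12 < x\<^sup>2" if "0 < x" "bessel_J 1 x = 0" for x
    using bessel_J_1_pos[of x] that by fastforce
  have "(\<Sum>k<5. (- 1) ^ k * bessel_coeff 4 k) < (0::real)"
    by (simp add: bessel_coeff_def eval_nat_numeral)
  then have "bessel_series 4 < 0" using bessel_series_tail(2)[of 4] by linarith
  then have neg: "bessel_J 1 4 \<le> 0" unfolding bessel_J_1 by simp
  have pos1: "bessel_J 1 1 \<ge> 0" using bessel_J_1_pos[of 1] by simp
  obtain y where y: "1 \<le> y" "y \<le> 4" "bessel_J 1 y = 0"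
    using IVT2'[OF neg pos1 _ bessel_J_1_continuous] by fastforce
  let ?Z = "{x \<in> {1..4}. bessel_J 1 x = 0}"
  have "closed ?Z"
    using continuous_closed_preimage_constant[OF bessel_J_1_continuous, of "{1..4}" 0] by simp
  moreover have "bounded ?Z" by (rule bounded_subset[OF bounded_closed_interval[of 1 4]]) auto
  ultimately have "compact ?Z" by (simp only: compact_eq_bounded_closed)
  then obtain x0 where x0: "x0 \<in> ?Z" "\<And>x. x \<in> ?Z \<Longrightarrow> x0 \<le> x"
  proof -
    assume "compact ?Z"
    moreover have "?Z \<noteq> {}" using y by auto
    ultimately show thesis using compact_attains_inf[of ?Z] that by blast
  qed
  have "l11 = x0"
    unfolding l11_def
  proof (rule Least_equality)
    show "0 < x0 \<and> bessel_J 1 x0 = 0" using x0(1) by auto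
    fix x assume x: "0 < x \<and> bessel_J 1 x = 0"
    then have "1 < x\<^sup>2" using pos[of x] by simp
    then have "1 \<le> x" using x power2_le_imp_le[of 1 x] by simp
    then show "x0 \<le> x" using x x0 by (cases "x \<le> 4") auto
  qed
  then show ?thesis using pos[of x0] x0(1) by auto
qed

text \<open>Gauge balls are star-shaped about their centre along Euclidean segments, so a point outside \<open>\<Omega>\<close>
  would give a boundary point that is too close.\<close>

lemma gauge_ball_inside:
  assumes xi: "\<xi> \<in> \<Omega>" and out: "\<And>p. p \<in> frontier \<Omega> \<Longrightarrow> c < kor (heis_inv \<xi> \<star> p)"
  shows "{q. kor (heis_inv \<xi> \<star> q) \<le> c} \<subseteq> \<Omega>"
proof (rule ccontr)
  assume "\<not> ?thesis"
  then obtain q where q: "kor (heis_inv \<xi> \<star> q) \<le> c" "q \<notin> \<Omega>" by blast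
  have "closed_segment \<xi> q \<inter> frontier \<Omega> \<noteq> {}"
    by (rule connected_Int_frontier) (use xi q in auto)
  then obtain p where p: "p \<in> closed_segment \<xi> q" "p \<in> frontier \<Omega>" by blast
  obtain \<tau> where \<tau>: "0 \<le> \<tau>" "\<tau> \<le> 1" "p = (1 - \<tau>) *\<^sub>R \<xi> + \<tau> *\<^sub>R q"
    using p(1) by (auto simp: closed_segment_def)
  have "heis_inv \<xi> \<star> p = \<tau> *\<^sub>R (heis_inv \<xi> \<star> q)"
    unfolding \<tau>(3) by (cases \<xi>; cases q) (simp add: algebra_simps)
  then have "kor (heis_inv \<xi> \<star> p) = \<tau> ^ 4 * (zsq (heis_inv \<xi> \<star> q))\<^sup>2 + \<tau>\<^sup>2 * (snd (snd (heis_inv \<xi> \<star> q)))\<^sup>2"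
    by (simp add: kor_def zsq_def power_mult_distrib eval_nat_numeral algebra_simps)
  also have "\<dots> \<le> 1 * (zsq (heis_inv \<xi> \<star> q))\<^sup>2 + 1 * (snd (snd (heis_inv \<xi> \<star> q)))\<^sup>2"
    using \<tau> by (intro add_mono mult_right_mono power_le_one) auto
  also have "\<dots> \<le> c" using q(1) by (simp add: kor_def)
  finally show False using out[OF p(2)] by simp
qed

theorem theorem6p2:
  fixes \<Omega> :: "heis set" and \<xi> :: heis
  assumes "bounded_domain \<Omega>"
    and "smooth_boundary \<Omega>"
    and "uniform_exterior_ball \<Omega>"
    and "uniform_exterior_ball (- closure \<Omega>)"
    and "\<xi> \<in> \<Omega>"
  shows "lambda1 \<Omega> \<le> C_const \<Omega> \<xi> * l11\<^sup>2 / (harmonic_radius \<Omega> \<xi>)\<^sup>2"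
proof -
  have \<Omega>: "open \<Omega>" "bounded \<Omega>" "\<Omega> \<noteq> {}" using assms(1) by (simp_all add: bounded_domain_def)
  have fc: "compact (frontier \<Omega>)" using \<Omega> by (simp add: compact_frontier_bounded)
  have "\<Omega> \<noteq> UNIV" using \<Omega>(2) not_bounded_UNIV by metis
  then have fne: "frontier \<Omega> \<noteq> {}" using \<Omega>(3) frontier_not_empty by blast
  have fout: "p \<notin> \<Omega>" if "p \<in> frontier \<Omega>" for p
    using that \<Omega>(1) by (auto simp: frontier_def interior_open)
  let ?N = "\<lambda>p. kor (heis_inv \<xi> \<star> p)"
  have dist: "heis_dist \<xi> p = root 4 (?N p)" for p by (simp add: heis_dist_def rho_kor)
  have dc: "continuous_on (frontier \<Omega>) (heis_dist \<xi>)"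
    unfolding dist[abs_def] by (intro continuous_intros)
  obtain p1 where p1: "p1 \<in> frontier \<Omega>" "\<And>p. p \<in> frontier \<Omega> \<Longrightarrow> heis_dist \<xi> p1 \<le> heis_dist \<xi> p"
    using continuous_attains_inf[OF fc fne dc] by blast
  obtain p2 where p2: "p2 \<in> frontier \<Omega>" "\<And>p. p \<in> frontier \<Omega> \<Longrightarrow> heis_dist \<xi> p \<le> heis_dist \<xi> p2"
    using continuous_attains_sup[OF fc fne dc] by blast
  define d where "d = heis_dist \<xi> p1"
  define D where "D = heis_dist \<xi> p2"
  have dinf: "(INF p\<in>frontier \<Omega>. heis_dist \<xi> p) = d"
    unfolding d_def by (rule cInf_eq_minimum) (use p1 in auto)
  have Dsup: "(SUP p\<in>frontier \<Omega>. heis_dist \<xi> p) = D"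
    unfolding D_def by (rule cSup_eq_maximum) (use p2 in auto)
  have dD: "d \<le> D" using p1(2)[OF p2(1)] by (simp add: d_def D_def)
  have Npos: "?N p > 0" if "p \<in> frontier \<Omega>" for p
  proof -
    have "?N p \<noteq> 0"
    proof
      assume "?N p = 0"
      then have "\<xi> \<star> (heis_inv \<xi> \<star> p) = \<xi> \<star> 0" by (simp only: kor_eq_0)
      then show False using fout[OF that] assms(5) by simp
    qed
    then show ?thesis using kor_nonneg[of "heis_inv \<xi> \<star> p"] by linarith
  qed
  have d: "d > 0" using Npos[OF p1(1)] by (simp add: d_def dist)
  have Nge: "d ^ 4 \<le> ?N p" if "p \<in> frontier \<Omega>" for p
    using power_mono[OF p1(2)[OF that], of 4] by (simp add: heis_dist_pow4 d_def)
  define H where "H = H_part \<Omega> \<xi>"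
  have "\<exists>u. dirichlet_solution \<Omega> (Gamma_fund \<xi>) u"
    by (rule dirichlet_solution_Gamma_exists[where d = "d ^ 4"])
       (use \<Omega> exterior_koranyi_of_uniform[OF assms(3)] d Nge in auto)
  then have H: "dirichlet_solution \<Omega> (Gamma_fund \<xi>) H"
    unfolding H_def H_part_def by (rule someI_ex)
  have "H \<xi> \<ge> 1 / (8 * pi * D\<^sup>2)"
  proof (rule dirichlet_minimum_principle[OF \<Omega>(1,2) H _ assms(5)])
    fix p assume p: "p \<in> frontier \<Omega>"
    have "0 < heis_dist \<xi> p" using p1(2)[OF p] d by (simp add: d_def)
    moreover have "(heis_dist \<xi> p)\<^sup>2 \<le> D\<^sup>2" unfolding D_def by (intro power_mono p2(2) p) simp
    ultimately have "1 / (8 * pi * D\<^sup>2) \<le> 1 / (8 * pi * (heis_dist \<xi> p)\<^sup>2)"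
      by (intro divide_left_mono mult_left_mono mult_pos_pos) (use d dD in auto)
    then show "1 / (8 * pi * D\<^sup>2) \<le> Gamma_fund \<xi> p" by (simp add: Gamma_fund_def heis_dist_def)
  qed
  then have "8 * pi * (1 / (8 * pi * D\<^sup>2)) \<le> 8 * pi * H \<xi>" by (rule mult_left_mono) simp
  then have HD: "8 * pi * H \<xi> \<ge> 1 / D\<^sup>2" by simp
  have D0: "1 / D\<^sup>2 > 0" using d dD by simp
  have hr: "1 / (harmonic_radius \<Omega> \<xi>)\<^sup>2 = 8 * pi * H \<xi>"
  proof -
    have "1 / (1 / sqrt X)\<^sup>2 = X" if "X > 0" for X :: real
      using that by (simp add: power_divide)
    moreover have "8 * pi * H \<xi> > 0" using less_le_trans[OF D0 HD] .
    ultimately show ?thesis unfolding harmonic_radius_def H_def[symmetric] by blast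
  qed
  define K where "K = 16 * sqrt 2 * C_heis\<^sup>2"
  have K: "K \<ge> 15.52"
  proof -
    have "C_heis\<^sup>2 = sqrt (3 / (2 * pi))"
    proof -
      have "(C_heis\<^sup>2)\<^sup>2 = 3 / (2 * pi)" by (simp add: C_heis_def flip: power_mult)
      then show ?thesis by (metis real_sqrt_abs abs_of_nonneg zero_le_power2)
    qed
    moreover have "sqrt 2 * sqrt (3 / (2 * pi)) = sqrt (2 * (3 / (2 * pi)))" by (rule real_sqrt_mult[symmetric])
    moreover have "2 * (3 / (2 * pi)) = 3 / pi" by simp
    ultimately have "K = 16 * sqrt (3 / pi)" unfolding K_def by (simp only: mult.assoc)
    moreover have "0.97 \<le> sqrt (3 / pi)"
    proof (rule real_le_rsqrt)
      show "0.97\<^sup>2 \<le> 3 / pi" using pi_approx by (simp add: field_simps power2_eq_square)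
    qed
    ultimately show ?thesis by simp
  qed
  \<comment> \<open>\<open>884.736 / (5.5 \<cdot> 0.894) < 180 < 15.52 \<cdot> 12\<close>\<close>
  have lam: "lambda1 \<Omega> \<le> 180 / d\<^sup>2"
  proof -
    \<comment> \<open>a ball strictly inside \<open>\<Omega>\<close>, so that the bump has compact support; the loss is within the numerical slack\<close>
    define c where "c = 4 / 5 * d ^ 4"
    have c: "c > 0" "c < d ^ 4" using d by (simp_all add: c_def)
    have "{q. ?N q \<le> c} \<subseteq> \<Omega>"
      by (rule gauge_ball_inside[OF assms(5)]) (use Nge c in force)
    from lambda1_le[OF \<Omega>(1) c(1) this]
    have "lambda1 \<Omega> \<le> 884.736 * exp (- 7 / 4) / sqrt c" .
    also have "\<dots> \<le> 884.736 * (1 / 5.5) / (0.894 * d\<^sup>2)"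
    proof (rule frac_le)
      \<comment> \<open>a quadratic Taylor polynomial is precise enough at the fourth part of the exponent\<close>
      have "1.5332 \<le> exp (7 / 16 :: real)"
        using exp_lower_Taylor_quadratic[of "7 / 16"] by (simp add: power2_eq_square)
      then have "1.5332 ^ 4 \<le> exp (7 / 16 :: real) ^ 4" by (rule power_mono) simp
      also have "\<dots> = exp (7 / 4)" by (simp add: exp_of_nat_mult[symmetric])
      finally have e: "5.5 \<le> exp (7 / 4 :: real)" by (simp add: eval_nat_numeral)
      have "exp (- 7 / 4 :: real) = exp (- (7 / 4))" by simp
      also have "\<dots> = 1 / exp (7 / 4)" by (simp only: exp_minus inverse_eq_divide)
      also have "\<dots> \<le> 1 / 5.5" using e by (intro divide_left_mono) auto
      finally show "884.736 * exp (- 7 / 4) \<le> 884.736 * (1 / 5.5 :: real)" by (rule mult_left_mono) simp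
    next
      show "0.894 * d\<^sup>2 \<le> sqrt c"
      proof (rule real_le_rsqrt)
        have "d ^ 4 = (d\<^sup>2)\<^sup>2" by (simp flip: power_mult)
        then have "(0.894 * d\<^sup>2)\<^sup>2 = 0.894\<^sup>2 * d ^ 4" by (simp only: power_mult_distrib)
        also have "\<dots> \<le> c" unfolding c_def by (rule mult_right_mono) (simp_all add: power2_eq_square)
        finally show "(0.894 * d\<^sup>2)\<^sup>2 \<le> c" .
      qed
    next
      show "0 \<le> 884.736 * (1 / 5.5 :: real)" by simp
      show "0 < 0.894 * d\<^sup>2" using d by simp
    qed
    also have "\<dots> = (884.736 * (1 / 5.5) / 0.894) / d\<^sup>2" by simp
    also have "\<dots> \<le> 180 / d\<^sup>2" by (rule divide_right_mono) simp_all
    finally show ?thesis .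
  qed
  have a: "alpha_ratio \<Omega> \<xi> = D / d" by (simp add: alpha_ratio_def dinf Dsup)
  have "180 / d\<^sup>2 \<le> K * (D / d) ^ 6 * l11\<^sup>2 * (8 * pi * H \<xi>)"
  proof -
    have r: "1 \<le> D / d" using d dD by simp
    have "1 / d\<^sup>2 \<le> (D / d) ^ 4 * (1 / d\<^sup>2)"
      using mult_right_mono[OF one_le_power[OF r, of 4], of "1 / d\<^sup>2"] by simp
    also have "\<dots> = (D / d) ^ 6 * (1 / D\<^sup>2)"
    proof -
      have "(D / d) ^ 6 = (D / d) ^ 4 * (D / d)\<^sup>2" by (simp flip: power_add)
      moreover have "(D / d)\<^sup>2 * (1 / D\<^sup>2) = 1 / d\<^sup>2" using d dD by (simp add: power_divide)
      ultimately show ?thesis by (simp only: mult.assoc)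
    qed
    also have "\<dots> \<le> (D / d) ^ 6 * (8 * pi * H \<xi>)"
      using HD r by (intro mult_left_mono) auto
    finally have 1: "1 / d\<^sup>2 \<le> (D / d) ^ 6 * (8 * pi * H \<xi>)" .
    have "180 / d\<^sup>2 = 180 * (1 / d\<^sup>2)" by simp
    also have "\<dots> \<le> (15.52 * 12) * (1 / d\<^sup>2)" by (rule mult_right_mono) simp_all
    also have "\<dots> \<le> (K * l11\<^sup>2) * ((D / d) ^ 6 * (8 * pi * H \<xi>))"
      using K l11_square_ge by (intro mult_mono 1) auto
    also have "\<dots> = K * (D / d) ^ 6 * l11\<^sup>2 * (8 * pi * H \<xi>)"
      by (simp only: mult.assoc mult.left_commute mult.commute)
    finally show ?thesis .
  qed
  with lam have "lambda1 \<Omega> \<le> K * (D / d) ^ 6 * l11\<^sup>2 * (1 / (harmonic_radius \<Omega> \<xi>)\<^sup>2)"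
    unfolding hr by (rule order_trans)
  also have "\<dots> = C_const \<Omega> \<xi> * l11\<^sup>2 / (harmonic_radius \<Omega> \<xi>)\<^sup>2"
  proof -
    have "(s * c) * b * l * (1 / r) = s * b * c * l / r" for s b c l r :: real by simp
    then show ?thesis unfolding C_const_def a K_def .
  qed
  finally show ?thesis .
qed

end
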